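(* Let $\mathcal A$ be an abelian category and $\mathcal T\subseteq\mathcal A$ a functorially finite full additive subcategory consisting of projective objects and closed under direct summands. Consider the following assertions: 1) For every object $T\in\mathcal T$, there is a monomorphism $T\rightarrowtail E$, where $E$ is an injective(-projective) object of $\mathcal A$ which belongs to $\mathcal T$. 2) For every $T\in\mathcal T\setminus\{0\}$, there is a non-zero morphism $\varphi:T\to T'$, with $T'\in\mathcal T$, which factors through an injective object of $\mathcal A$. 3) The pretriangulated category $\underline{\mathcal A}=\mathcal A/\langle\mathcal T\rangle$ is weakly balanced. 4) If $f:M\to N$ is an epimorphism in $\mathcal A$ such that $\ker(f)\in\mathcal T$ and every morphism $h:M\to T$ with $T\in\mathcal T$ vanishes on $\ker(f)$, then $f$ is an isomorphism in $\mathcal A$. 5) If $j:T\to M$ is a non-zero monomorphism in $\mathcal A$, with $T\in\mathcal T$, then there is a morphism $h:M\to T'$ such that $hj\neq 0$, for some $T'\in\mathcal T$. 6) If $N$ is an object of $\mathcal A$ such that the covariant functor $\mathrm{Ext}^1_{\mathcal A}(N,?)_{|\mathcal T}:\mathcal T\to\mathrm{Mod}\,\mathbf Z$ is non-zero, then $\mathrm{Ext}^1_{\mathcal A}(N,?)_{|\mathcal T}$ does not contain a non-zero representable subfunctor. Then $1)\Rightarrow 2)\Rightarrow 3)\Leftrightarrow 4)\Leftrightarrow 5)\Leftrightarrow 6)$ and, in case $\mathcal A$ has enough injectives, all assertions $2)$–$6)$ are equivalent.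
   Context: The stable category $\underline{\mathcal A}=\mathcal A/\langle\mathcal T\rangle$ is the quotient of $\mathcal A$ by the ideal of morphisms factoring through an object of $\mathcal T$; $\overline f$ denotes the class of $f$. A $\mathcal T$-preenvelope of $M$ is a morphism $M\to T^M$ with $T^M\in\mathcal T$ such that $\mathcal A(T^M,T)\to\mathcal A(M,T)$ is surjective for all $T\in\mathcal T$; a $\mathcal T$-precover $T_M\to M$ is the dual notion. $\mathcal T$ is functorially finite if every object of $\mathcal A$ has a $\mathcal T$-preenvelope and a $\mathcal T$-precover. In that case $\underline{\mathcal A}$ is pretriangulated: fix for each $M$ a right exact sequence $M\xrightarrow{i_M}T^M\to\Sigma M\to 0$ with $i_M$ a $\mathcal T$-preenvelope; for $f:L\to M$, the pushout of $i_L$ and $f$ gives $g:M\to N$, and, with the induced $h:N\to\Sigma L$ (vanishing on $M$ and agreeing with $T^L\to\Sigma L$ on $T^L$), a sequence $L\xrightarrow{\overline f}M\xrightarrow{\overline g}N\xrightarrow{\overline h}\Sigma L$; the right triangles are the sequences isomorphic in $\underline{\mathcal A}$ to these. Left triangles $\Omega N\to L\to M\to N$ are defined dually with precovers, kernels and pullbacks. $\underline{\mathcal A}$ is weakly balanced if a morphism $\alpha:M\to N$ of $\underline{\mathcal A}$ is an isomorphism whenever there exist a left triangle $\Omega N\to 0\to M\xrightarrow{\alpha}N$ and a right triangle $M\xrightarrow{\alpha}N\to 0\to\Sigma M$. In 1), $E$ is automatically projective since $\mathcal T$ consists of projectives. In 6), $\mathrm{Ext}^1$ is Yoneda's (possibly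 large) extension group, and a representable subfunctor means a subfunctor isomorphic to $\mathcal T(T,?)$ for some $T\in\mathcal T$. *)

theory Defs
  imports "HOL-Algebra.Coset"
begin

text \<open>
  Categories are given by carrier sets of objects and of arrows; every arrow carries its domain
  and codomain. Composition is written in the order of functions, and nothing is assumed about
  the operations outside the carriers or on non-composable arrows.
\<close>

record ('o, 'm) cat =
  Ob :: "'o set"
  Ar :: "'m set"
  Dom :: "'m \<Rightarrow> 'o"
  Cod :: "'m \<Rightarrow> 'o"
  Id :: "'o \<Rightarrow> 'm"
  Comp :: "'m \<Rightarrow> 'm \<Rightarrow> 'm"  (infixl "\<cdot>\<index>" 70)

record ('o, 'm) preadditive_cat = "('o, 'm) cat" +
  Plus :: "'m \<Rightarrow> 'm \<Rightarrow> 'm"  (infixl "\<boxplus>\<index>" 65)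
  Zero :: "'o \<Rightarrow> 'o \<Rightarrow> 'm"

definition Hom :: "('o, 'm, 'z) cat_scheme \<Rightarrow> 'o \<Rightarrow> 'o \<Rightarrow> 'm set" where
  "Hom C M N = {f \<in> Ar C. Dom C f = M \<and> Cod C f = N}"

locale category =
  fixes C :: "('o, 'm, 'z) cat_scheme" (structure)
  assumes Dom_in_Ob: "f \<in> Ar C \<Longrightarrow> Dom C f \<in> Ob C"
    and Cod_in_Ob: "f \<in> Ar C \<Longrightarrow> Cod C f \<in> Ob C"
    and Id_in_Hom: "M \<in> Ob C \<Longrightarrow> Id C M \<in> Hom C M M"
    and Comp_in_Hom: "\<lbrakk>f \<in> Hom C L M; g \<in> Hom C M N\<rbrakk> \<Longrightarrow> g \<cdot> f \<in> Hom C L N"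
    and Comp_Id_right: "f \<in> Hom C M N \<Longrightarrow> f \<cdot> Id C M = f"
    and Comp_Id_left: "f \<in> Hom C M N \<Longrightarrow> Id C N \<cdot> f = f"
    and Comp_assoc:
      "\<lbrakk>f \<in> Hom C K L; g \<in> Hom C L M; h \<in> Hom C M N\<rbrakk> \<Longrightarrow> (h \<cdot> g) \<cdot> f = h \<cdot> (g \<cdot> f)"

subsection \<open>Notions valid in any category\<close>

definition is_mono :: "('o, 'm, 'z) cat_scheme \<Rightarrow> 'm \<Rightarrow> bool" where
  "is_mono C f \<longleftrightarrow> f \<in> Ar C \<and>
     (\<forall>L\<in>Ob C. \<forall>u\<in>Hom C L (Dom C f). \<forall>v\<in>Hom C L (Dom C f).
        f \<cdot>\<^bsub>C\<^esub> u = f \<cdot>\<^bsub>C\<^esub> v \<longrightarrow> u = v)"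

definition is_epi :: "('o, 'm, 'z) cat_scheme \<Rightarrow> 'm \<Rightarrow> bool" where
  "is_epi C f \<longleftrightarrow> f \<in> Ar C \<and>
     (\<forall>L\<in>Ob C. \<forall>u\<in>Hom C (Cod C f) L. \<forall>v\<in>Hom C (Cod C f) L.
        u \<cdot>\<^bsub>C\<^esub> f = v \<cdot>\<^bsub>C\<^esub> f \<longrightarrow> u = v)"

definition is_iso :: "('o, 'm, 'z) cat_scheme \<Rightarrow> 'm \<Rightarrow> bool" where
  "is_iso C f \<longleftrightarrow> f \<in> Ar C \<and>
     (\<exists>g\<in>Hom C (Cod C f) (Dom C f).
        g \<cdot>\<^bsub>C\<^esub> f = Id C (Dom C f) \<and> f \<cdot>\<^bsub>C\<^esub> g = Id C (Cod C f))"

definition is_zero_object :: "('o, 'm, 'z) cat_scheme \<Rightarrow> 'o \<Rightarrow> bool" where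
  "is_zero_object C Z \<longleftrightarrow> Z \<in> Ob C \<and>
     (\<forall>M\<in>Ob C. (\<exists>!f. f \<in> Hom C Z M) \<and> (\<exists>!f. f \<in> Hom C M Z))"

definition is_projective :: "('o, 'm, 'z) cat_scheme \<Rightarrow> 'o \<Rightarrow> bool" where
  "is_projective C P \<longleftrightarrow> P \<in> Ob C \<and>
     (\<forall>e f. is_epi C e \<and> f \<in> Hom C P (Cod C e) \<longrightarrow>
        (\<exists>g\<in>Hom C P (Dom C e). e \<cdot>\<^bsub>C\<^esub> g = f))"

definition is_injective :: "('o, 'm, 'z) cat_scheme \<Rightarrow> 'o \<Rightarrow> bool" where
  "is_injective C E \<longleftrightarrow> E \<in> Ob C \<and>
     (\<forall>m f. is_mono C m \<and> f \<in> Hom C (Dom C m) E \<longrightarrow>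
        (\<exists>g\<in>Hom C (Cod C m) E. g \<cdot>\<^bsub>C\<^esub> m = f))"

definition enough_injectives :: "('o, 'm, 'z) cat_scheme \<Rightarrow> bool" where
  "enough_injectives C \<longleftrightarrow>
     (\<forall>M\<in>Ob C. \<exists>E. is_injective C E \<and> (\<exists>m\<in>Hom C M E. is_mono C m))"

text \<open>\<open>is_pushout C f g u v\<close>: the square \<open>u f = v g\<close> is a pushout of the span \<open>(f, g)\<close>.\<close>

definition is_pushout :: "('o, 'm, 'z) cat_scheme \<Rightarrow> 'm \<Rightarrow> 'm \<Rightarrow> 'm \<Rightarrow> 'm \<Rightarrow> bool" where
  "is_pushout C f g u v \<longleftrightarrow>
     f \<in> Ar C \<and> g \<in> Ar C \<and> u \<in> Ar C \<and> v \<in> Ar C \<and>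
     Dom C f = Dom C g \<and> Dom C u = Cod C f \<and> Dom C v = Cod C g \<and> Cod C u = Cod C v \<and>
     u \<cdot>\<^bsub>C\<^esub> f = v \<cdot>\<^bsub>C\<^esub> g \<and>
     (\<forall>X\<in>Ob C. \<forall>a\<in>Hom C (Cod C f) X. \<forall>b\<in>Hom C (Cod C g) X.
        a \<cdot>\<^bsub>C\<^esub> f = b \<cdot>\<^bsub>C\<^esub> g \<longrightarrow>
        (\<exists>!w. w \<in> Hom C (Cod C u) X \<and> w \<cdot>\<^bsub>C\<^esub> u = a \<and> w \<cdot>\<^bsub>C\<^esub> v = b))"

text \<open>\<open>is_pullback C f g u v\<close>: the square \<open>f u = g v\<close> is a pullback of the cospan \<open>(f, g)\<close>.\<close>

definition is_pullback :: "('o, 'm, 'z) cat_scheme \<Rightarrow> 'm \<Rightarrow> 'm \<Rightarrow> 'm \<Rightarrow> 'm \<Rightarrow> bool" where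
  "is_pullback C f g u v \<longleftrightarrow>
     f \<in> Ar C \<and> g \<in> Ar C \<and> u \<in> Ar C \<and> v \<in> Ar C \<and>
     Cod C f = Cod C g \<and> Cod C u = Dom C f \<and> Cod C v = Dom C g \<and> Dom C u = Dom C v \<and>
     f \<cdot>\<^bsub>C\<^esub> u = g \<cdot>\<^bsub>C\<^esub> v \<and>
     (\<forall>X\<in>Ob C. \<forall>a\<in>Hom C X (Dom C f). \<forall>b\<in>Hom C X (Dom C g).
        f \<cdot>\<^bsub>C\<^esub> a = g \<cdot>\<^bsub>C\<^esub> b \<longrightarrow>
        (\<exists>!w. w \<in> Hom C X (Dom C u) \<and> u \<cdot>\<^bsub>C\<^esub> w = a \<and> v \<cdot>\<^bsub>C\<^esub> w = b))"

subsection \<open>Preadditive, additive and abelian categories\<close>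

definition hom_group :: "('o, 'm, 'z) preadditive_cat_scheme \<Rightarrow> 'o \<Rightarrow> 'o \<Rightarrow> 'm monoid" where
  "hom_group C M N = \<lparr>carrier = Hom C M N, mult = Plus C, one = Zero C M N\<rparr>"

locale preadditive_category = category C
  for C :: "('o, 'm, 'z) preadditive_cat_scheme" (structure) +
  assumes comm_group_hom_group:
      "\<lbrakk>M \<in> Ob C; N \<in> Ob C\<rbrakk> \<Longrightarrow> comm_group (hom_group C M N)"
    and Comp_Plus_right:
      "\<lbrakk>f \<in> Hom C L M; f' \<in> Hom C L M; g \<in> Hom C M N\<rbrakk> \<Longrightarrow> g \<cdot> (f \<boxplus> f') = (g \<cdot> f) \<boxplus> (g \<cdot> f')"
    and Comp_Plus_left:
      "\<lbrakk>f \<in> Hom C L M; g \<in> Hom C M N; g' \<in> Hom C M N\<rbrakk> \<Longrightarrow> (g \<boxplus> g') \<cdot> f = (g \<cdot> f) \<boxplus> (g' \<cdot> f)"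

text \<open>The biproduct object of \<open>M\<close> and \<open>N\<close> is the common codomain of the injections.\<close>

definition is_biproduct ::
  "('o, 'm, 'z) preadditive_cat_scheme \<Rightarrow> 'o \<Rightarrow> 'o \<Rightarrow> 'm \<Rightarrow> 'm \<Rightarrow> 'm \<Rightarrow> 'm \<Rightarrow> bool" where
  "is_biproduct C M N i\<^sub>1 i\<^sub>2 p\<^sub>1 p\<^sub>2 \<longleftrightarrow>
     (\<exists>P\<in>Ob C. i\<^sub>1 \<in> Hom C M P \<and> i\<^sub>2 \<in> Hom C N P \<and> p\<^sub>1 \<in> Hom C P M \<and> p\<^sub>2 \<in> Hom C P N \<and>
        p\<^sub>1 \<cdot>\<^bsub>C\<^esub> i\<^sub>1 = Id C M \<and> p\<^sub>2 \<cdot>\<^bsub>C\<^esub> i\<^sub>2 = Id C N \<and>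
        p\<^sub>1 \<cdot>\<^bsub>C\<^esub> i\<^sub>2 = Zero C N M \<and> p\<^sub>2 \<cdot>\<^bsub>C\<^esub> i\<^sub>1 = Zero C M N \<and>
        (i\<^sub>1 \<cdot>\<^bsub>C\<^esub> p\<^sub>1) \<boxplus>\<^bsub>C\<^esub> (i\<^sub>2 \<cdot>\<^bsub>C\<^esub> p\<^sub>2) = Id C P)"

definition is_kernel :: "('o, 'm, 'z) preadditive_cat_scheme \<Rightarrow> 'm \<Rightarrow> 'm \<Rightarrow> bool" where
  "is_kernel C f k \<longleftrightarrow> f \<in> Ar C \<and> k \<in> Ar C \<and> Cod C k = Dom C f \<and>
     f \<cdot>\<^bsub>C\<^esub> k = Zero C (Dom C k) (Cod C f) \<and>
     (\<forall>X\<in>Ob C. \<forall>g\<in>Hom C X (Dom C f). f \<cdot>\<^bsub>C\<^esub> g = Zero C X (Cod C f) \<longrightarrow>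
        (\<exists>!w. w \<in> Hom C X (Dom C k) \<and> k \<cdot>\<^bsub>C\<^esub> w = g))"

definition is_cokernel :: "('o, 'm, 'z) preadditive_cat_scheme \<Rightarrow> 'm \<Rightarrow> 'm \<Rightarrow> bool" where
  "is_cokernel C f q \<longleftrightarrow> f \<in> Ar C \<and> q \<in> Ar C \<and> Dom C q = Cod C f \<and>
     q \<cdot>\<^bsub>C\<^esub> f = Zero C (Dom C f) (Cod C q) \<and>
     (\<forall>X\<in>Ob C. \<forall>g\<in>Hom C (Cod C f) X. g \<cdot>\<^bsub>C\<^esub> f = Zero C (Dom C f) X \<longrightarrow>
        (\<exists>!w. w \<in> Hom C (Cod C q) X \<and> w \<cdot>\<^bsub>C\<^esub> q = g))"

locale additive_category = preadditive_category +
  assumes ex_zero_object: "\<exists>Z. is_zero_object C Z"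
    and ex_biproduct:
      "\<lbrakk>M \<in> Ob C; N \<in> Ob C\<rbrakk> \<Longrightarrow> \<exists>i\<^sub>1 i\<^sub>2 p\<^sub>1 p\<^sub>2. is_biproduct C M N i\<^sub>1 i\<^sub>2 p\<^sub>1 p\<^sub>2"

locale abelian_category = additive_category +
  assumes ex_kernel: "f \<in> Ar C \<Longrightarrow> \<exists>k. is_kernel C f k"
    and ex_cokernel: "f \<in> Ar C \<Longrightarrow> \<exists>q. is_cokernel C f q"
    and mono_is_kernel: "is_mono C f \<Longrightarrow> \<exists>g. is_kernel C g f"
    and epi_is_cokernel: "is_epi C f \<Longrightarrow> \<exists>g. is_cokernel C g f"

subsection \<open>Full subcategories, preenvelopes and precovers\<close>

text \<open>A full subcategory is given by its set of objects.\<close>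

definition full_additive_subcategory ::
  "('o, 'm, 'z) preadditive_cat_scheme \<Rightarrow> 'o set \<Rightarrow> bool" where
  "full_additive_subcategory C \<T> \<longleftrightarrow> \<T> \<subseteq> Ob C \<and> (\<exists>Z\<in>\<T>. is_zero_object C Z) \<and>
     (\<forall>M\<in>\<T>. \<forall>N\<in>\<T>. \<exists>i\<^sub>1 i\<^sub>2 p\<^sub>1 p\<^sub>2. is_biproduct C M N i\<^sub>1 i\<^sub>2 p\<^sub>1 p\<^sub>2 \<and> Cod C i\<^sub>1 \<in> \<T>)"

definition closed_under_summands ::
  "('o, 'm, 'z) preadditive_cat_scheme \<Rightarrow> 'o set \<Rightarrow> bool" where
  "closed_under_summands C \<T> \<longleftrightarrow>
     (\<forall>M\<in>Ob C. \<forall>N\<in>Ob C. \<forall>i\<^sub>1 i\<^sub>2 p\<^sub>1 p\<^sub>2.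
        is_biproduct C M N i\<^sub>1 i\<^sub>2 p\<^sub>1 p\<^sub>2 \<and> Cod C i\<^sub>1 \<in> \<T> \<longrightarrow> M \<in> \<T>)"

definition is_preenvelope :: "('o, 'm, 'z) cat_scheme \<Rightarrow> 'o set \<Rightarrow> 'o \<Rightarrow> 'm \<Rightarrow> bool" where
  "is_preenvelope C \<T> M i \<longleftrightarrow> i \<in> Ar C \<and> Dom C i = M \<and> Cod C i \<in> \<T> \<and>
     (\<forall>T\<in>\<T>. \<forall>f\<in>Hom C M T. \<exists>g\<in>Hom C (Cod C i) T. g \<cdot>\<^bsub>C\<^esub> i = f)"

definition is_precover :: "('o, 'm, 'z) cat_scheme \<Rightarrow> 'o set \<Rightarrow> 'o \<Rightarrow> 'm \<Rightarrow> bool" where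
  "is_precover C \<T> M p \<longleftrightarrow> p \<in> Ar C \<and> Cod C p = M \<and> Dom C p \<in> \<T> \<and>
     (\<forall>T\<in>\<T>. \<forall>f\<in>Hom C T M. \<exists>g\<in>Hom C T (Dom C p). p \<cdot>\<^bsub>C\<^esub> g = f)"

definition functorially_finite :: "('o, 'm, 'z) cat_scheme \<Rightarrow> 'o set \<Rightarrow> bool" where
  "functorially_finite C \<T> \<longleftrightarrow>
     (\<forall>M\<in>Ob C. (\<exists>i. is_preenvelope C \<T> M i) \<and> (\<exists>p. is_precover C \<T> M p))"

subsection \<open>The stable category\<close>

definition factoring_arrows :: "('o, 'm, 'z) cat_scheme \<Rightarrow> 'o set \<Rightarrow> 'o \<Rightarrow> 'o \<Rightarrow> 'm set" where
  "factoring_arrows C \<T> M N = {v \<cdot>\<^bsub>C\<^esub> u | u v. \<exists>T\<in>\<T>. u \<in> Hom C M T \<and> v \<in> Hom C T N}"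

definition stable_class :: "('o, 'm, 'z) preadditive_cat_scheme \<Rightarrow> 'o set \<Rightarrow> 'm \<Rightarrow> 'm set" where
  "stable_class C \<T> f =
     factoring_arrows C \<T> (Dom C f) (Cod C f) #>\<^bsub>hom_group C (Dom C f) (Cod C f)\<^esub> f"

definition stable_category ::
  "('o, 'm, 'z) preadditive_cat_scheme \<Rightarrow> 'o set \<Rightarrow> ('o, 'm set) preadditive_cat" where
  "stable_category C \<T> =
     (let rep = (\<lambda>X. SOME f. f \<in> X) in
      \<lparr>Ob = Ob C,
       Ar = stable_class C \<T> ` Ar C,
       Dom = (\<lambda>X. Dom C (rep X)),
       Cod = (\<lambda>X. Cod C (rep X)),
       Id = (\<lambda>M. stable_class C \<T> (Id C M)),
       Comp = (\<lambda>Y X. stable_class C \<T> (rep Y \<cdot>\<^bsub>C\<^esub> rep X)),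
       Plus = (\<lambda>X Y. stable_class C \<T> (rep X \<boxplus>\<^bsub>C\<^esub> rep Y)),
       Zero = (\<lambda>M N. stable_class C \<T> (Zero C M N))\<rparr>)"

subsection \<open>Triangles in the stable category\<close>

text \<open>
  The functions \<open>i\<close> and \<open>q\<close> record the chosen right exact sequences
  \<open>M \<rightarrow> T\<^sup>M \<rightarrow> \<Sigma>M \<rightarrow> 0\<close>, so that \<open>\<Sigma>M\<close> is the codomain of \<open>q M\<close>. Dually, \<open>k\<close> and \<open>p\<close> record
  the chosen left exact sequences \<open>0 \<rightarrow> \<Omega>M \<rightarrow> T\<^sub>M \<rightarrow> M\<close>, so that \<open>\<Omega>M\<close> is the domain of \<open>k M\<close>.
\<close>

definition preenvelope_choice ::
  "('o, 'm, 'z) preadditive_cat_scheme \<Rightarrow> 'o set \<Rightarrow> ('o \<Rightarrow> 'm) \<Rightarrow> ('o \<Rightarrow> 'm) \<Rightarrow> bool" where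
  "preenvelope_choice C \<T> i q \<longleftrightarrow>
     (\<forall>M\<in>Ob C. is_preenvelope C \<T> M (i M) \<and> is_cokernel C (i M) (q M))"

definition precover_choice ::
  "('o, 'm, 'z) preadditive_cat_scheme \<Rightarrow> 'o set \<Rightarrow> ('o \<Rightarrow> 'm) \<Rightarrow> ('o \<Rightarrow> 'm) \<Rightarrow> bool" where
  "precover_choice C \<T> k p \<longleftrightarrow>
     (\<forall>M\<in>Ob C. is_precover C \<T> M (p M) \<and> is_kernel C (p M) (k M))"

text \<open>
  The actions of \<open>\<Sigma>\<close> and \<open>\<Omega>\<close> on arrows of the stable category: lift a representative
  to the chosen sequences and take the class of the induced arrow. This class depends neither on
  the representative nor on the lift.
\<close>

definition Susp ::
  "('o, 'm, 'z) preadditive_cat_scheme \<Rightarrow> 'o set \<Rightarrow> ('o \<Rightarrow> 'm) \<Rightarrow> ('o \<Rightarrow> 'm) \<Rightarrow> 'm set \<Rightarrow> 'm set" where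
  "Susp C \<T> i q X = (THE Y. \<exists>a t s. a \<in> X \<and>
     t \<in> Hom C (Cod C (i (Dom C a))) (Cod C (i (Cod C a))) \<and>
     s \<in> Hom C (Cod C (q (Dom C a))) (Cod C (q (Cod C a))) \<and>
     t \<cdot>\<^bsub>C\<^esub> i (Dom C a) = i (Cod C a) \<cdot>\<^bsub>C\<^esub> a \<and>
     s \<cdot>\<^bsub>C\<^esub> q (Dom C a) = q (Cod C a) \<cdot>\<^bsub>C\<^esub> t \<and>
     Y = stable_class C \<T> s)"

definition Loop ::
  "('o, 'm, 'z) preadditive_cat_scheme \<Rightarrow> 'o set \<Rightarrow> ('o \<Rightarrow> 'm) \<Rightarrow> ('o \<Rightarrow> 'm) \<Rightarrow> 'm set \<Rightarrow> 'm set" where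
  "Loop C \<T> k p X = (THE Y. \<exists>a t s. a \<in> X \<and>
     t \<in> Hom C (Dom C (p (Dom C a))) (Dom C (p (Cod C a))) \<and>
     s \<in> Hom C (Dom C (k (Dom C a))) (Dom C (k (Cod C a))) \<and>
     p (Cod C a) \<cdot>\<^bsub>C\<^esub> t = a \<cdot>\<^bsub>C\<^esub> p (Dom C a) \<and>
     k (Cod C a) \<cdot>\<^bsub>C\<^esub> s = t \<cdot>\<^bsub>C\<^esub> k (Dom C a) \<and>
     Y = stable_class C \<T> s)"

definition standard_right_triangle ::
  "('o, 'm, 'z) preadditive_cat_scheme \<Rightarrow> ('o \<Rightarrow> 'm) \<Rightarrow> ('o \<Rightarrow> 'm) \<Rightarrow> 'm \<Rightarrow> 'm \<Rightarrow> 'm \<Rightarrow> bool" where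
  "standard_right_triangle C i q f g h \<longleftrightarrow> (\<exists>v.
     is_pushout C (i (Dom C f)) f v g \<and>
     h \<in> Hom C (Cod C g) (Cod C (q (Dom C f))) \<and>
     h \<cdot>\<^bsub>C\<^esub> g = Zero C (Cod C f) (Cod C (q (Dom C f))) \<and>
     h \<cdot>\<^bsub>C\<^esub> v = q (Dom C f))"

definition standard_left_triangle ::
  "('o, 'm, 'z) preadditive_cat_scheme \<Rightarrow> ('o \<Rightarrow> 'm) \<Rightarrow> ('o \<Rightarrow> 'm) \<Rightarrow> 'm \<Rightarrow> 'm \<Rightarrow> 'm \<Rightarrow> bool" where
  "standard_left_triangle C k p h g f \<longleftrightarrow> (\<exists>v.
     is_pullback C (p (Cod C f)) f v g \<and>
     h \<in> Hom C (Dom C (k (Cod C f))) (Dom C g) \<and>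
     g \<cdot>\<^bsub>C\<^esub> h = Zero C (Dom C (k (Cod C f))) (Dom C f) \<and>
     v \<cdot>\<^bsub>C\<^esub> h = k (Cod C f))"

text \<open>
  Right triangles \<open>L \<rightarrow> M \<rightarrow> N \<rightarrow> \<Sigma>L\<close> with arrows \<open>x\<close>, \<open>y\<close>, \<open>z\<close>, and left triangles
  \<open>\<Omega>N \<rightarrow> L \<rightarrow> M \<rightarrow> N\<close> with arrows \<open>z\<close>, \<open>y\<close>, \<open>x\<close>. An isomorphism of such sequences is
  \<open>(a, b, c, \<Sigma>a)\<close>, respectively \<open>(\<Omega>c, a, b, c)\<close>.
\<close>

definition right_triangle ::
  "('o, 'm, 'z) preadditive_cat_scheme \<Rightarrow> 'o set \<Rightarrow> ('o \<Rightarrow> 'm) \<Rightarrow> ('o \<Rightarrow> 'm) \<Rightarrow>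
    'm set \<Rightarrow> 'm set \<Rightarrow> 'm set \<Rightarrow> bool" where
  "right_triangle C \<T> i q x y z \<longleftrightarrow>
     (let S = stable_category C \<T>; cl = stable_class C \<T> in
      \<exists>L\<in>Ob C. \<exists>M\<in>Ob C. \<exists>N\<in>Ob C.
        x \<in> Hom S L M \<and> y \<in> Hom S M N \<and> z \<in> Hom S N (Cod C (q L)) \<and>
        (\<exists>f g h a b c. standard_right_triangle C i q f g h \<and>
           a \<in> Hom S L (Dom C f) \<and> b \<in> Hom S M (Cod C f) \<and> c \<in> Hom S N (Cod C g) \<and>
           is_iso S a \<and> is_iso S b \<and> is_iso S c \<and>
           b \<cdot>\<^bsub>S\<^esub> x = cl f \<cdot>\<^bsub>S\<^esub> a \<and>
           c \<cdot>\<^bsub>S\<^esub> y = cl g \<cdot>\<^bsub>S\<^esub> b \<and>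
           Susp C \<T> i q a \<cdot>\<^bsub>S\<^esub> z = cl h \<cdot>\<^bsub>S\<^esub> c))"

definition left_triangle ::
  "('o, 'm, 'z) preadditive_cat_scheme \<Rightarrow> 'o set \<Rightarrow> ('o \<Rightarrow> 'm) \<Rightarrow> ('o \<Rightarrow> 'm) \<Rightarrow>
    'm set \<Rightarrow> 'm set \<Rightarrow> 'm set \<Rightarrow> bool" where
  "left_triangle C \<T> k p z y x \<longleftrightarrow>
     (let S = stable_category C \<T>; cl = stable_class C \<T> in
      \<exists>L\<in>Ob C. \<exists>M\<in>Ob C. \<exists>N\<in>Ob C.
        z \<in> Hom S (Dom C (k N)) L \<and> y \<in> Hom S L M \<and> x \<in> Hom S M N \<and>
        (\<exists>f g h a b c. standard_left_triangle C k p h g f \<and>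
           a \<in> Hom S L (Dom C g) \<and> b \<in> Hom S M (Dom C f) \<and> c \<in> Hom S N (Cod C f) \<and>
           is_iso S a \<and> is_iso S b \<and> is_iso S c \<and>
           a \<cdot>\<^bsub>S\<^esub> z = cl h \<cdot>\<^bsub>S\<^esub> Loop C \<T> k p c \<and>
           b \<cdot>\<^bsub>S\<^esub> y = cl g \<cdot>\<^bsub>S\<^esub> a \<and>
           c \<cdot>\<^bsub>S\<^esub> x = cl f \<cdot>\<^bsub>S\<^esub> b))"

definition weakly_balanced ::
  "('o, 'm, 'z) preadditive_cat_scheme \<Rightarrow> 'o set \<Rightarrow>
    ('o \<Rightarrow> 'm) \<Rightarrow> ('o \<Rightarrow> 'm) \<Rightarrow> ('o \<Rightarrow> 'm) \<Rightarrow> ('o \<Rightarrow> 'm) \<Rightarrow> bool" where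
  "weakly_balanced C \<T> i q k p \<longleftrightarrow>
     (let S = stable_category C \<T> in
      \<forall>\<alpha>\<in>Ar S.
        (\<exists>z y. left_triangle C \<T> k p z y \<alpha> \<and> is_zero_object S (Dom S y)) \<and>
        (\<exists>y z. right_triangle C \<T> i q \<alpha> y z \<and> is_zero_object S (Cod S y))
        \<longrightarrow> is_iso S \<alpha>)"

subsection \<open>Yoneda extensions\<close>

text \<open>An extension \<open>0 \<rightarrow> T \<rightarrow> E \<rightarrow> N \<rightarrow> 0\<close> is represented by its pair of non-trivial arrows.\<close>

fun is_extension :: "('o, 'm, 'z) preadditive_cat_scheme \<Rightarrow> 'o \<Rightarrow> 'o \<Rightarrow> 'm \<times> 'm \<Rightarrow> bool" where
  "is_extension C N T (j, r) \<longleftrightarrow>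
     is_kernel C r j \<and> is_cokernel C j r \<and> Dom C j = T \<and> Cod C r = N"

definition extension_rel ::
  "('o, 'm, 'z) preadditive_cat_scheme \<Rightarrow> 'o \<Rightarrow> 'o \<Rightarrow> (('m \<times> 'm) \<times> ('m \<times> 'm)) set" where
  "extension_rel C N T =
     {((j, r), (j', r')). is_extension C N T (j, r) \<and> is_extension C N T (j', r') \<and>
        (\<exists>u\<in>Hom C (Cod C j) (Cod C j'). is_iso C u \<and> u \<cdot>\<^bsub>C\<^esub> j = j' \<and> r' \<cdot>\<^bsub>C\<^esub> u = r)}"

text \<open>\<open>is_pushout_extension C a e e'\<close>: the extension \<open>e'\<close> is obtained from \<open>e\<close> by pushout along
  the arrow \<open>a\<close> out of the left end; dually for \<open>is_pullback_extension\<close>.\<close>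

fun is_pushout_extension ::
  "('o, 'm, 'z) preadditive_cat_scheme \<Rightarrow> 'm \<Rightarrow> 'm \<times> 'm \<Rightarrow> 'm \<times> 'm \<Rightarrow> bool" where
  "is_pushout_extension C a (j, r) (j', r') \<longleftrightarrow>
     (\<exists>u. is_pushout C j a u j' \<and> r' \<in> Hom C (Cod C u) (Cod C r) \<and>
        r' \<cdot>\<^bsub>C\<^esub> u = r \<and> r' \<cdot>\<^bsub>C\<^esub> j' = Zero C (Cod C a) (Cod C r))"

fun is_pullback_extension ::
  "('o, 'm, 'z) preadditive_cat_scheme \<Rightarrow> 'm \<Rightarrow> 'm \<times> 'm \<Rightarrow> 'm \<times> 'm \<Rightarrow> bool" where
  "is_pullback_extension C b (j, r) (j', r') \<longleftrightarrow>
     (\<exists>u. is_pullback C r b u r' \<and> j' \<in> Hom C (Dom C j) (Dom C u) \<and>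
        u \<cdot>\<^bsub>C\<^esub> j' = j \<and> r' \<cdot>\<^bsub>C\<^esub> j' = Zero C (Dom C j) (Dom C b))"

text \<open>
  The Baer sum of two extensions of \<open>N\<close> by \<open>T\<close>: pull the extension \<open>(j \<oplus> j', r \<oplus> r')\<close> of
  \<open>N \<oplus> N\<close> by \<open>T \<oplus> T\<close> back along the diagonal \<open>n\<^sub>1 + n\<^sub>2\<close> of \<open>N\<close>, and push the result out along the
  codiagonal \<open>s\<^sub>1 + s\<^sub>2\<close> of \<open>T\<close>.
\<close>

fun is_Baer_sum ::
  "('o, 'm, 'z) preadditive_cat_scheme \<Rightarrow> 'm \<times> 'm \<Rightarrow> 'm \<times> 'm \<Rightarrow> 'm \<times> 'm \<Rightarrow> bool" where
  "is_Baer_sum C (j, r) (j', r') e \<longleftrightarrow>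
     (\<exists>t\<^sub>1 t\<^sub>2 s\<^sub>1 s\<^sub>2 e\<^sub>1 e\<^sub>2 d\<^sub>1 d\<^sub>2 n\<^sub>1 n\<^sub>2 m\<^sub>1 m\<^sub>2 e'.
        is_biproduct C (Dom C j) (Dom C j') t\<^sub>1 t\<^sub>2 s\<^sub>1 s\<^sub>2 \<and>
        is_biproduct C (Cod C j) (Cod C j') e\<^sub>1 e\<^sub>2 d\<^sub>1 d\<^sub>2 \<and>
        is_biproduct C (Cod C r) (Cod C r') n\<^sub>1 n\<^sub>2 m\<^sub>1 m\<^sub>2 \<and>
        is_pullback_extension C (n\<^sub>1 \<boxplus>\<^bsub>C\<^esub> n\<^sub>2)
          ((e\<^sub>1 \<cdot>\<^bsub>C\<^esub> j \<cdot>\<^bsub>C\<^esub> s\<^sub>1) \<boxplus>\<^bsub>C\<^esub> (e\<^sub>2 \<cdot>\<^bsub>C\<^esub> j' \<cdot>\<^bsub>C\<^esub> s\<^sub>2),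
           (n\<^sub>1 \<cdot>\<^bsub>C\<^esub> r \<cdot>\<^bsub>C\<^esub> d\<^sub>1) \<boxplus>\<^bsub>C\<^esub> (n\<^sub>2 \<cdot>\<^bsub>C\<^esub> r' \<cdot>\<^bsub>C\<^esub> d\<^sub>2)) e' \<and>
        is_pushout_extension C (s\<^sub>1 \<boxplus>\<^bsub>C\<^esub> s\<^sub>2) e' e)"

text \<open>
  The group \<open>Ext\<^sup>1(N, T)\<close>. Pushouts and pullbacks are only determined up to isomorphism, so the set
  of all Baer sums of members of two classes is again a full equivalence class; the same applies
  to \<open>Ext_map\<close>. The neutral element is the class of split extensions.
\<close>

definition Ext_group ::
  "('o, 'm, 'z) preadditive_cat_scheme \<Rightarrow> 'o \<Rightarrow> 'o \<Rightarrow> ('m \<times> 'm) set monoid" where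
  "Ext_group C N T =
     \<lparr>carrier = {e. is_extension C N T e} // extension_rel C N T,
      mult = (\<lambda>X Y. {e. \<exists>x\<in>X. \<exists>y\<in>Y. is_Baer_sum C x y e}),
      one = {(j, r). \<exists>s d. is_biproduct C T N j s d r}\<rparr>"

definition Ext_map ::
  "('o, 'm, 'z) preadditive_cat_scheme \<Rightarrow> 'm \<Rightarrow> ('m \<times> 'm) set \<Rightarrow> ('m \<times> 'm) set" where
  "Ext_map C a X = {e. \<exists>x\<in>X. is_pushout_extension C a x e}"

definition Ext_subfunctor ::
  "('o, 'm, 'z) preadditive_cat_scheme \<Rightarrow> 'o set \<Rightarrow> 'o \<Rightarrow> ('o \<Rightarrow> ('m \<times> 'm) set set) \<Rightarrow> bool" where
  "Ext_subfunctor C \<T> N F \<longleftrightarrow>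
     (\<forall>T\<in>\<T>. subgroup (F T) (Ext_group C N T)) \<and>
     (\<forall>T\<in>\<T>. \<forall>T'\<in>\<T>. \<forall>a\<in>Hom C T T'. Ext_map C a ` F T \<subseteq> F T')"

definition iso_to_representable ::
  "('o, 'm, 'z) preadditive_cat_scheme \<Rightarrow> 'o set \<Rightarrow> 'o \<Rightarrow> ('o \<Rightarrow> ('m \<times> 'm) set set) \<Rightarrow> 'o \<Rightarrow> bool" where
  "iso_to_representable C \<T> N F T\<^sub>0 \<longleftrightarrow>
     (\<exists>\<eta>. (\<forall>T\<in>\<T>. \<eta> T \<in> iso (hom_group C T\<^sub>0 T) (Ext_group C N T\<lparr>carrier := F T\<rparr>)) \<and>
          (\<forall>T\<in>\<T>. \<forall>T'\<in>\<T>. \<forall>a\<in>Hom C T T'. \<forall>x\<in>Hom C T\<^sub>0 T.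
             \<eta> T' (a \<cdot>\<^bsub>C\<^esub> x) = Ext_map C a (\<eta> T x)))"

subsection \<open>The assertions\<close>

definition embeds_in_injectives :: "('o, 'm, 'z) cat_scheme \<Rightarrow> 'o set \<Rightarrow> bool" where
  "embeds_in_injectives C \<T> \<longleftrightarrow>
     (\<forall>T\<in>\<T>. \<exists>E\<in>\<T>. is_injective C E \<and> (\<exists>m\<in>Hom C T E. is_mono C m))"

definition nonzero_through_injective ::
  "('o, 'm, 'z) preadditive_cat_scheme \<Rightarrow> 'o set \<Rightarrow> bool" where
  "nonzero_through_injective C \<T> \<longleftrightarrow>
     (\<forall>T\<in>\<T>. \<not> is_zero_object C T \<longrightarrow>
        (\<exists>T'\<in>\<T>. \<exists>\<phi>\<in>Hom C T T'. \<phi> \<noteq> Zero C T T' \<and>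
           (\<exists>E. is_injective C E \<and> (\<exists>u\<in>Hom C T E. \<exists>v\<in>Hom C E T'. \<phi> = v \<cdot>\<^bsub>C\<^esub> u))))"

definition epi_with_invisible_kernel_iso ::
  "('o, 'm, 'z) preadditive_cat_scheme \<Rightarrow> 'o set \<Rightarrow> bool" where
  "epi_with_invisible_kernel_iso C \<T> \<longleftrightarrow>
     (\<forall>M\<in>Ob C. \<forall>N\<in>Ob C. \<forall>f\<in>Hom C M N. \<forall>l.
        is_epi C f \<and> is_kernel C f l \<and> Dom C l \<in> \<T> \<and>
        (\<forall>T\<in>\<T>. \<forall>h\<in>Hom C M T. h \<cdot>\<^bsub>C\<^esub> l = Zero C (Dom C l) T)
        \<longrightarrow> is_iso C f)"

definition nonzero_mono_detected ::
  "('o, 'm, 'z) preadditive_cat_scheme \<Rightarrow> 'o set \<Rightarrow> bool" where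
  "nonzero_mono_detected C \<T> \<longleftrightarrow>
     (\<forall>T\<in>\<T>. \<forall>M\<in>Ob C. \<forall>j\<in>Hom C T M. is_mono C j \<and> j \<noteq> Zero C T M \<longrightarrow>
        (\<exists>T'\<in>\<T>. \<exists>h\<in>Hom C M T'. h \<cdot>\<^bsub>C\<^esub> j \<noteq> Zero C T T'))"

definition no_representable_Ext_subfunctor ::
  "('o, 'm, 'z) preadditive_cat_scheme \<Rightarrow> 'o set \<Rightarrow> bool" where
  "no_representable_Ext_subfunctor C \<T> \<longleftrightarrow>
     (\<forall>N\<in>Ob C.
        (\<exists>T\<in>\<T>. carrier (Ext_group C N T) \<noteq> {\<one>\<^bsub>Ext_group C N T\<^esub>}) \<longrightarrow>
        \<not> (\<exists>F. Ext_subfunctor C \<T> N F \<and>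
              (\<exists>T\<in>\<T>. F T \<noteq> {\<one>\<^bsub>Ext_group C N T\<^esub>}) \<and>
              (\<exists>T\<^sub>0\<in>\<T>. iso_to_representable C \<T> N F T\<^sub>0)))"

end

theory Submission
  imports Defs
begin

text \<open>
  All assertions speak of the short exact sequences \<open>T \<rightarrow> M \<rightarrow> N\<close> with \<open>T\<close> in \<open>\<T>\<close> for which every
  arrow from \<open>M\<close> into \<open>\<T>\<close> vanishes on \<open>T\<close>. The assertions \<open>nonzero_mono_detected\<close> and
  \<open>epi_with_invisible_kernel_iso\<close> say that \<open>T = 0\<close> in all of them, in terms of \<open>T \<rightarrow> M\<close> and of
  \<open>M \<rightarrow> N\<close> (\<open>epi_iso_iff_detected\<close>). A non-zero arrow \<open>T \<rightarrow> T'\<close> that factors through an injective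
  object extends to \<open>M\<close>, so \<open>nonzero_through_injective\<close> excludes such sequences with \<open>T \<noteq> 0\<close>. If
  there are enough injectives, it is conversely what \<open>nonzero_mono_detected\<close> says about an embedding
  of \<open>T\<close> into an injective object.

  Weak balance implies \<open>T = 0\<close>: the arrow \<open>M \<rightarrow> N\<close> has a left and a right triangle with a zero term,
  and its composite with a stable inverse both kills \<open>T\<close> and restricts to the inclusion of \<open>T\<close>
  (\<open>weakly_balanced_imp_epi_iso\<close>). For the converse, let \<open>\<alpha>\<close> lie in two triangles with a zero term.
  The third object \<open>Q\<close> of the right triangle is in \<open>\<T>\<close>, so it is projective and the exact sequence
  \<open>M \<rightarrow> N \<oplus> T\<^sup>M \<rightarrow> Q\<close> that computes it splits on the right. Replacing \<open>N\<close> by the image of \<open>M\<close> makes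
  \<open>\<alpha>\<close>, up to stable isomorphism, the class of an epimorphism \<open>e\<close> through which all arrows into \<open>\<T>\<close>
  factor (\<open>stable_image_of_pushout\<close>). The left triangle then says that \<open>ker e\<close> is in \<open>\<T>\<close>. This is the
  main step, since the left triangle is only known up to stable isomorphism (\<open>kernel_of_epi_in_T\<close>).
  Hence \<open>ker e = 0\<close> and \<open>\<alpha>\<close> is invertible (\<open>epi_iso_imp_weakly_balanced\<close>).

  By Yoneda's lemma, a natural transformation \<open>\<T>(T, ?) \<rightarrow> Ext(N, ?)\<close> takes \<open>a\<close> to the pushout along
  \<open>a\<close> of one extension \<open>T \<rightarrow> M \<rightarrow> N\<close>. It kills exactly the arrows \<open>a\<close> that extend to \<open>M\<close>, so it is
  injective exactly when every arrow from \<open>M\<close> into \<open>\<T>\<close> vanishes on \<open>T\<close>. The group structure of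
  \<open>Ext\<close> enters only through the fact that any two extensions of \<open>N\<close> are pushouts of a single one,
  along arrows \<open>a\<close> and \<open>b\<close> say, and that their Baer sum is then its pushout along \<open>a + b\<close>
  (\<open>Baer_sum_iff\<close>).
\<close>

section \<open>Arithmetic in a preadditive category\<close>

lemma Hom_iff: "f \<in> Hom C M N \<longleftrightarrow> f \<in> Ar C \<and> Dom C f = M \<and> Cod C f = N"
  by (simp add: Hom_def)

lemma HomD:
  assumes "f \<in> Hom C M N"
  shows "f \<in> Ar C" "Dom C f = M" "Cod C f = N"
  using assms by (simp_all add: Hom_def)

context category
begin

declare Dom_in_Ob [simp] Cod_in_Ob [simp]

lemma Hom_objects:
  assumes "f \<in> Hom C M N"
  shows "M \<in> Ob C" "N \<in> Ob C"
  using assms Dom_in_Ob Cod_in_Ob by (auto simp: Hom_def)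

lemma Hom_data:
  assumes "f \<in> Hom C M N"
  shows "f \<in> Ar C \<and> Dom C f = M \<and> Cod C f = N \<and> M \<in> Ob C \<and> N \<in> Ob C"
  using Hom_objects[OF assms] HomD[OF assms] by simp

lemma Id_simps [simp]:
  assumes "M \<in> Ob C"
  shows "Id C M \<in> Ar C" "Dom C (Id C M) = M" "Cod C (Id C M) = M"
  using Id_in_Hom[OF assms] by (simp_all add: Hom_def)

lemma Comp_simps [simp]:
  assumes "f \<in> Ar C" "g \<in> Ar C" "Dom C g = Cod C f"
  shows "g \<cdot> f \<in> Ar C" "Dom C (g \<cdot> f) = Dom C f" "Cod C (g \<cdot> f) = Cod C g"
  using Comp_in_Hom[of f "Dom C f" "Cod C f" g "Cod C g"] assms by (simp_all add: Hom_def)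

lemma Id_right [simp]: "f \<in> Ar C \<Longrightarrow> Dom C f = M \<Longrightarrow> f \<cdot> Id C M = f"
  using Comp_Id_right by (auto simp: Hom_def)

lemma Id_left [simp]: "f \<in> Ar C \<Longrightarrow> Cod C f = N \<Longrightarrow> Id C N \<cdot> f = f"
  using Comp_Id_left by (auto simp: Hom_def)

lemma assoc [simp]:
  "\<lbrakk>f \<in> Ar C; g \<in> Ar C; h \<in> Ar C; Dom C g = Cod C f; Dom C h = Cod C g\<rbrakk>
    \<Longrightarrow> (h \<cdot> g) \<cdot> f = h \<cdot> (g \<cdot> f)"
  using Comp_assoc[of f "Dom C f" "Cod C f" g "Cod C g" h "Cod C h"] by (auto simp: Hom_def)

text \<open>Composites are kept associated to the right, so an equation between two composites has to be
  made available inside a longer composite.\<close>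

lemma comp_reduce:
  "\<lbrakk>g \<cdot> f = h; f \<in> Ar C; g \<in> Ar C; Dom C g = Cod C f; x \<in> Ar C; Cod C x = Dom C f\<rbrakk>
    \<Longrightarrow> g \<cdot> (f \<cdot> x) = h \<cdot> x"
  using assoc[of x f g] by simp

lemma mono_cancel:
  assumes "is_mono C f" "u \<in> Ar C" "v \<in> Ar C" "Cod C u = Dom C f" "Cod C v = Dom C f"
    "Dom C u = Dom C v" "f \<cdot> u = f \<cdot> v"
  shows "u = v"
  using assms unfolding is_mono_def Hom_def by (metis (mono_tags, lifting) Dom_in_Ob mem_Collect_eq)

lemma epi_cancel:
  assumes "is_epi C f" "u \<in> Ar C" "v \<in> Ar C" "Dom C u = Cod C f" "Dom C v = Cod C f"
    "Cod C u = Cod C v" "u \<cdot> f = v \<cdot> f"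
  shows "u = v"
  using assms unfolding is_epi_def Hom_def by (metis (mono_tags, lifting) Cod_in_Ob mem_Collect_eq)

lemma mono_in_Ar: "is_mono C f \<Longrightarrow> f \<in> Ar C"
  by (simp add: is_mono_def)

lemma isoE:
  assumes "is_iso C f" "f \<in> Hom C M N"
  obtains g where "g \<in> Hom C N M" "g \<cdot> f = Id C M" "f \<cdot> g = Id C N"
  using assms by (auto simp: is_iso_def Hom_def)

lemma isoI:
  assumes "f \<in> Hom C M N" "g \<in> Hom C N M" "g \<cdot> f = Id C M" "f \<cdot> g = Id C N"
  shows "is_iso C f"
  using assms by (auto simp: is_iso_def Hom_def)

lemma iso_Id: "M \<in> Ob C \<Longrightarrow> is_iso C (Id C M)"
  by (rule isoI[of _ M M "Id C M"]) (auto simp: Hom_def)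

lemma iso_comp:
  assumes "is_iso C f" "f \<in> Hom C L M" "is_iso C g" "g \<in> Hom C M N"
  shows "is_iso C (g \<cdot> f)"
proof -
  obtain f' where f': "f' \<in> Hom C M L" "f' \<cdot> f = Id C L" "f \<cdot> f' = Id C M"
    using assms isoE by blast
  obtain g' where g': "g' \<in> Hom C N M" "g' \<cdot> g = Id C M" "g \<cdot> g' = Id C N"
    using assms isoE by blast
  note H [THEN Hom_data] = assms(2,4) f'(1) g'(1)
  show ?thesis
    by (rule isoI[of _ L N "f' \<cdot> g'"])
       (use H f' g' in \<open>auto simp: Hom_def comp_reduce[OF f'(2)] comp_reduce[OF f'(3)]
          comp_reduce[OF g'(2)] comp_reduce[OF g'(3)]\<close>)
qed

end

context preadditive_category
begin

definition neg :: "'m \<Rightarrow> 'm" where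
  "neg f = inv\<^bsub>hom_group C (Dom C f) (Cod C f)\<^esub> f"

abbreviation minus :: "'m \<Rightarrow> 'm \<Rightarrow> 'm" (infixl "\<boxminus>" 65) where
  "f \<boxminus> g \<equiv> f \<boxplus> neg g"

lemma hom_group_simps [simp]:
  "carrier (hom_group C M N) = Hom C M N"
  "mult (hom_group C M N) = Plus C"
  "one (hom_group C M N) = Zero C M N"
  by (simp_all add: hom_group_def)

lemma Plus_simps [simp]:
  assumes "f \<in> Ar C" "g \<in> Ar C" "Dom C g = Dom C f" "Cod C g = Cod C f"
  shows "f \<boxplus> g \<in> Ar C" "Dom C (f \<boxplus> g) = Dom C f" "Cod C (f \<boxplus> g) = Cod C f"
proof -
  interpret comm_group "hom_group C (Dom C f) (Cod C f)"
    using comm_group_hom_group assms by auto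
  have "f \<boxplus> g \<in> Hom C (Dom C f) (Cod C f)"
    using m_closed[of f g] assms by (simp add: Hom_def)
  then show "f \<boxplus> g \<in> Ar C" "Dom C (f \<boxplus> g) = Dom C f" "Cod C (f \<boxplus> g) = Cod C f"
    by (simp_all add: Hom_def)
qed

lemma Zero_simps [simp]:
  assumes "M \<in> Ob C" "N \<in> Ob C"
  shows "Zero C M N \<in> Ar C" "Dom C (Zero C M N) = M" "Cod C (Zero C M N) = N"
proof -
  interpret comm_group "hom_group C M N"
    using comm_group_hom_group assms by auto
  show "Zero C M N \<in> Ar C" "Dom C (Zero C M N) = M" "Cod C (Zero C M N) = N"
    using one_closed by (simp_all add: Hom_def)
qed

lemma neg_simps [simp]:
  assumes "f \<in> Ar C"
  shows "neg f \<in> Ar C" "Dom C (neg f) = Dom C f" "Cod C (neg f) = Cod C f"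
proof -
  interpret comm_group "hom_group C (Dom C f) (Cod C f)"
    using comm_group_hom_group assms by auto
  have "neg f \<in> Hom C (Dom C f) (Cod C f)"
    using inv_closed[of f] assms by (simp add: Hom_def neg_def)
  then show "neg f \<in> Ar C" "Dom C (neg f) = Dom C f" "Cod C (neg f) = Cod C f"
    by (simp_all add: Hom_def)
qed

lemma Plus_assoc [simp]:
  assumes "f \<in> Ar C" "g \<in> Ar C" "h \<in> Ar C" "Dom C g = Dom C f" "Cod C g = Cod C f"
    "Dom C h = Dom C f" "Cod C h = Cod C f"
  shows "(f \<boxplus> g) \<boxplus> h = f \<boxplus> (g \<boxplus> h)"
proof -
  interpret comm_group "hom_group C (Dom C f) (Cod C f)"
    using comm_group_hom_group assms by auto
  show ?thesis
    using m_assoc[of f g h] assms by (simp add: Hom_def)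
qed

lemma Plus_commute:
  assumes "f \<in> Ar C" "g \<in> Ar C" "Dom C g = Dom C f" "Cod C g = Cod C f"
  shows "f \<boxplus> g = g \<boxplus> f"
proof -
  interpret comm_group "hom_group C (Dom C f) (Cod C f)"
    using comm_group_hom_group assms by auto
  show ?thesis
    using m_comm[of f g] assms by (simp add: Hom_def)
qed

lemma Plus_left_commute:
  assumes "f \<in> Ar C" "g \<in> Ar C" "h \<in> Ar C" "Dom C g = Dom C f" "Cod C g = Cod C f"
    "Dom C h = Dom C f" "Cod C h = Cod C f"
  shows "f \<boxplus> (g \<boxplus> h) = g \<boxplus> (f \<boxplus> h)"
  using Plus_assoc[of f g h] Plus_assoc[of g f h] Plus_commute[of f g] assms by simp

lemmas Plus_ac = Plus_commute Plus_left_commute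

lemma Plus_Zero [simp]:
  assumes "f \<in> Ar C" "Dom C f = M" "Cod C f = N"
  shows "f \<boxplus> Zero C M N = f" "Zero C M N \<boxplus> f = f"
proof -
  interpret comm_group "hom_group C M N"
    using comm_group_hom_group assms by auto
  show "f \<boxplus> Zero C M N = f" "Zero C M N \<boxplus> f = f"
    using r_one[of f] l_one[of f] assms by (simp_all add: Hom_def)
qed

lemma Plus_neg [simp]:
  assumes "f \<in> Ar C"
  shows "f \<boxminus> f = Zero C (Dom C f) (Cod C f)" "neg f \<boxplus> f = Zero C (Dom C f) (Cod C f)"
proof -
  interpret comm_group "hom_group C (Dom C f) (Cod C f)"
    using comm_group_hom_group assms by auto
  show "f \<boxminus> f = Zero C (Dom C f) (Cod C f)" "neg f \<boxplus> f = Zero C (Dom C f) (Cod C f)"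
    using r_inv[of f] l_inv[of f] assms by (simp_all add: Hom_def neg_def)
qed

lemma Plus_neg_cancel [simp]:
  assumes "f \<in> Ar C" "g \<in> Ar C" "Dom C g = Dom C f" "Cod C g = Cod C f"
  shows "f \<boxplus> (neg f \<boxplus> g) = g" "neg f \<boxplus> (f \<boxplus> g) = g"
  using Plus_assoc[of f "neg f" g] Plus_assoc[of "neg f" f g] assms by simp_all

lemma neg_unique:
  assumes "f \<in> Ar C" "g \<in> Ar C" "Dom C g = Dom C f" "Cod C g = Cod C f"
    "f \<boxplus> g = Zero C (Dom C f) (Cod C f)"
  shows "g = neg f"
  using Plus_neg_cancel(2)[of f g] assms by simp

lemma diff_eq_iff:
  assumes "f \<in> Hom C M N" "g \<in> Hom C M N" "h \<in> Hom C M N"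
  shows "f \<boxminus> g = h \<longleftrightarrow> f = h \<boxplus> g"
proof -
  have "(f \<boxminus> g) \<boxplus> g = f" "(h \<boxplus> g) \<boxminus> g = h"
    using HomD[OF assms(1)] HomD[OF assms(2)] HomD[OF assms(3)] by simp_all
  then show ?thesis by metis
qed

lemma diff_eq_Zero_iff:
  assumes "f \<in> Hom C M N" "g \<in> Hom C M N"
  shows "f \<boxminus> g = Zero C M N \<longleftrightarrow> f = g"
proof -
  have "Zero C M N \<in> Hom C M N" "Zero C M N \<boxplus> g = g"
    using Hom_objects[OF assms(1)] HomD[OF assms(2)] by (simp_all add: Hom_def)
  then show ?thesis using diff_eq_iff[OF assms] by simp
qed

lemma Plus_left_cancel:
  assumes "f \<in> Hom C M N" "g \<in> Hom C M N" "h \<in> Hom C M N"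
  shows "f \<boxplus> g = f \<boxplus> h \<longleftrightarrow> g = h"
proof -
  have "neg f \<boxplus> (f \<boxplus> g) = g" "neg f \<boxplus> (f \<boxplus> h) = h"
    using HomD[OF assms(1)] HomD[OF assms(2)] HomD[OF assms(3)] by simp_all
  then show ?thesis by metis
qed

lemma neg_neg [simp]: "f \<in> Ar C \<Longrightarrow> neg (neg f) = f"
  using neg_unique[of "neg f" f] by simp

lemma neg_Zero [simp]: "M \<in> Ob C \<Longrightarrow> N \<in> Ob C \<Longrightarrow> neg (Zero C M N) = Zero C M N"
  using neg_unique[of "Zero C M N" "Zero C M N"] by simp

lemma neg_Plus [simp]:
  assumes "f \<in> Ar C" "g \<in> Ar C" "Dom C g = Dom C f" "Cod C g = Cod C f"
  shows "neg (f \<boxplus> g) = neg f \<boxplus> neg g"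
proof (rule neg_unique[symmetric])
  show "(f \<boxplus> g) \<boxplus> (neg f \<boxplus> neg g) = Zero C (Dom C (f \<boxplus> g)) (Cod C (f \<boxplus> g))"
    using assms by (simp add: Plus_left_commute[of g "neg f"])
qed (use assms in auto)

lemma Comp_Plus [simp]:
  assumes "f \<in> Ar C" "f' \<in> Ar C" "g \<in> Ar C" "Dom C f' = Dom C f" "Cod C f' = Cod C f"
    "Dom C g = Cod C f"
  shows "g \<cdot> (f \<boxplus> f') = (g \<cdot> f) \<boxplus> (g \<cdot> f')"
  using Comp_Plus_right[of f "Dom C f" "Cod C f" f' g "Cod C g"] assms by (simp add: Hom_def)

lemma Plus_Comp [simp]:
  assumes "f \<in> Ar C" "g \<in> Ar C" "g' \<in> Ar C" "Dom C g = Cod C f" "Dom C g' = Dom C g"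
    "Cod C g' = Cod C g"
  shows "(g \<boxplus> g') \<cdot> f = (g \<cdot> f) \<boxplus> (g' \<cdot> f)"
  using Comp_Plus_left[of f "Dom C f" "Cod C f" g "Cod C g" g'] assms by (simp add: Hom_def)

lemma Comp_Zero [simp]:
  assumes "g \<in> Ar C" "Dom C g = N" "M \<in> Ob C"
  shows "g \<cdot> Zero C M N = Zero C M (Cod C g)"
proof -
  have N: "N \<in> Ob C" using assms by auto
  have "g \<cdot> Zero C M N = g \<cdot> (Zero C M N \<boxplus> Zero C M N)" using N assms by simp
  also have "\<dots> = (g \<cdot> Zero C M N) \<boxplus> (g \<cdot> Zero C M N)" using N assms by (intro Comp_Plus) auto
  finally have *: "g \<cdot> Zero C M N = (g \<cdot> Zero C M N) \<boxplus> (g \<cdot> Zero C M N)" .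
  show ?thesis
    using Plus_left_cancel[of "g \<cdot> Zero C M N" M "Cod C g" "g \<cdot> Zero C M N" "Zero C M (Cod C g)"]
      * N assms by (simp add: Hom_def)
qed

lemma Zero_Comp [simp]:
  assumes "f \<in> Ar C" "Cod C f = M" "N \<in> Ob C"
  shows "Zero C M N \<cdot> f = Zero C (Dom C f) N"
proof -
  have M: "M \<in> Ob C" using assms by auto
  have "Zero C M N \<cdot> f = (Zero C M N \<boxplus> Zero C M N) \<cdot> f" using M assms by simp
  also have "\<dots> = (Zero C M N \<cdot> f) \<boxplus> (Zero C M N \<cdot> f)" using M assms by (intro Plus_Comp) auto
  finally have *: "Zero C M N \<cdot> f = (Zero C M N \<cdot> f) \<boxplus> (Zero C M N \<cdot> f)" .
  show ?thesis
    using Plus_left_cancel[of "Zero C M N \<cdot> f" "Dom C f" N "Zero C M N \<cdot> f" "Zero C (Dom C f) N"]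
      * M assms by (simp add: Hom_def)
qed

lemma Comp_neg [simp]:
  assumes "f \<in> Ar C" "g \<in> Ar C" "Dom C g = Cod C f"
  shows "g \<cdot> neg f = neg (g \<cdot> f)"
proof (rule neg_unique)
  have "(g \<cdot> f) \<boxplus> (g \<cdot> neg f) = g \<cdot> (f \<boxminus> f)"
    using Comp_Plus[of f "neg f" g] assms by simp
  also have "\<dots> = Zero C (Dom C f) (Cod C g)"
    using Plus_neg(1)[OF assms(1)] assms by simp
  finally show "(g \<cdot> f) \<boxplus> (g \<cdot> neg f) = Zero C (Dom C (g \<cdot> f)) (Cod C (g \<cdot> f))"
    using assms by simp
qed (use assms in auto)

lemma neg_Comp [simp]:
  assumes "f \<in> Ar C" "g \<in> Ar C" "Dom C g = Cod C f"
  shows "neg g \<cdot> f = neg (g \<cdot> f)"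
proof (rule neg_unique)
  have "(g \<cdot> f) \<boxplus> (neg g \<cdot> f) = (g \<boxminus> g) \<cdot> f"
    using Plus_Comp[of f g "neg g"] assms by simp
  also have "\<dots> = Zero C (Dom C f) (Cod C g)"
    using Plus_neg(1)[OF assms(2)] assms by simp
  finally show "(g \<cdot> f) \<boxplus> (neg g \<cdot> f) = Zero C (Dom C (g \<cdot> f)) (Cod C (g \<cdot> f))"
    using assms by simp
qed (use assms in auto)

subsection \<open>Monomorphisms, epimorphisms, kernels and cokernels\<close>

lemma mono_cancel_Zero:
  assumes "is_mono C f" "f \<in> Hom C M N" "x \<in> Hom C L M" "f \<cdot> x = Zero C L N"
  shows "x = Zero C L M"
  by (rule mono_cancel[OF assms(1)]) (use assms Hom_objects in \<open>auto simp: Hom_def\<close>)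

lemma epi_cancel_Zero:
  assumes "is_epi C f" "f \<in> Hom C M N" "x \<in> Hom C N L" "x \<cdot> f = Zero C M L"
  shows "x = Zero C N L"
  by (rule epi_cancel[OF assms(1)]) (use assms Hom_objects in \<open>auto simp: Hom_def\<close>)

lemma monoI:
  assumes f: "f \<in> Hom C M N"
    and zero: "\<And>L x. x \<in> Hom C L M \<Longrightarrow> f \<cdot> x = Zero C L N \<Longrightarrow> x = Zero C L M"
  shows "is_mono C f"
  unfolding is_mono_def
proof (intro conjI ballI impI)
  show "f \<in> Ar C" using f by (simp add: Hom_def)
  fix L u v assume L: "L \<in> Ob C" "u \<in> Hom C L (Dom C f)" "v \<in> Hom C L (Dom C f)" "f \<cdot> u = f \<cdot> v"
  note H [THEN Hom_data] = f L(2,3)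
  have "u \<boxminus> v = Zero C L M"
    using H L by (intro zero) (auto simp: Hom_def)
  then show "u = v"
    using H diff_eq_Zero_iff[of u L M v] by (simp add: Hom_def)
qed

lemma epiI:
  assumes f: "f \<in> Hom C M N"
    and zero: "\<And>L x. x \<in> Hom C N L \<Longrightarrow> x \<cdot> f = Zero C M L \<Longrightarrow> x = Zero C N L"
  shows "is_epi C f"
  unfolding is_epi_def
proof (intro conjI ballI impI)
  show "f \<in> Ar C" using f by (simp add: Hom_def)
  fix L u v assume L: "L \<in> Ob C" "u \<in> Hom C (Cod C f) L" "v \<in> Hom C (Cod C f) L" "u \<cdot> f = v \<cdot> f"
  note H [THEN Hom_data] = f L(2,3)
  have "u \<boxminus> v = Zero C N L"
    using H L by (intro zero) (auto simp: Hom_def)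
  then show "u = v"
    using H diff_eq_Zero_iff[of u N L v] by (simp add: Hom_def)
qed

lemma kernel_Hom:
  assumes "is_kernel C f k" "f \<in> Hom C M N"
  shows "k \<in> Hom C (Dom C k) M" "f \<cdot> k = Zero C (Dom C k) N"
  using assms by (auto simp: is_kernel_def Hom_def)

lemma kernel_mono:
  assumes "is_kernel C f k"
  shows "is_mono C k"
  unfolding is_mono_def
proof (intro conjI ballI impI)
  have k: "k \<in> Ar C" "f \<in> Ar C" "Cod C k = Dom C f" "f \<cdot> k = Zero C (Dom C k) (Cod C f)"
    and uni: "\<And>X g. X \<in> Ob C \<Longrightarrow> g \<in> Hom C X (Dom C f) \<Longrightarrow> f \<cdot> g = Zero C X (Cod C f) \<Longrightarrow>
        (\<exists>!w. w \<in> Hom C X (Dom C k) \<and> k \<cdot> w = g)"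
    using assms by (auto simp: is_kernel_def)
  show "k \<in> Ar C" by fact
  fix L u v assume L: "L \<in> Ob C" "u \<in> Hom C L (Dom C k)" "v \<in> Hom C L (Dom C k)" "k \<cdot> u = k \<cdot> v"
  note H [THEN Hom_data] = L(2,3)
  have "\<exists>!w. w \<in> Hom C L (Dom C k) \<and> k \<cdot> w = k \<cdot> v"
    by (rule uni) (use k H L in \<open>auto simp: Hom_def comp_reduce[OF k(4)]\<close>)
  then show "u = v" using L by auto
qed

lemma kernel_factor:
  assumes "is_kernel C f k" "f \<in> Hom C M N" "x \<in> Hom C X M" "f \<cdot> x = Zero C X N"
  obtains w where "w \<in> Hom C X (Dom C k)" "k \<cdot> w = x"
  using assms Hom_objects[OF assms(3)] unfolding is_kernel_def Hom_def by blast

lemma kernelI: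
  assumes "f \<in> Hom C M N" "k \<in> Hom C K M" "f \<cdot> k = Zero C K N" "is_mono C k"
    and factor: "\<And>X x. x \<in> Hom C X M \<Longrightarrow> f \<cdot> x = Zero C X N \<Longrightarrow> \<exists>w\<in>Hom C X K. k \<cdot> w = x"
  shows "is_kernel C f k"
  unfolding is_kernel_def
proof (intro conjI ballI impI)
  note H [THEN Hom_data] = assms(1,2)
  show "f \<in> Ar C" "k \<in> Ar C" "Cod C k = Dom C f" "f \<cdot> k = Zero C (Dom C k) (Cod C f)"
    using H assms by auto
  fix X x assume x: "X \<in> Ob C" "x \<in> Hom C X (Dom C f)" "f \<cdot> x = Zero C X (Cod C f)"
  then obtain w where w: "w \<in> Hom C X K" "k \<cdot> w = x" using factor H by auto
  show "\<exists>!w. w \<in> Hom C X (Dom C k) \<and> k \<cdot> w = x"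
  proof (rule ex1I[of _ w])
    show "w \<in> Hom C X (Dom C k) \<and> k \<cdot> w = x" using w H by simp
    fix w' assume w': "w' \<in> Hom C X (Dom C k) \<and> k \<cdot> w' = x"
    show "w' = w"
      by (rule mono_cancel[OF assms(4)]) (use w w' H in \<open>auto simp: Hom_def\<close>)
  qed
qed

lemma cokernel_Hom:
  assumes "is_cokernel C f q" "f \<in> Hom C M N"
  shows "q \<in> Hom C N (Cod C q)" "q \<cdot> f = Zero C M (Cod C q)"
  using assms by (auto simp: is_cokernel_def Hom_def)

lemma cokernel_epi:
  assumes "is_cokernel C f q"
  shows "is_epi C q"
  unfolding is_epi_def
proof (intro conjI ballI impI)
  have k: "q \<in> Ar C" "f \<in> Ar C" "Dom C q = Cod C f" "q \<cdot> f = Zero C (Dom C f) (Cod C q)"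
    and uni: "\<And>X g. X \<in> Ob C \<Longrightarrow> g \<in> Hom C (Cod C f) X \<Longrightarrow> g \<cdot> f = Zero C (Dom C f) X \<Longrightarrow>
        (\<exists>!w. w \<in> Hom C (Cod C q) X \<and> w \<cdot> q = g)"
    using assms by (auto simp: is_cokernel_def)
  show "q \<in> Ar C" by fact
  fix L u v assume L: "L \<in> Ob C" "u \<in> Hom C (Cod C q) L" "v \<in> Hom C (Cod C q) L" "u \<cdot> q = v \<cdot> q"
  note H [THEN Hom_data] = L(2,3)
  have "\<exists>!w. w \<in> Hom C (Cod C q) L \<and> w \<cdot> q = v \<cdot> q"
    by (rule uni) (use k H L in \<open>auto simp: Hom_def\<close>)
  then show "u = v" using L by auto
qed

lemma cokernel_factor:
  assumes "is_cokernel C f q" "f \<in> Hom C M N" "x \<in> Hom C N X" "x \<cdot> f = Zero C M X"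
  obtains w where "w \<in> Hom C (Cod C q) X" "w \<cdot> q = x"
  using assms Hom_objects[OF assms(3)] unfolding is_cokernel_def Hom_def by blast

lemma cokernelI:
  assumes "f \<in> Hom C M N" "q \<in> Hom C N Q" "q \<cdot> f = Zero C M Q" "is_epi C q"
    and factor: "\<And>X x. x \<in> Hom C N X \<Longrightarrow> x \<cdot> f = Zero C M X \<Longrightarrow> \<exists>w\<in>Hom C Q X. w \<cdot> q = x"
  shows "is_cokernel C f q"
  unfolding is_cokernel_def
proof (intro conjI ballI impI)
  note H [THEN Hom_data] = assms(1,2)
  show "f \<in> Ar C" "q \<in> Ar C" "Dom C q = Cod C f" "q \<cdot> f = Zero C (Dom C f) (Cod C q)"
    using H assms by auto
  fix X x assume x: "X \<in> Ob C" "x \<in> Hom C (Cod C f) X" "x \<cdot> f = Zero C (Dom C f) X"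
  then obtain w where w: "w \<in> Hom C Q X" "w \<cdot> q = x" using factor H by auto
  show "\<exists>!w. w \<in> Hom C (Cod C q) X \<and> w \<cdot> q = x"
  proof (rule ex1I[of _ w])
    show "w \<in> Hom C (Cod C q) X \<and> w \<cdot> q = x" using w H by simp
    fix w' assume w': "w' \<in> Hom C (Cod C q) X \<and> w' \<cdot> q = x"
    show "w' = w"
      by (rule epi_cancel[OF assms(4)]) (use w w' H in \<open>auto simp: Hom_def\<close>)
  qed
qed

lemma zero_object_iff:
  assumes "Z \<in> Ob C"
  shows "is_zero_object C Z \<longleftrightarrow> Id C Z = Zero C Z Z"
proof
  assume "is_zero_object C Z"
  then have "\<exists>!f. f \<in> Hom C Z Z" using assms by (auto simp: is_zero_object_def)
  moreover have "Id C Z \<in> Hom C Z Z" "Zero C Z Z \<in> Hom C Z Z" using assms by (auto simp: Hom_def)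
  ultimately show "Id C Z = Zero C Z Z" by auto
next
  assume id: "Id C Z = Zero C Z Z"
  have 1: "f = Zero C Z M" if "f \<in> Hom C Z M" for f M
    using Id_right[of f Z] that assms id by (auto simp: Hom_def)
  have 2: "f = Zero C M Z" if "f \<in> Hom C M Z" for f M
    using Id_left[of f Z] that assms id by (auto simp: Hom_def)
  show "is_zero_object C Z"
    unfolding is_zero_object_def
  proof (intro conjI ballI)
    fix M assume "M \<in> Ob C"
    then have "Zero C Z M \<in> Hom C Z M" "Zero C M Z \<in> Hom C M Z" using assms by (auto simp: Hom_def)
    then show "\<exists>!f. f \<in> Hom C Z M" "\<exists>!f. f \<in> Hom C M Z" using 1 2 by blast+
  qed fact
qed

lemma mono_eq_Zero_iff:
  assumes "is_mono C m" "m \<in> Hom C M N"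
  shows "m = Zero C M N \<longleftrightarrow> is_zero_object C M"
proof -
  note H [THEN Hom_data] = assms(2)
  have "m = Zero C M N \<longleftrightarrow> Id C M = Zero C M M"
  proof
    assume "m = Zero C M N"
    then show "Id C M = Zero C M M"
      by (intro mono_cancel_Zero[OF assms]) (use H in \<open>auto simp: Hom_iff\<close>)
  next
    assume "Id C M = Zero C M M"
    then have "m \<cdot> Id C M = m \<cdot> Zero C M M" by simp
    then show "m = Zero C M N" using H by simp
  qed
  then show ?thesis using zero_object_iff H by blast
qed

lemma
  assumes "is_biproduct C M N i1 i2 p1 p2"
  shows biproduct_Hom: "i1 \<in> Hom C M (Cod C i1)" "i2 \<in> Hom C N (Cod C i1)"
      "p1 \<in> Hom C (Cod C i1) M" "p2 \<in> Hom C (Cod C i1) N"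
    and biproduct_eqs: "p1 \<cdot> i1 = Id C M" "p2 \<cdot> i2 = Id C N"
      "p1 \<cdot> i2 = Zero C N M" "p2 \<cdot> i1 = Zero C M N"
    and biproduct_sum: "(i1 \<cdot> p1) \<boxplus> (i2 \<cdot> p2) = Id C (Cod C i1)"
  using assms unfolding is_biproduct_def by (auto simp: Hom_iff)

lemma biproduct_out_eq:
  assumes b: "is_biproduct C M N i1 i2 p1 p2"
    and x: "x \<in> Hom C (Cod C i1) X" "y \<in> Hom C (Cod C i1) X"
    and eq: "x \<cdot> i1 = y \<cdot> i1" "x \<cdot> i2 = y \<cdot> i2"
  shows "x = y"
proof -
  define P where "P = Cod C i1"
  note P = biproduct_Hom[OF b, folded P_def] biproduct_sum[OF b, folded P_def]
  note H [THEN Hom_data] = P(1,2,3,4) x(1,2)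
  have *: "z = ((z \<cdot> i1) \<cdot> p1) \<boxplus> ((z \<cdot> i2) \<cdot> p2)" if "z \<in> Ar C" "Dom C z = P" for z
  proof -
    have "z = z \<cdot> ((i1 \<cdot> p1) \<boxplus> (i2 \<cdot> p2))" using that P(5) by simp
    also have "\<dots> = ((z \<cdot> i1) \<cdot> p1) \<boxplus> ((z \<cdot> i2) \<cdot> p2)"
      using that H by simp
    finally show ?thesis .
  qed
  show ?thesis using *[of x] *[of y] eq H by simp
qed

lemma biproduct_in_eq:
  assumes b: "is_biproduct C M N i1 i2 p1 p2"
    and x: "x \<in> Hom C X (Cod C i1)" "y \<in> Hom C X (Cod C i1)"
    and eq: "p1 \<cdot> x = p1 \<cdot> y" "p2 \<cdot> x = p2 \<cdot> y"
  shows "x = y"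
proof -
  define P where "P = Cod C i1"
  note P = biproduct_Hom[OF b, folded P_def] biproduct_sum[OF b, folded P_def]
  note H [THEN Hom_data] = P(1,2,3,4) x(1,2)
  have *: "z = (i1 \<cdot> (p1 \<cdot> z)) \<boxplus> (i2 \<cdot> (p2 \<cdot> z))" if "z \<in> Ar C" "Cod C z = P" for z
  proof -
    have "z = ((i1 \<cdot> p1) \<boxplus> (i2 \<cdot> p2)) \<cdot> z" using that P(5) by simp
    also have "\<dots> = (i1 \<cdot> (p1 \<cdot> z)) \<boxplus> (i2 \<cdot> (p2 \<cdot> z))"
      using that H by simp
    finally show ?thesis .
  qed
  show ?thesis using *[of x] *[of y] eq H by simp
qed

text \<open>The splitting lemma: a section of an arrow turns its kernel into a direct summand.\<close>

lemma split_kernel_biproduct: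
  assumes k: "is_kernel C r j" and r: "r \<in> Hom C E N" and j: "j \<in> Hom C T E"
    and s: "s \<in> Hom C N E" "r \<cdot> s = Id C N"
  obtains d where "d \<in> Hom C E T" "is_biproduct C T N j s d r"
proof -
  note H [THEN Hom_data] = r j s(1)
  have rj: "r \<cdot> j = Zero C T N" using kernel_Hom(2)[OF k r] H by simp
  have "r \<cdot> (Id C E \<boxminus> (s \<cdot> r)) = Zero C E N"
    using H s by (simp add: comp_reduce[OF s(2)])
  then obtain d where d: "d \<in> Hom C E (Dom C j)" "j \<cdot> d = Id C E \<boxminus> (s \<cdot> r)"
    using kernel_factor[OF k r, of "Id C E \<boxminus> (s \<cdot> r)" E] H by (auto simp: Hom_def)
  note D [THEN Hom_data] = d(1)
  have dj: "d \<cdot> j = Id C T"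
    by (rule mono_cancel[OF kernel_mono[OF k]])
       (use D H rj in \<open>auto simp: comp_reduce[OF d(2)]\<close>)
  have ds: "d \<cdot> s = Zero C N T"
    by (rule mono_cancel[OF kernel_mono[OF k]])
       (use D H s in \<open>auto simp: comp_reduce[OF d(2)]\<close>)
  have "(j \<cdot> d) \<boxplus> (s \<cdot> r) = Id C E"
    using d(2) H by simp
  then have "is_biproduct C T N j s d r"
    unfolding is_biproduct_def
    using dj ds rj s H D by (intro bexI[of _ E]) (auto simp: Hom_def)
  then show thesis using that D H by (auto simp: Hom_def)
qed

subsection \<open>Pushouts and pullbacks\<close>

lemma biproduct_swap:
  assumes "is_biproduct C M N i1 i2 p1 p2"
  shows "is_biproduct C N M i2 i1 p2 p1"
proof -
  note H [THEN Hom_data] = biproduct_Hom[OF assms]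
  have "(i2 \<cdot> p2) \<boxplus> (i1 \<cdot> p1) = Id C (Cod C i1)"
    using biproduct_sum[OF assms] H Plus_commute[of "i2 \<cdot> p2" "i1 \<cdot> p1"] by simp
  then show ?thesis
    unfolding is_biproduct_def using biproduct_Hom[OF assms] biproduct_eqs[OF assms] H by blast
qed

text \<open>An arrow out of \<open>M \<oplus> N\<close> is a pair of arrows, so the pushout of \<open>f\<close> and \<open>g\<close> is the cokernel of
  \<open>K \<rightarrow> M \<oplus> N\<close>, up to a sign in one of the components.\<close>

lemma pushout_iff_cokernel:
  assumes f: "f \<in> Hom C K M" and g: "g \<in> Hom C K N" and u: "u \<in> Hom C M Q" and v: "v \<in> Hom C N Q"
    and b: "is_biproduct C M N i1 i2 p1 p2"
  shows "is_pushout C f g u v \<longleftrightarrow>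
    is_cokernel C ((i1 \<cdot> f) \<boxplus> (i2 \<cdot> g)) ((u \<cdot> p1) \<boxminus> (v \<cdot> p2))"
proof -
  define P where "P = Cod C i1"
  note P = biproduct_Hom[OF b, folded P_def] and B = biproduct_eqs[OF b]
  note H [THEN Hom_data] = f g u v P(1,2,3,4)
  note R = B B[THEN comp_reduce]
  define m where "m = (i1 \<cdot> f) \<boxplus> (i2 \<cdot> g)"
  define c where "c = (u \<cdot> p1) \<boxminus> (v \<cdot> p2)"
  have m: "m \<in> Hom C K P" and c: "c \<in> Hom C P Q" using H by (simp_all add: m_def c_def Hom_def)
  have ci: "c \<cdot> i1 = u" "c \<cdot> i2 = neg v" using H by (simp_all add: c_def R)
  have cm: "c \<cdot> m = (u \<cdot> f) \<boxminus> (v \<cdot> g)" using H by (simp add: c_def m_def R)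
  have comm: "c \<cdot> m = Zero C K Q \<longleftrightarrow> u \<cdot> f = v \<cdot> g"
    unfolding cm using H by (intro diff_eq_Zero_iff) (auto simp: Hom_def)
  have out: "z = c" if "z \<in> Hom C P Q" "z \<cdot> i1 = u" "z \<cdot> i2 = neg v" for z
    by (rule biproduct_out_eq[OF b]) (use that c ci H in auto)
  have "is_cokernel C m c" if po: "is_pushout C f g u v"
  proof -
    have uf: "u \<cdot> f = v \<cdot> g"
      and uni: "\<And>X a d. X \<in> Ob C \<Longrightarrow> a \<in> Hom C M X \<Longrightarrow> d \<in> Hom C N X \<Longrightarrow> a \<cdot> f = d \<cdot> g \<Longrightarrow>
        \<exists>!w. w \<in> Hom C Q X \<and> w \<cdot> u = a \<and> w \<cdot> v = d"
      using po H unfolding is_pushout_def by auto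
    show ?thesis
    proof (rule cokernelI[OF m c])
      show "c \<cdot> m = Zero C K Q" using comm uf by simp
      show "is_epi C c"
      proof (rule epiI[OF c])
        fix L x assume x: "x \<in> Hom C Q L" "x \<cdot> c = Zero C P L"
        note X [THEN Hom_data] = x(1) c
        have "x \<cdot> (c \<cdot> i1) = Zero C M L" "x \<cdot> (c \<cdot> i2) = Zero C N L"
          using X H by (simp_all add: comp_reduce[OF x(2)])
        then have 1: "x \<cdot> u = Zero C M L" "neg (x \<cdot> v) = Zero C N L" using X H ci by auto
        then have "neg (neg (x \<cdot> v)) = neg (Zero C N L)" by simp
        then have 2: "x \<cdot> v = Zero C N L" using X H by simp
        have "\<exists>!w. w \<in> Hom C Q L \<and> w \<cdot> u = Zero C M L \<and> w \<cdot> v = Zero C N L"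
          by (rule uni) (use X H in \<open>auto simp: Hom_def\<close>)
        moreover have "Zero C Q L \<in> Hom C Q L \<and> Zero C Q L \<cdot> u = Zero C M L \<and> Zero C Q L \<cdot> v = Zero C N L"
          using X H by (auto simp: Hom_def)
        ultimately show "x = Zero C Q L" using x 1 2 by blast
      qed
    next
      fix X x assume x: "x \<in> Hom C P X" "x \<cdot> m = Zero C K X"
      note X [THEN Hom_data] = x(1)
      have "(x \<cdot> (i1 \<cdot> f)) \<boxplus> (x \<cdot> (i2 \<cdot> g)) = Zero C K X"
        using x(2) X H by (simp add: m_def)
      then have "(x \<cdot> (i1 \<cdot> f)) \<boxminus> neg (x \<cdot> (i2 \<cdot> g)) = Zero C K X" using X H by simp
      then have "x \<cdot> (i1 \<cdot> f) = neg (x \<cdot> (i2 \<cdot> g))"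
        using X H by (subst (asm) diff_eq_Zero_iff) (auto simp: Hom_def)
      then have "\<exists>!w. w \<in> Hom C Q X \<and> w \<cdot> u = x \<cdot> i1 \<and> w \<cdot> v = neg (x \<cdot> i2)"
        by (intro uni) (use X H in \<open>auto simp: Hom_def\<close>)
      then obtain w where w: "w \<in> Hom C Q X" "w \<cdot> u = x \<cdot> i1" "w \<cdot> v = neg (x \<cdot> i2)" by blast
      note W [THEN Hom_data] = w(1) c
      have "w \<cdot> c = x"
        by (rule biproduct_out_eq[OF b]) (use W X H w ci in \<open>auto simp: Hom_def\<close>)
      then show "\<exists>w\<in>Hom C Q X. w \<cdot> c = x" using w by blast
    qed
  qed
  moreover have "is_pushout C f g u v" if co: "is_cokernel C m c"
    unfolding is_pushout_def
  proof (intro conjI ballI impI)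
    note M [THEN Hom_data] = m c
    show "u \<cdot> f = v \<cdot> g" using comm cokernel_Hom(2)[OF co m] M by simp
    fix X a d assume X: "X \<in> Ob C" "a \<in> Hom C (Cod C f) X" "d \<in> Hom C (Cod C g) X" "a \<cdot> f = d \<cdot> g"
    note A [THEN Hom_data] = X(2,3)
    define x where "x = (a \<cdot> p1) \<boxminus> (d \<cdot> p2)"
    have x: "x \<in> Hom C P X" using A H by (simp add: x_def Hom_def)
    have xi: "x \<cdot> i1 = a" "x \<cdot> i2 = neg d" using A H X by (simp_all add: x_def R)
    have "x \<cdot> m = Zero C K X" using A H X by (simp add: x_def m_def R)
    then obtain w where w: "w \<in> Hom C Q X" "w \<cdot> c = x"
      using cokernel_factor[OF co m x] M by auto
    note W [THEN Hom_data] = w(1) x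
    have "w \<cdot> u = a" "w \<cdot> neg v = neg d"
      using xi ci comp_reduce[OF w(2)] W M H by metis+
    then have 1: "w \<cdot> u = a" "neg (neg (w \<cdot> v)) = neg (neg d)" using W H by auto
    then have 2: "w \<cdot> v = d" using W H A by simp
    show "\<exists>!w. w \<in> Hom C (Cod C u) X \<and> w \<cdot> u = a \<and> w \<cdot> v = d"
    proof (rule ex1I[of _ w])
      show "w \<in> Hom C (Cod C u) X \<and> w \<cdot> u = a \<and> w \<cdot> v = d" using 1 2 w H by simp
      fix w' assume w': "w' \<in> Hom C (Cod C u) X \<and> w' \<cdot> u = a \<and> w' \<cdot> v = d"
      then have W': "w' \<in> Ar C" "Dom C w' = Q" "Cod C w' = X" using H by (auto simp: Hom_def)
      have eq: "w' \<cdot> c = w \<cdot> c"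
        by (rule biproduct_out_eq[OF b, of _ X]) (use W W' M H w' 1 2 ci in \<open>auto simp: Hom_def\<close>)
      show "w' = w"
        by (rule epi_cancel[OF cokernel_epi[OF co]]) (use eq W W' M in auto)
    qed
  qed (use H in auto)
  ultimately show ?thesis unfolding m_def c_def by blast
qed

lemma pushout_factor:
  assumes "is_pushout C f g u v" "f \<in> Hom C K M" "g \<in> Hom C K N" "u \<in> Hom C M Q"
    "a \<in> Hom C M X" "b \<in> Hom C N X" "a \<cdot> f = b \<cdot> g"
  obtains w where "w \<in> Hom C Q X" "w \<cdot> u = a" "w \<cdot> v = b"
proof -
  note H = HomD[OF assms(2)] HomD[OF assms(3)] HomD[OF assms(4)]
  have "\<And>X a b. X \<in> Ob C \<Longrightarrow> a \<in> Hom C M X \<Longrightarrow> b \<in> Hom C N X \<Longrightarrow> a \<cdot> f = b \<cdot> g \<Longrightarrow>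
        \<exists>!w. w \<in> Hom C Q X \<and> w \<cdot> u = a \<and> w \<cdot> v = b"
    using assms(1) unfolding is_pushout_def H by blast
  from this[OF Hom_objects(2)[OF assms(5)] assms(5,6,7)] show thesis using that by blast
qed

lemma pullback_factor:
  assumes "is_pullback C f g u v" "f \<in> Hom C M K" "g \<in> Hom C N K" "u \<in> Hom C Q M"
    "a \<in> Hom C X M" "b \<in> Hom C X N" "f \<cdot> a = g \<cdot> b"
  obtains w where "w \<in> Hom C X Q" "u \<cdot> w = a" "v \<cdot> w = b"
proof -
  note H = HomD[OF assms(2)] HomD[OF assms(3)] HomD[OF assms(4)]
  have "\<And>X a b. X \<in> Ob C \<Longrightarrow> a \<in> Hom C X M \<Longrightarrow> b \<in> Hom C X N \<Longrightarrow> f \<cdot> a = g \<cdot> b \<Longrightarrow>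
        \<exists>!w. w \<in> Hom C X Q \<and> u \<cdot> w = a \<and> v \<cdot> w = b"
    using assms(1) unfolding is_pullback_def H by blast
  from this[OF Hom_objects(1)[OF assms(5)] assms(5,6,7)] show thesis using that by blast
qed

lemma pushout_Hom:
  assumes "is_pushout C f g u v" "f \<in> Hom C K M" "g \<in> Hom C K N"
  shows "u \<in> Hom C M (Cod C u)" "v \<in> Hom C N (Cod C u)" "u \<cdot> f = v \<cdot> g"
  using assms(1) HomD[OF assms(2)] HomD[OF assms(3)] unfolding is_pushout_def
  by (simp_all add: Hom_iff)

lemma pullback_Hom:
  assumes "is_pullback C f g u v" "f \<in> Hom C M K" "g \<in> Hom C N K"
  shows "u \<in> Hom C (Dom C u) M" "v \<in> Hom C (Dom C u) N" "f \<cdot> u = g \<cdot> v"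
  using assms(1) HomD[OF assms(2)] HomD[OF assms(3)] unfolding is_pullback_def
  by (simp_all add: Hom_iff)

lemma pushout_eq:
  assumes "is_pushout C f g u v" "f \<in> Hom C K M" "g \<in> Hom C K N" "u \<in> Hom C M Q"
    "x \<in> Hom C Q X" "y \<in> Hom C Q X" "x \<cdot> u = y \<cdot> u" "x \<cdot> v = y \<cdot> v"
  shows "x = y"
proof -
  note P = pushout_Hom[OF assms(1-3)]
  note H [THEN Hom_data] = assms(2,3,4,5,6) P(1,2)
  have uni: "\<And>X a b. X \<in> Ob C \<Longrightarrow> a \<in> Hom C M X \<Longrightarrow> b \<in> Hom C N X \<Longrightarrow> a \<cdot> f = b \<cdot> g \<Longrightarrow>
        \<exists>!w. w \<in> Hom C Q X \<and> w \<cdot> u = a \<and> w \<cdot> v = b"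
    using assms(1) H unfolding is_pushout_def by auto
  have "(x \<cdot> u) \<cdot> f = (x \<cdot> v) \<cdot> g" using H P(3) by simp
  then have "\<exists>!w. w \<in> Hom C Q X \<and> w \<cdot> u = x \<cdot> u \<and> w \<cdot> v = x \<cdot> v"
    by (intro uni) (use H Hom_objects[OF assms(5)] in \<open>auto simp: Hom_iff\<close>)
  then show ?thesis using assms by metis
qed

lemma pullback_eq:
  assumes "is_pullback C f g u v" "f \<in> Hom C M K" "g \<in> Hom C N K" "u \<in> Hom C Q M"
    "x \<in> Hom C X Q" "y \<in> Hom C X Q" "u \<cdot> x = u \<cdot> y" "v \<cdot> x = v \<cdot> y"
  shows "x = y"
proof -
  note P = pullback_Hom[OF assms(1-3)]
  note H [THEN Hom_data] = assms(2,3,4,5,6) P(1,2)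
  have uni: "\<And>X a b. X \<in> Ob C \<Longrightarrow> a \<in> Hom C X M \<Longrightarrow> b \<in> Hom C X N \<Longrightarrow> f \<cdot> a = g \<cdot> b \<Longrightarrow>
        \<exists>!w. w \<in> Hom C X Q \<and> u \<cdot> w = a \<and> v \<cdot> w = b"
    using assms(1) H unfolding is_pullback_def by auto
  have "\<exists>!w. w \<in> Hom C X Q \<and> u \<cdot> w = u \<cdot> x \<and> v \<cdot> w = v \<cdot> x"
    by (rule uni) (use H Hom_objects[OF assms(5)] in \<open>auto simp: Hom_def comp_reduce[OF P(3)]\<close>)
  then show ?thesis using assms by metis
qed

end

section \<open>Exactness in an abelian category\<close>

context abelian_category
begin

lemma obtain_kernel:
  assumes "f \<in> Hom C M N"
  obtains K k where "k \<in> Hom C K M" "is_kernel C f k"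
  using ex_kernel[of f] kernel_Hom(1)[OF _ assms] HomD[OF assms] by blast

lemma obtain_cokernel:
  assumes "f \<in> Hom C M N"
  obtains Q q where "q \<in> Hom C N Q" "is_cokernel C f q"
  using ex_cokernel[of f] cokernel_Hom(1)[OF _ assms] HomD[OF assms] by blast

lemma mono_kernel_of_cokernel:
  assumes m: "is_mono C m" "m \<in> Hom C M N" and c: "is_cokernel C m c" "c \<in> Hom C N Q"
  shows "is_kernel C c m"
proof -
  obtain g where g: "is_kernel C g m" using mono_is_kernel m by blast
  then obtain L where gL: "g \<in> Hom C N L" using HomD[OF m(2)] by (auto simp: is_kernel_def Hom_def)
  have gm: "g \<cdot> m = Zero C M L" using kernel_Hom(2)[OF g gL] HomD[OF m(2)] by simp
  obtain w where w: "w \<in> Hom C Q L" "w \<cdot> c = g"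
    using cokernel_factor[OF c(1) m(2) gL gm] HomD[OF c(2)] by auto
  show ?thesis
  proof (rule kernelI[OF c(2) m(2) _ m(1)])
    show "c \<cdot> m = Zero C M Q" using cokernel_Hom(2)[OF c(1) m(2)] HomD[OF c(2)] by simp
    fix X x assume x: "x \<in> Hom C X N" "c \<cdot> x = Zero C X Q"
    have "g \<cdot> x = w \<cdot> (c \<cdot> x)"
      using w HomD[OF w(1)] HomD[OF c(2)] HomD[OF x(1)] comp_reduce[OF w(2)] by auto
    then have "g \<cdot> x = Zero C X L"
      using x HomD[OF w(1)] Hom_objects[OF x(1)] by simp
    then show "\<exists>w\<in>Hom C X M. m \<cdot> w = x"
      using kernel_factor[OF g gL x(1)] HomD[OF m(2)] by auto
  qed
qed

lemma epi_cokernel_of_kernel: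
  assumes e: "is_epi C e" "e \<in> Hom C M N" and k: "is_kernel C e k" "k \<in> Hom C K M"
  shows "is_cokernel C k e"
proof -
  obtain g where g: "is_cokernel C g e" using epi_is_cokernel e by blast
  then obtain L where gL: "g \<in> Hom C L M" using HomD[OF e(2)] by (auto simp: is_cokernel_def Hom_def)
  have eg: "e \<cdot> g = Zero C L N" using cokernel_Hom(2)[OF g gL] HomD[OF e(2)] by simp
  obtain w where w: "w \<in> Hom C L K" "k \<cdot> w = g"
    using kernel_factor[OF k(1) e(2) gL eg] HomD[OF k(2)] by auto
  show ?thesis
  proof (rule cokernelI[OF k(2) e(2) _ e(1)])
    show "e \<cdot> k = Zero C K N" using kernel_Hom(2)[OF k(1) e(2)] HomD[OF k(2)] by simp
    fix X x assume x: "x \<in> Hom C M X" "x \<cdot> k = Zero C K X"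
    have "x \<cdot> g = (x \<cdot> k) \<cdot> w"
      using w HomD[OF w(1)] HomD[OF k(2)] HomD[OF x(1)] by auto
    then have "x \<cdot> g = Zero C L X"
      using x HomD[OF w(1)] Hom_objects[OF x(1)] by simp
    then show "\<exists>w\<in>Hom C N X. w \<cdot> e = x"
      using cokernel_factor[OF g gL x(1)] HomD[OF e(2)] by auto
  qed
qed

lemma mono_epi_iso:
  assumes "is_mono C f" "is_epi C f"
  shows "is_iso C f"
proof -
  obtain M N where f: "f \<in> Hom C M N" using mono_in_Ar[OF assms(1)] by (auto simp: Hom_def)
  note O [THEN Hom_data] = f
  obtain Q c where c: "c \<in> Hom C N Q" "is_cokernel C f c" using obtain_cokernel[OF f] by blast
  have k: "is_kernel C c f" by (rule mono_kernel_of_cokernel[OF assms(1) f c(2,1)])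
  have "c = Zero C N Q"
    by (rule epi_cancel_Zero[OF assms(2) f c(1)])
       (use cokernel_Hom(2)[OF c(2) f] HomD[OF c(1)] in simp)
  then obtain g where g: "g \<in> Hom C N M" "f \<cdot> g = Id C N"
    using kernel_factor[OF k c(1), of "Id C N" N] O Hom_objects[OF c(1)] by (auto simp: Hom_def)
  have "g \<cdot> f = Id C M"
    by (rule mono_cancel[OF assms(1)]) (use O HomD[OF g(1)] in \<open>auto simp: comp_reduce[OF g(2)]\<close>)
  then show ?thesis using isoI[OF f g(1)] g(2) by blast
qed

text \<open>Let \<open>u e = 0\<close>. Then \<open>m\<close> factors through the subobject \<open>ker u\<close> of the image \<open>I = ker (coker m)\<close>.
  This subobject of \<open>N\<close> is the kernel of some arrow, which kills \<open>m\<close>, so factors through \<open>coker m\<close>,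
  and therefore kills \<open>I\<close>. Thus \<open>ker u\<close> is all of \<open>I\<close>.\<close>

lemma epi_onto_image:
  assumes m: "m \<in> Hom C M N" and c: "is_cokernel C m c" "c \<in> Hom C N Q"
    and n: "is_kernel C c n" "n \<in> Hom C I N" and e: "e \<in> Hom C M I" "n \<cdot> e = m"
  shows "is_epi C e"
proof (rule epiI[OF e(1)])
  fix X u assume u: "u \<in> Hom C I X" "u \<cdot> e = Zero C M X"
  obtain U t where t: "t \<in> Hom C U I" "is_kernel C u t" using obtain_kernel[OF u(1)] by blast
  obtain e' where e': "e' \<in> Hom C M U" "t \<cdot> e' = e"
    using kernel_factor[OF t(2) u(1) e(1) u(2)] HomD[OF t(1)] by auto
  note H [THEN Hom_data] = m c(2) n(2) e(1) u(1) t(1) e'(1)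
  have nt: "n \<cdot> t \<in> Hom C U N" using H by (simp add: Hom_def)
  have "is_mono C (n \<cdot> t)"
  proof (rule monoI[OF nt])
    fix L x assume x: "x \<in> Hom C L U" "(n \<cdot> t) \<cdot> x = Zero C L N"
    have tx: "t \<cdot> x = Zero C L I"
      by (rule mono_cancel_Zero[OF kernel_mono[OF n(1)] n(2)])
         (use x H HomD[OF x(1)] in \<open>auto simp: Hom_def\<close>)
    show "x = Zero C L U"
      by (rule mono_cancel_Zero[OF kernel_mono[OF t(2)] t(1) x(1) tx])
  qed
  then obtain w where w: "is_kernel C w (n \<cdot> t)" using mono_is_kernel by blast
  then obtain Y where wY: "w \<in> Hom C N Y" using HomD[OF nt] by (auto simp: is_kernel_def Hom_def)
  have wnt: "w \<cdot> (n \<cdot> t) = Zero C U Y" using kernel_Hom(2)[OF w wY] HomD[OF nt] by simp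
  have "w \<cdot> m = (w \<cdot> (n \<cdot> t)) \<cdot> e'"
    using H HomD[OF wY] e'(2) e(2) by simp
  then have "w \<cdot> m = Zero C M Y" using wnt H Hom_objects[OF wY] by simp
  then obtain w' where w': "w' \<in> Hom C Q Y" "w' \<cdot> c = w"
    using cokernel_factor[OF c(1) m wY] H by auto
  have "c \<cdot> n = Zero C I Q" using kernel_Hom(2)[OF n(1) c(2)] H by simp
  then have "w \<cdot> n = Zero C I Y"
    using comp_reduce[OF w'(2), of n] H HomD[OF w'(1)] by simp
  then obtain s where s: "s \<in> Hom C I U" "(n \<cdot> t) \<cdot> s = n"
    using kernel_factor[OF w wY n(2)] HomD[OF nt] by auto
  have ts: "t \<cdot> s = Id C I"
    by (rule mono_cancel[OF kernel_mono[OF n(1)]]) (use s H HomD[OF s(1)] in auto)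
  have ut: "u \<cdot> t = Zero C U X" using kernel_Hom(2)[OF t(2) u(1)] H by simp
  have "u = (u \<cdot> t) \<cdot> s"
    using H HomD[OF s(1)] ts by simp
  then show "u = Zero C I X"
    using ut HomD[OF s(1)] H by simp
qed

text \<open>Epimorphisms are stable under pullback: \<open>f - g\<close> out of the direct sum is an epimorphism because
  \<open>f\<close> is, hence it is the cokernel of the pullback; an arrow \<open>x\<close> vanishing on the image of the pullback
  therefore extends to the base, where it is cancelled by \<open>f\<close>.\<close>

lemma obtain_pullback_of_epi:
  assumes e: "is_epi C f" and f: "f \<in> Hom C M K" and g: "g \<in> Hom C N K"
  obtains P u v where "u \<in> Hom C P M" "v \<in> Hom C P N" "is_pullback C f g u v" "is_epi C v"
proof -
  obtain i1 i2 p1 p2 where b: "is_biproduct C M N i1 i2 p1 p2"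
    using ex_biproduct Hom_objects[OF f] Hom_objects[OF g] by blast
  define S where "S = Cod C i1"
  note S = biproduct_Hom[OF b, folded S_def] and B = biproduct_eqs[OF b]
  note H [THEN Hom_data] = f g S(1,2,3,4)
  note R = B B[THEN comp_reduce]
  define \<phi> where "\<phi> = (f \<cdot> p1) \<boxminus> (g \<cdot> p2)"
  have \<phi>: "\<phi> \<in> Hom C S K" using H by (simp add: \<phi>_def Hom_def)
  have \<phi>i: "\<phi> \<cdot> i1 = f" using H by (simp add: \<phi>_def R)
  have \<phi>epi: "is_epi C \<phi>"
  proof (rule epiI[OF \<phi>])
    fix L x assume x: "x \<in> Hom C K L" "x \<cdot> \<phi> = Zero C S L"
    have "x \<cdot> f = (x \<cdot> \<phi>) \<cdot> i1" using \<phi>i H HomD[OF \<phi>] HomD[OF x(1)] by simp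
    then have "x \<cdot> f = Zero C M L" using x H Hom_objects[OF x(1)] by simp
    then show "x = Zero C K L" using epi_cancel_Zero[OF e f x(1)] by blast
  qed
  obtain P k where k: "k \<in> Hom C P S" "is_kernel C \<phi> k" using obtain_kernel[OF \<phi>] by blast
  have co: "is_cokernel C k \<phi>" by (rule epi_cokernel_of_kernel[OF \<phi>epi \<phi> k(2,1)])
  note KH [THEN Hom_data] = k(1) \<phi>
  have \<phi>k: "\<phi> \<cdot> k = Zero C P K" using kernel_Hom(2)[OF k(2) \<phi>] KH by simp
  then have "(f \<cdot> (p1 \<cdot> k)) \<boxminus> (g \<cdot> (p2 \<cdot> k)) = Zero C P K" using H KH by (simp add: \<phi>_def)
  then have comm: "f \<cdot> (p1 \<cdot> k) = g \<cdot> (p2 \<cdot> k)"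
    using H KH by (subst (asm) diff_eq_Zero_iff) (auto simp: Hom_def)
  have "is_pullback C f g (p1 \<cdot> k) (p2 \<cdot> k)"
    unfolding is_pullback_def
  proof (intro conjI ballI impI)
    show "f \<cdot> (p1 \<cdot> k) = g \<cdot> (p2 \<cdot> k)" by (rule comm)
    fix X a d assume X: "X \<in> Ob C" "a \<in> Hom C X (Dom C f)" "d \<in> Hom C X (Dom C g)" "f \<cdot> a = g \<cdot> d"
    note A [THEN Hom_data] = X(2,3)
    define x where "x = (i1 \<cdot> a) \<boxplus> (i2 \<cdot> d)"
    have x: "x \<in> Hom C X S" using A H by (simp add: x_def Hom_def)
    have px: "p1 \<cdot> x = a" "p2 \<cdot> x = d" using A H X by (simp_all add: x_def R)
    have "\<phi> \<cdot> x = Zero C X K" using A H X HomD[OF x] px by (simp add: \<phi>_def)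
    then obtain w where w: "w \<in> Hom C X P" "k \<cdot> w = x"
      using kernel_factor[OF k(2) \<phi> x] KH by auto
    note W [THEN Hom_data] = w(1)
    show "\<exists>!w. w \<in> Hom C X (Dom C (p1 \<cdot> k)) \<and> (p1 \<cdot> k) \<cdot> w = a \<and> (p2 \<cdot> k) \<cdot> w = d"
    proof (rule ex1I[of _ w])
      show "w \<in> Hom C X (Dom C (p1 \<cdot> k)) \<and> (p1 \<cdot> k) \<cdot> w = a \<and> (p2 \<cdot> k) \<cdot> w = d"
        using W w KH H px by (simp add: Hom_def)
      fix w' assume w': "w' \<in> Hom C X (Dom C (p1 \<cdot> k)) \<and> (p1 \<cdot> k) \<cdot> w' = a \<and> (p2 \<cdot> k) \<cdot> w' = d"
      then have W': "w' \<in> Ar C" "Dom C w' = X" "Cod C w' = P" using H KH by (auto simp: Hom_def)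
      have eq: "k \<cdot> w' = k \<cdot> w"
        by (rule biproduct_in_eq[OF b, of _ X])
           (use W W' w' w px KH H in \<open>auto simp: Hom_def\<close>)
      show "w' = w"
        by (rule mono_cancel[OF kernel_mono[OF k(2)]]) (use eq W W' KH in auto)
    qed
  qed (use H KH in auto)
  moreover have "is_epi C (p2 \<cdot> k)"
  proof (rule epiI)
    show "p2 \<cdot> k \<in> Hom C P N" using H KH by (simp add: Hom_def)
    fix L x assume x: "x \<in> Hom C N L" "x \<cdot> (p2 \<cdot> k) = Zero C P L"
    note X [THEN Hom_data] = x(1)
    obtain z where z: "z \<in> Hom C K L" "z \<cdot> \<phi> = x \<cdot> p2"
      using cokernel_factor[OF co k(1), of "x \<cdot> p2" L] X H KH x by (auto simp: Hom_def)
    note Z [THEN Hom_data] = z(1)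
    have "z \<cdot> f = (x \<cdot> p2) \<cdot> i1" using \<phi>i H KH Z comp_reduce[OF z(2), of i1] X by simp
    also have "\<dots> = Zero C M L" using X H B by simp
    finally have "z = Zero C K L" using epi_cancel_Zero[OF e f z(1)] by blast
    then have "x \<cdot> p2 = Zero C S L" using z(2) KH X H by simp
    then have "(x \<cdot> p2) \<cdot> i2 = Zero C N L" using X H by simp
    then show "x = Zero C N L" using X H B by simp
  qed
  ultimately show thesis
    using that[of "p1 \<cdot> k" P "p2 \<cdot> k"] H KH by (auto simp: Hom_def)
qed

end

section \<open>Projective subcategories and their stable categories\<close>

locale projective_subcategory = abelian_category C
  for C :: "('o, 'm, 'z) preadditive_cat_scheme" (structure) +
  fixes \<T> :: "'o set"
  assumes additive: "full_additive_subcategory C \<T>"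
    and projective: "T \<in> \<T> \<Longrightarrow> is_projective C T"
    and summands: "closed_under_summands C \<T>"
begin

lemma T_in_Ob: "T \<in> \<T> \<Longrightarrow> T \<in> Ob C"
  using additive by (auto simp: full_additive_subcategory_def)

lemma T_nonempty: obtains T where "T \<in> \<T>"
  using additive by (auto simp: full_additive_subcategory_def)

lemma T_biproduct:
  assumes "T \<in> \<T>" "T' \<in> \<T>"
  obtains P i1 i2 p1 p2 where "P \<in> \<T>" "i1 \<in> Hom C T P" "is_biproduct C T T' i1 i2 p1 p2"
proof -
  obtain i1 i2 p1 p2 where b: "is_biproduct C T T' i1 i2 p1 p2" "Cod C i1 \<in> \<T>"
    using additive assms unfolding full_additive_subcategory_def by blast
  then have "i1 \<in> Hom C T (Cod C i1)" using biproduct_Hom(1) by blast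
  then show thesis using that b by blast
qed

lemma lift:
  assumes "T \<in> \<T>" "is_epi C e" "e \<in> Hom C M N" "f \<in> Hom C T N"
  obtains g where "g \<in> Hom C T M" "e \<cdot> g = f"
  using projective[OF assms(1)] assms(2,4) HomD[OF assms(3)] unfolding is_projective_def by blast

subsection \<open>The ideal of arrows that factor through the subcategory\<close>

abbreviation factoring :: "'o \<Rightarrow> 'o \<Rightarrow> 'm set" where
  "factoring \<equiv> factoring_arrows C \<T>"

lemma factoringI:
  "T \<in> \<T> \<Longrightarrow> u \<in> Hom C M T \<Longrightarrow> v \<in> Hom C T N \<Longrightarrow> v \<cdot> u \<in> factoring M N"
  by (auto simp: factoring_arrows_def)

lemma factoringE:
  assumes "x \<in> factoring M N"
  obtains T u v where "T \<in> \<T>" "u \<in> Hom C M T" "v \<in> Hom C T N" "x = v \<cdot> u"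
  using assms by (auto simp: factoring_arrows_def)

lemma factoring_Hom: "x \<in> factoring M N \<Longrightarrow> x \<in> Hom C M N"
  by (auto elim!: factoringE simp: Hom_def)

lemma factoring_comp:
  assumes "x \<in> factoring M N"
  shows "g \<in> Hom C N L \<Longrightarrow> g \<cdot> x \<in> factoring M L"
    and "f \<in> Hom C L M \<Longrightarrow> x \<cdot> f \<in> factoring L N"
proof -
  obtain T u v where x: "T \<in> \<T>" "u \<in> Hom C M T" "v \<in> Hom C T N" "x = v \<cdot> u"
    using assms by (rule factoringE)
  note H [THEN Hom_data] = x(2,3)
  show "g \<cdot> x \<in> factoring M L" if g: "g \<in> Hom C N L"
    using factoringI[OF x(1,2), of "g \<cdot> v" L] H HomD[OF g] x(4) by (simp add: Hom_def)
  show "x \<cdot> f \<in> factoring L N" if f: "f \<in> Hom C L M"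
    using factoringI[OF x(1) _ x(3), of "u \<cdot> f" L] H HomD[OF f] x(4) by (simp add: Hom_def)
qed

lemma factoring_through_T: 
  "x \<in> Hom C M N \<Longrightarrow> N \<in> \<T> \<Longrightarrow> x \<in> factoring M N"
  "x \<in> Hom C M N \<Longrightarrow> M \<in> \<T> \<Longrightarrow> x \<in> factoring M N"
  using factoringI[of N x M "Id C N" N] factoringI[of M "Id C M" M x N] T_in_Ob
  by (auto simp: Hom_def)

lemma factoring_Zero:
  assumes "M \<in> Ob C" "N \<in> Ob C"
  shows "Zero C M N \<in> factoring M N"
proof -
  obtain T where T: "T \<in> \<T>" by (rule T_nonempty)
  show ?thesis
    using factoringI[OF T, of "Zero C M T" M "Zero C T N" N] T_in_Ob[OF T] assms
    by (simp add: Hom_def)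
qed

lemma factoring_neg:
  assumes "x \<in> factoring M N"
  shows "neg x \<in> factoring M N"
proof -
  have H: "x \<in> Hom C M N" by (rule factoring_Hom[OF assms])
  have "neg (Id C N) \<cdot> x \<in> factoring M N"
    by (rule factoring_comp(1)[OF assms]) (use Hom_objects[OF H] in \<open>auto simp: Hom_def\<close>)
  then show ?thesis using HomD[OF H] Hom_objects[OF H] by simp
qed

text \<open>The sum of \<open>v u\<close> and \<open>v' u'\<close> factors through the direct sum of the two objects of \<open>\<T>\<close>.\<close>

lemma factoring_Plus:
  assumes "x \<in> factoring M N" "y \<in> factoring M N"
  shows "x \<boxplus> y \<in> factoring M N"
proof -
  obtain T u v where x: "T \<in> \<T>" "u \<in> Hom C M T" "v \<in> Hom C T N" "x = v \<cdot> u"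
    using assms(1) by (rule factoringE)
  obtain T' u' v' where y: "T' \<in> \<T>" "u' \<in> Hom C M T'" "v' \<in> Hom C T' N" "y = v' \<cdot> u'"
    using assms(2) by (rule factoringE)
  obtain P i1 i2 p1 p2 where P: "P \<in> \<T>" "i1 \<in> Hom C T P" and b: "is_biproduct C T T' i1 i2 p1 p2"
    using T_biproduct[OF x(1) y(1)] by blast
  note B = biproduct_Hom(2-4)[OF b, unfolded HomD(3)[OF P(2)]] biproduct_eqs[OF b]
  note H [THEN Hom_data] = x(2,3) y(2,3) P(2) B(1,2,3)
  have "((v \<cdot> p1) \<boxplus> (v' \<cdot> p2)) \<cdot> ((i1 \<cdot> u) \<boxplus> (i2 \<cdot> u')) \<in> factoring M N"
    by (rule factoringI[OF P(1)]) (use H in \<open>auto simp: Hom_def\<close>)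
  also have "((v \<cdot> p1) \<boxplus> (v' \<cdot> p2)) \<cdot> ((i1 \<cdot> u) \<boxplus> (i2 \<cdot> u')) = x \<boxplus> y"
    using H x(4) y(4) Hom_objects[OF x(2)] Hom_objects[OF x(3)] Hom_objects[OF y(2)]
    by (simp add: B(4-7)[THEN comp_reduce])
  finally show ?thesis .
qed

text \<open>If the identity of \<open>M\<close> is \<open>v u\<close> with \<open>u: M \<rightarrow> T\<close>, then \<open>u\<close> splits \<open>v\<close>, so \<open>M\<close> is a direct
  summand of \<open>T\<close>.\<close>

lemma T_iff_Id_factoring:
  assumes M: "M \<in> Ob C"
  shows "M \<in> \<T> \<longleftrightarrow> Id C M \<in> factoring M M"
proof
  assume "M \<in> \<T>"
  then show "Id C M \<in> factoring M M"
    by (intro factoring_through_T(1)) (use M in \<open>auto simp: Hom_def\<close>)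
next
  assume "Id C M \<in> factoring M M"
  then obtain T u v where u: "T \<in> \<T>" "u \<in> Hom C M T" "v \<in> Hom C T M" "Id C M = v \<cdot> u"
    by (rule factoringE)
  obtain K k where k: "k \<in> Hom C K T" "is_kernel C v k" using obtain_kernel[OF u(3)] by blast
  obtain d where d: "is_biproduct C K M k u d v"
    using split_kernel_biproduct[OF k(2) u(3) k(1) u(2)] u(4) by metis
  then have "is_biproduct C M K u k v d" by (rule biproduct_swap)
  then show "M \<in> \<T>"
    using summands u(1) HomD[OF u(2)] Hom_objects[OF k(1)] M unfolding closed_under_summands_def by blast
qed

subsection \<open>The stable category\<close>

abbreviation S :: "('o, 'm set) preadditive_cat" where
  "S \<equiv> stable_category C \<T>"

abbreviation cl :: "'m \<Rightarrow> 'm set" where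
  "cl \<equiv> stable_class C \<T>"

lemma mem_cl_iff:
  assumes f: "f \<in> Hom C M N"
  shows "g \<in> cl f \<longleftrightarrow> g \<in> Hom C M N \<and> g \<boxminus> f \<in> factoring M N"
proof -
  note H [THEN Hom_data] = f
  have "g \<in> cl f \<longleftrightarrow> (\<exists>x\<in>factoring M N. g = x \<boxplus> f)"
    using H by (simp add: stable_class_def r_coset_def)
  also have "\<dots> \<longleftrightarrow> g \<in> Hom C M N \<and> g \<boxminus> f \<in> factoring M N"
  proof
    assume "\<exists>x\<in>factoring M N. g = x \<boxplus> f"
    then obtain x where x: "x \<in> factoring M N" "g = x \<boxplus> f" by blast
    show "g \<in> Hom C M N \<and> g \<boxminus> f \<in> factoring M N"
      using x H HomD[OF factoring_Hom[OF x(1)]] by (simp add: Hom_def)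
  next
    assume g: "g \<in> Hom C M N \<and> g \<boxminus> f \<in> factoring M N"
    have "g = (g \<boxminus> f) \<boxplus> f" using g H HomD[of g C M N] by simp
    then show "\<exists>x\<in>factoring M N. g = x \<boxplus> f" using g by blast
  qed
  finally show ?thesis .
qed

lemma cl_self: "f \<in> Hom C M N \<Longrightarrow> f \<in> cl f"
  using mem_cl_iff[of f M N f] factoring_Zero[of M N] HomD[of f C M N] Hom_objects[of f M N] by simp

lemma cl_eq_iff:
  assumes "f \<in> Hom C M N" "g \<in> Hom C M N"
  shows "cl f = cl g \<longleftrightarrow> f \<boxminus> g \<in> factoring M N"
proof
  assume "cl f = cl g"
  then show "f \<boxminus> g \<in> factoring M N"
    using cl_self[OF assms(1)] mem_cl_iff[OF assms(2)] by blast
next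
  note H [THEN Hom_data] = assms(1,2)
  assume fg: "f \<boxminus> g \<in> factoring M N"
  have "h \<boxminus> g \<in> factoring M N \<longleftrightarrow> h \<boxminus> f \<in> factoring M N" if h: "h \<in> Hom C M N" for h
  proof -
    have 1: "h \<boxminus> g = (h \<boxminus> f) \<boxplus> (f \<boxminus> g)" "h \<boxminus> f = (h \<boxminus> g) \<boxplus> neg (f \<boxminus> g)"
      using HomD[OF h] H by (simp_all add: Plus_commute[of "neg f" g])
    show ?thesis
      using 1 fg factoring_Plus factoring_neg by metis
  qed
  then show "cl f = cl g"
    using mem_cl_iff[OF assms(1)] mem_cl_iff[OF assms(2)] by blast
qed

lemma rep_cl:
  assumes "f \<in> Hom C M N"
  shows "(SOME g. g \<in> cl f) \<in> Hom C M N" "cl (SOME g. g \<in> cl f) = cl f"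
proof -
  have "(SOME g. g \<in> cl f) \<in> cl f" using cl_self[OF assms] by (rule someI)
  then show "(SOME g. g \<in> cl f) \<in> Hom C M N" "cl (SOME g. g \<in> cl f) = cl f"
    using mem_cl_iff[OF assms] cl_eq_iff[OF _ assms] by blast+
qed

lemma cl_comp_cong:
  assumes "f \<in> Hom C L M" "f' \<in> Hom C L M" "g \<in> Hom C M N" "g' \<in> Hom C M N"
    "cl f = cl f'" "cl g = cl g'"
  shows "cl (g \<cdot> f) = cl (g' \<cdot> f')"
proof -
  note H [THEN Hom_data] = assms(1,2,3,4)
  have "f \<boxminus> f' \<in> factoring L M" "g \<boxminus> g' \<in> factoring M N"
    using cl_eq_iff assms by blast+
  then have "(g \<cdot> (f \<boxminus> f')) \<boxplus> ((g \<boxminus> g') \<cdot> f') \<in> factoring L N"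
    using factoring_comp factoring_Plus assms by blast
  also have "(g \<cdot> (f \<boxminus> f')) \<boxplus> ((g \<boxminus> g') \<cdot> f') = (g \<cdot> f) \<boxminus> (g' \<cdot> f')"
    using H by simp
  finally show ?thesis
    using H by (subst cl_eq_iff) (auto simp: Hom_def)
qed

lemma S_simps [simp]:
  "Ob S = Ob C"
  "f \<in> Ar C \<Longrightarrow> cl f \<in> Ar S"
  "f \<in> Ar C \<Longrightarrow> Dom S (cl f) = Dom C f"
  "f \<in> Ar C \<Longrightarrow> Cod S (cl f) = Cod C f"
  "Id S M = cl (Id C M)"
proof -
  show "Ob S = Ob C" "f \<in> Ar C \<Longrightarrow> cl f \<in> Ar S" "Id S M = cl (Id C M)"
    by (simp_all add: stable_category_def)
  show "f \<in> Ar C \<Longrightarrow> Dom S (cl f) = Dom C f" "f \<in> Ar C \<Longrightarrow> Cod S (cl f) = Cod C f"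
    using rep_cl(1)[of f "Dom C f" "Cod C f"] by (simp_all add: stable_category_def Hom_def)
qed

lemma S_Comp [simp]:
  assumes "f \<in> Ar C" "g \<in> Ar C" "Dom C g = Cod C f"
  shows "cl g \<cdot>\<^bsub>S\<^esub> cl f = cl (g \<cdot> f)"
proof -
  have f: "f \<in> Hom C (Dom C f) (Cod C f)" and g: "g \<in> Hom C (Cod C f) (Cod C g)"
    using assms by (auto simp: Hom_def)
  show ?thesis
    using cl_comp_cong[OF rep_cl(1)[OF f] f rep_cl(1)[OF g] g rep_cl(2)[OF f] rep_cl(2)[OF g]]
    by (simp add: stable_category_def)
qed

lemma cl_in_Hom: "f \<in> Hom C M N \<Longrightarrow> cl f \<in> Hom S M N"
  by (auto simp: Hom_iff)

lemma S_HomE: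
  assumes "x \<in> Hom S M N"
  obtains f where "f \<in> Hom C M N" "x = cl f"
proof -
  obtain f where f: "f \<in> Ar C" "x = cl f"
    using assms by (auto simp: Hom_iff stable_category_def)
  then show thesis using that[of f] assms by (auto simp: Hom_iff)
qed

lemma category_S: "category S"
proof
  fix f assume "f \<in> Ar S"
  then obtain f' where "f' \<in> Hom C (Dom S f) (Cod S f)"
    using S_HomE[of f "Dom S f" "Cod S f"] by (auto simp: Hom_iff)
  then show "Dom S f \<in> Ob S" "Cod S f \<in> Ob S" using Hom_objects by auto
next
  fix M assume "M \<in> Ob S"
  then show "Id S M \<in> Hom S M M" by (simp add: Hom_iff)
next
  fix f g L M N assume "f \<in> Hom S L M" "g \<in> Hom S M N"
  then obtain f' g' where f: "f' \<in> Hom C L M" "f = cl f'" and g: "g' \<in> Hom C M N" "g = cl g'"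
    using S_HomE by metis
  show "g \<cdot>\<^bsub>S\<^esub> f \<in> Hom S L N"
    unfolding f(2) g(2) using HomD[OF f(1)] HomD[OF g(1)] by (simp add: Hom_iff)
next
  fix f M N assume "f \<in> Hom S M N"
  then obtain f' where f: "f' \<in> Hom C M N" "f = cl f'" using S_HomE by metis
  show "f \<cdot>\<^bsub>S\<^esub> Id S M = f" "Id S N \<cdot>\<^bsub>S\<^esub> f = f"
    unfolding f(2) using HomD[OF f(1)] Hom_objects[OF f(1)] by simp_all
next
  fix f g h K L M N assume "f \<in> Hom S K L" "g \<in> Hom S L M" "h \<in> Hom S M N"
  then obtain f' g' h' where f: "f' \<in> Hom C K L" "f = cl f'" and g: "g' \<in> Hom C L M" "g = cl g'"
    and h: "h' \<in> Hom C M N" "h = cl h'"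
    using S_HomE by metis
  show "h \<cdot>\<^bsub>S\<^esub> g \<cdot>\<^bsub>S\<^esub> f = h \<cdot>\<^bsub>S\<^esub> (g \<cdot>\<^bsub>S\<^esub> f)"
    unfolding f(2) g(2) h(2) using HomD[OF f(1)] HomD[OF g(1)] HomD[OF h(1)] by simp
qed

lemma S_iso_iff:
  assumes f: "f \<in> Hom C M N"
  shows "is_iso S (cl f) \<longleftrightarrow>
    (\<exists>g\<in>Hom C N M. (g \<cdot> f) \<boxminus> Id C M \<in> factoring M M \<and> (f \<cdot> g) \<boxminus> Id C N \<in> factoring N N)"
proof -
  note H [THEN Hom_data] = f
  have inv: "cl g \<cdot>\<^bsub>S\<^esub> cl f = Id S M \<and> cl f \<cdot>\<^bsub>S\<^esub> cl g = Id S N \<longleftrightarrow>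
      (g \<cdot> f) \<boxminus> Id C M \<in> factoring M M \<and> (f \<cdot> g) \<boxminus> Id C N \<in> factoring N N"
    if g: "g \<in> Hom C N M" for g
  proof -
    note G [THEN Hom_data] = g
    have "cl (g \<cdot> f) = cl (Id C M) \<longleftrightarrow> (g \<cdot> f) \<boxminus> Id C M \<in> factoring M M"
      "cl (f \<cdot> g) = cl (Id C N) \<longleftrightarrow> (f \<cdot> g) \<boxminus> Id C N \<in> factoring N N"
      using H G by (auto intro!: cl_eq_iff simp: Hom_def)
    then show ?thesis using H G by simp
  qed
  have S: "cl f \<in> Hom S M N" by (rule cl_in_Hom[OF f])
  show ?thesis
  proof
    assume "is_iso S (cl f)"
    then obtain y where y: "y \<in> Hom S N M" "y \<cdot>\<^bsub>S\<^esub> cl f = Id S M" "cl f \<cdot>\<^bsub>S\<^esub> y = Id S N"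
      using category.isoE[OF category_S _ S] by blast
    obtain g where g: "g \<in> Hom C N M" "y = cl g" using S_HomE[OF y(1)] by blast
    show "\<exists>g\<in>Hom C N M. (g \<cdot> f) \<boxminus> Id C M \<in> factoring M M \<and> (f \<cdot> g) \<boxminus> Id C N \<in> factoring N N"
      using inv[OF g(1)] y g by blast
  next
    assume "\<exists>g\<in>Hom C N M. (g \<cdot> f) \<boxminus> Id C M \<in> factoring M M \<and> (f \<cdot> g) \<boxminus> Id C N \<in> factoring N N"
    then obtain g where g: "g \<in> Hom C N M" "cl g \<cdot>\<^bsub>S\<^esub> cl f = Id S M" "cl f \<cdot>\<^bsub>S\<^esub> cl g = Id S N"
      using inv by blast
    show "is_iso S (cl f)"
      by (rule category.isoI[OF category_S S cl_in_Hom[OF g(1)] g(2,3)])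
  qed
qed

lemma S_iso_of_iso:
  assumes "is_iso C f" "f \<in> Hom C M N"
  shows "is_iso S (cl f)"
proof -
  obtain g where g: "g \<in> Hom C N M" "g \<cdot> f = Id C M" "f \<cdot> g = Id C N"
    using isoE[OF assms] by blast
  show ?thesis
    by (rule category.isoI[OF category_S cl_in_Hom[OF assms(2)] cl_in_Hom[OF g(1)]])
       (use g HomD[OF g(1)] HomD[OF assms(2)] in auto)
qed

lemma S_zero_object_iff:
  assumes Z: "Z \<in> Ob C"
  shows "is_zero_object S Z \<longleftrightarrow> Z \<in> \<T>"
proof
  assume "is_zero_object S Z"
  then have ex: "\<exists>!f. f \<in> Hom S Z Z" using Z by (auto simp: is_zero_object_def)
  have H: "Id C Z \<in> Hom C Z Z" "Zero C Z Z \<in> Hom C Z Z" using Z by (auto simp: Hom_def)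
  have "cl (Id C Z) = cl (Zero C Z Z)" using cl_in_Hom[OF H(1)] cl_in_Hom[OF H(2)] ex by blast
  then have "Id C Z \<in> factoring Z Z" using cl_eq_iff[OF H] Z by simp
  then show "Z \<in> \<T>" using T_iff_Id_factoring[OF Z] by blast
next
  assume T: "Z \<in> \<T>"
  have 1: "x = cl (Zero C M N)" if x: "x \<in> Hom S M N" "M = Z \<or> N = Z" for x M N
  proof -
    obtain f where f: "f \<in> Hom C M N" "x = cl f" using S_HomE[OF x(1)] by blast
    have "f \<in> factoring M N" using factoring_through_T f x(2) T by blast
    then have "cl f = cl (Zero C M N)"
      using f Hom_objects[OF f(1)] HomD[OF f(1)] by (subst cl_eq_iff) (auto simp: Hom_def)
    then show ?thesis using f by simp
  qed
  have 2: "cl (Zero C M N) \<in> Hom S M N" if "M \<in> Ob C" "N \<in> Ob C" for M N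
    using that by (intro cl_in_Hom) (auto simp: Hom_def)
  show "is_zero_object S Z"
    unfolding is_zero_object_def
  proof (intro conjI ballI)
    fix M assume "M \<in> Ob S"
    then have "M \<in> Ob C" by simp
    then show "\<exists>!f. f \<in> Hom S Z M" "\<exists>!f. f \<in> Hom S M Z"
      using 1[of _ Z M] 1[of _ M Z] 2[of Z M] 2[of M Z] Z by metis+
  qed (use Z in simp)
qed

lemma T_iso_closed:
  assumes "is_iso S a" "a \<in> Hom S M N" "M \<in> \<T>"
  shows "N \<in> \<T>"
proof -
  obtain f where f: "f \<in> Hom C M N" "a = cl f" using S_HomE[OF assms(2)] by blast
  obtain g where g: "g \<in> Hom C N M" "(f \<cdot> g) \<boxminus> Id C N \<in> factoring N N"
    using assms(1) S_iso_iff[OF f(1)] f(2) by blast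
  note H [THEN Hom_data] = f(1) g(1)
  have "f \<cdot> g \<in> factoring N N" by (rule factoringI[OF assms(3) g(1) f(1)])
  then have "(f \<cdot> g) \<boxplus> neg ((f \<cdot> g) \<boxminus> Id C N) \<in> factoring N N"
    using factoring_Plus factoring_neg g(2) by blast
  also have "(f \<cdot> g) \<boxplus> neg ((f \<cdot> g) \<boxminus> Id C N) = Id C N" using H by simp
  finally show ?thesis using T_iff_Id_factoring H by blast
qed

section \<open>Monomorphisms out of the projective subcategory\<close>

lemma zero_kernel_iso:
  assumes f: "f \<in> Hom C M N" "is_epi C f" and l: "is_kernel C f l" "l \<in> Hom C T M" "l = Zero C T M"
  shows "is_iso C f"
proof (rule mono_epi_iso[OF monoI[OF f(1)] f(2)])
  fix L x assume x: "x \<in> Hom C L M" "f \<cdot> x = Zero C L N"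
  obtain w where w: "w \<in> Hom C L T" "l \<cdot> w = x"
    using kernel_factor[OF l(1) f(1) x] HomD[OF l(2)] by auto
  then show "x = Zero C L M" using l HomD[OF w(1)] Hom_objects[OF l(2)] by auto
qed

lemma embeds_imp_nonzero_through_injective:
  assumes "embeds_in_injectives C \<T>"
  shows "nonzero_through_injective C \<T>"
  unfolding nonzero_through_injective_def
proof (intro ballI impI)
  fix T assume T: "T \<in> \<T>" "\<not> is_zero_object C T"
  obtain E m where E: "E \<in> \<T>" "is_injective C E" "m \<in> Hom C T E" "is_mono C m"
    using assms T unfolding embeds_in_injectives_def by blast
  note H [THEN Hom_data] = E(3)
  have "m \<noteq> Zero C T E" using mono_eq_Zero_iff[OF E(4,3)] T(2) by blast
  moreover have "m = Id C E \<cdot> m" "Id C E \<in> Hom C E E" using H by (auto simp: Hom_def)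
  ultimately show "\<exists>T'\<in>\<T>. \<exists>\<phi>\<in>Hom C T T'. \<phi> \<noteq> Zero C T T' \<and>
      (\<exists>E. is_injective C E \<and> (\<exists>u\<in>Hom C T E. \<exists>v\<in>Hom C E T'. \<phi> = v \<cdot> u))"
    using E by blast
qed

text \<open>An arrow out of \<open>T\<close> that factors through an injective object extends along every monomorphism
  \<open>j: T \<rightarrow> M\<close>.\<close>

lemma nonzero_through_injective_imp_detected:
  assumes "nonzero_through_injective C \<T>"
  shows "nonzero_mono_detected C \<T>"
  unfolding nonzero_mono_detected_def
proof (intro ballI impI)
  fix T M j assume T: "T \<in> \<T>" and M: "M \<in> Ob C" and j: "j \<in> Hom C T M" "is_mono C j \<and> j \<noteq> Zero C T M"
  note H [THEN Hom_data] = j(1)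
  have "\<not> is_zero_object C T" using mono_eq_Zero_iff[OF _ j(1)] j(2) by blast
  then obtain T' \<phi> E u v where E: "T' \<in> \<T>" "\<phi> \<noteq> Zero C T T'" "is_injective C E"
    "u \<in> Hom C T E" "v \<in> Hom C E T'" "\<phi> = v \<cdot> u"
    using assms T unfolding nonzero_through_injective_def by blast
  obtain w where w: "w \<in> Hom C M E" "w \<cdot> j = u"
    using E(3,4) j H unfolding is_injective_def by metis
  note W [THEN Hom_data] = w(1) E(5)
  have "v \<cdot> w \<in> Hom C M T'" "(v \<cdot> w) \<cdot> j \<noteq> Zero C T T'"
    using W H E(2,6) w(2) by (auto simp: Hom_def)
  then show "\<exists>T'\<in>\<T>. \<exists>h\<in>Hom C M T'. h \<cdot> j \<noteq> Zero C T T'" using E(1) by blast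
qed

lemma detected_imp_nonzero_through_injective:
  assumes d: "nonzero_mono_detected C \<T>" and enough: "enough_injectives C"
  shows "nonzero_through_injective C \<T>"
  unfolding nonzero_through_injective_def
proof (intro ballI impI)
  fix T assume T: "T \<in> \<T>" "\<not> is_zero_object C T"
  obtain E m where E: "is_injective C E" "m \<in> Hom C T E" "is_mono C m"
    using enough T_in_Ob[OF T(1)] unfolding enough_injectives_def by blast
  note H [THEN Hom_data] = E(2)
  have "m \<noteq> Zero C T E" using mono_eq_Zero_iff[OF E(3,2)] T(2) by blast
  then obtain T' h where "T' \<in> \<T>" "h \<in> Hom C E T'" "h \<cdot> m \<noteq> Zero C T T'"
    using d T(1) E H unfolding nonzero_mono_detected_def by blast
  moreover have "h \<cdot> m \<in> Hom C T T'" using H HomD[OF \<open>h \<in> Hom C E T'\<close>] by (simp add: Hom_def)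
  ultimately show "\<exists>T'\<in>\<T>. \<exists>\<phi>\<in>Hom C T T'. \<phi> \<noteq> Zero C T T' \<and>
      (\<exists>E. is_injective C E \<and> (\<exists>u\<in>Hom C T E. \<exists>v\<in>Hom C E T'. \<phi> = v \<cdot> u))"
    using E by blast
qed

text \<open>A monomorphism \<open>j\<close> out of \<open>\<T>\<close> and an epimorphism with kernel in \<open>\<T>\<close> are the two ends of one
  short exact sequence, and the epimorphism is invertible exactly when \<open>j = 0\<close>.\<close>

lemma epi_iso_iff_detected:
  "epi_with_invisible_kernel_iso C \<T> \<longleftrightarrow> nonzero_mono_detected C \<T>"
proof
  assume iso: "epi_with_invisible_kernel_iso C \<T>"
  show "nonzero_mono_detected C \<T>"
    unfolding nonzero_mono_detected_def
  proof (intro ballI impI, rule ccontr)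
    fix T M j assume T: "T \<in> \<T>" and M: "M \<in> Ob C" and j: "j \<in> Hom C T M" "is_mono C j \<and> j \<noteq> Zero C T M"
      and none: "\<not> (\<exists>T'\<in>\<T>. \<exists>h\<in>Hom C M T'. h \<cdot> j \<noteq> Zero C T T')"
    obtain Q f where f: "f \<in> Hom C M Q" "is_cokernel C j f" using obtain_cokernel[OF j(1)] by blast
    have k: "is_kernel C f j" using mono_kernel_of_cokernel[OF _ j(1) f(2,1)] j by blast
    have epi: "is_epi C f" by (rule cokernel_epi[OF f(2)])
    note H [THEN Hom_data] = j(1) f(1)
    have "is_iso C f"
      using iso f(1) H epi k T none unfolding epi_with_invisible_kernel_iso_def by metis
    then obtain g where g: "g \<in> Hom C Q M" "g \<cdot> f = Id C M" using isoE f(1) by metis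
    have "f \<cdot> j = Zero C T Q" using kernel_Hom(2)[OF k f(1)] H by simp
    then have "g \<cdot> (f \<cdot> j) = Zero C T M" using HomD[OF g(1)] H by simp
    then show False using comp_reduce[OF g(2), of j] H HomD[OF g(1)] j by simp
  qed
next
  assume d: "nonzero_mono_detected C \<T>"
  show "epi_with_invisible_kernel_iso C \<T>"
    unfolding epi_with_invisible_kernel_iso_def
  proof (intro ballI allI impI)
    fix M N f l assume f: "f \<in> Hom C M N"
      and hyp: "is_epi C f \<and> is_kernel C f l \<and> Dom C l \<in> \<T> \<and>
        (\<forall>T\<in>\<T>. \<forall>h\<in>Hom C M T. h \<cdot> l = Zero C (Dom C l) T)"
    have l: "l \<in> Hom C (Dom C l) M" "is_mono C l"
      using kernel_Hom(1)[of f l M N] kernel_mono hyp f by auto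
    have "l = Zero C (Dom C l) M"
      using d hyp l Hom_objects[OF f] unfolding nonzero_mono_detected_def by blast
    then show "is_iso C f" using zero_kernel_iso[OF f _ _ l(1)] hyp by blast
  qed
qed

section \<open>Standard triangles\<close>

text \<open>An arrow \<open>a\<close> in the class of the identity differs from it by \<open>d i\<close>, as every arrow into \<open>\<T>\<close>
  extends along the preenvelope \<open>i\<close>; so the induced arrow on the cokernels differs from the identity
  by an arrow through the target of \<open>i\<close>.\<close>

lemma Susp_Id:
  assumes c: "preenvelope_choice C \<T> i q" and M: "M \<in> Ob C"
  shows "Susp C \<T> i q (cl (Id C M)) = cl (Id C (Cod C (q M)))"
proof -
  define T Q where "T = Cod C (i M)" and "Q = Cod C (q M)"
  have pre: "is_preenvelope C \<T> M (i M)" and cok: "is_cokernel C (i M) (q M)"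
    using c M by (auto simp: preenvelope_choice_def)
  have i: "i M \<in> Hom C M T" and T: "T \<in> \<T>"
    and ext: "\<And>T' f. T' \<in> \<T> \<Longrightarrow> f \<in> Hom C M T' \<Longrightarrow> \<exists>g\<in>Hom C T T'. g \<cdot> i M = f"
    using pre by (auto simp: is_preenvelope_def T_def Hom_iff)
  have q: "q M \<in> Hom C T Q" and qi: "q M \<cdot> i M = Zero C M Q"
    using cokernel_Hom[OF cok i] by (auto simp: Q_def)
  note H [THEN Hom_data] = i q
  have IdM: "Id C M \<in> Hom C M M" using M by (simp add: Hom_def)
  let ?P = "\<lambda>Y. \<exists>a t s. a \<in> cl (Id C M) \<and>
     t \<in> Hom C (Cod C (i (Dom C a))) (Cod C (i (Cod C a))) \<and>
     s \<in> Hom C (Cod C (q (Dom C a))) (Cod C (q (Cod C a))) \<and>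
     t \<cdot> i (Dom C a) = i (Cod C a) \<cdot> a \<and> s \<cdot> q (Dom C a) = q (Cod C a) \<cdot> t \<and> Y = cl s"
  have "?P (cl (Id C Q))"
    by (rule exI[of _ "Id C M"], rule exI[of _ "Id C T"], rule exI[of _ "Id C Q"])
       (use cl_self[OF IdM] H M in \<open>auto simp: Hom_def\<close>)
  moreover have "Y = cl (Id C Q)" if Y: "?P Y" for Y
  proof -
    obtain a t s where a: "a \<in> cl (Id C M)"
      and t: "t \<in> Hom C (Cod C (i (Dom C a))) (Cod C (i (Cod C a)))"
      and s: "s \<in> Hom C (Cod C (q (Dom C a))) (Cod C (q (Cod C a)))"
      and eq: "t \<cdot> i (Dom C a) = i (Cod C a) \<cdot> a" "s \<cdot> q (Dom C a) = q (Cod C a) \<cdot> t" "Y = cl s"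
      using Y by blast
    have aM: "a \<in> Hom C M M" and fac: "a \<boxminus> Id C M \<in> factoring M M"
      using a mem_cl_iff[OF IdM] by auto
    note A [THEN Hom_data] = aM
    have t: "t \<in> Hom C T T" and s: "s \<in> Hom C Q Q"
      and ti: "t \<cdot> i M = i M \<cdot> a" and sq: "s \<cdot> q M = q M \<cdot> t"
      using t s eq A H by simp_all
    note TS [THEN Hom_data] = t s
    obtain T' u v where u: "T' \<in> \<T>" "u \<in> Hom C M T'" "v \<in> Hom C T' M" "a \<boxminus> Id C M = v \<cdot> u"
      using fac by (rule factoringE)
    obtain u' where u': "u' \<in> Hom C T T'" "u' \<cdot> i M = u" using ext u by blast
    define d where "d = v \<cdot> u'"
    have d: "d \<in> Hom C T M" using HomD[OF u(3)] HomD[OF u'(1)] by (simp add: d_def Hom_def)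
    note D [THEN Hom_data] = d
    have "a \<boxminus> Id C M = d \<cdot> i M"
      using u(4) u'(2) HomD[OF u(3)] HomD[OF u'(1)] H by (simp add: d_def)
    then have a_eq: "a = (d \<cdot> i M) \<boxplus> Id C M"
      using aM D H by (subst (asm) diff_eq_iff) (auto simp: Hom_def)
    have "((t \<boxminus> Id C T) \<boxminus> (i M \<cdot> d)) \<cdot> i M = (t \<cdot> i M) \<boxplus> (neg (i M) \<boxplus> neg (i M \<cdot> (d \<cdot> i M)))"
      using TS D H by simp
    also have "\<dots> = Zero C M T"
      unfolding ti unfolding a_eq using TS D H by simp
    finally obtain r where r: "r \<in> Hom C Q T" "r \<cdot> q M = (t \<boxminus> Id C T) \<boxminus> (i M \<cdot> d)"
      using cokernel_factor[OF cok i, of "(t \<boxminus> Id C T) \<boxminus> (i M \<cdot> d)" T] TS D H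
      by (auto simp: Hom_def)
    note R [THEN Hom_data] = r(1)
    have "(q M \<cdot> r) \<cdot> q M = q M \<cdot> ((t \<boxminus> Id C T) \<boxminus> (i M \<cdot> d))"
      using r R H by simp
    also have "\<dots> = (s \<boxminus> Id C Q) \<cdot> q M"
      using TS D H sq by (simp add: comp_reduce[OF qi])
    finally have eq': "(q M \<cdot> r) \<cdot> q M = (s \<boxminus> Id C Q) \<cdot> q M" .
    have "s \<boxminus> Id C Q = q M \<cdot> r"
      by (rule epi_cancel[OF cokernel_epi[OF cok] _ _ _ _ _ eq'[symmetric]]) (use TS R H in simp_all)
    then have "s \<boxminus> Id C Q \<in> factoring Q Q" using factoringI[OF T r(1) q] by simp
    then have "cl s = cl (Id C Q)" using s H by (subst cl_eq_iff) (auto simp: Hom_def)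
    then show ?thesis using eq(3) by simp
  qed
  ultimately show ?thesis unfolding Susp_def Q_def[symmetric] by (rule the_equality)
qed

lemma Loop_Id:
  assumes c: "precover_choice C \<T> k p" and M: "M \<in> Ob C"
  shows "Loop C \<T> k p (cl (Id C M)) = cl (Id C (Dom C (k M)))"
proof -
  define T Q where "T = Dom C (p M)" and "Q = Dom C (k M)"
  have pre: "is_precover C \<T> M (p M)" and ker: "is_kernel C (p M) (k M)"
    using c M by (auto simp: precover_choice_def)
  have p: "p M \<in> Hom C T M" and T: "T \<in> \<T>"
    and ext: "\<And>T' f. T' \<in> \<T> \<Longrightarrow> f \<in> Hom C T' M \<Longrightarrow> \<exists>g\<in>Hom C T' T. p M \<cdot> g = f"
    using pre by (auto simp: is_precover_def T_def Hom_iff)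
  have k: "k M \<in> Hom C Q T" and pk: "p M \<cdot> k M = Zero C Q M"
    using kernel_Hom[OF ker p] by (auto simp: Q_def)
  note H [THEN Hom_data] = p k
  have IdM: "Id C M \<in> Hom C M M" using M by (simp add: Hom_def)
  let ?P = "\<lambda>Y. \<exists>a t s. a \<in> cl (Id C M) \<and>
     t \<in> Hom C (Dom C (p (Dom C a))) (Dom C (p (Cod C a))) \<and>
     s \<in> Hom C (Dom C (k (Dom C a))) (Dom C (k (Cod C a))) \<and>
     p (Cod C a) \<cdot> t = a \<cdot> p (Dom C a) \<and> k (Cod C a) \<cdot> s = t \<cdot> k (Dom C a) \<and> Y = cl s"
  have "?P (cl (Id C Q))"
    by (rule exI[of _ "Id C M"], rule exI[of _ "Id C T"], rule exI[of _ "Id C Q"])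
       (use cl_self[OF IdM] H M in \<open>auto simp: Hom_def\<close>)
  moreover have "Y = cl (Id C Q)" if Y: "?P Y" for Y
  proof -
    obtain a t s where a: "a \<in> cl (Id C M)"
      and t: "t \<in> Hom C (Dom C (p (Dom C a))) (Dom C (p (Cod C a)))"
      and s: "s \<in> Hom C (Dom C (k (Dom C a))) (Dom C (k (Cod C a)))"
      and eq: "p (Cod C a) \<cdot> t = a \<cdot> p (Dom C a)" "k (Cod C a) \<cdot> s = t \<cdot> k (Dom C a)" "Y = cl s"
      using Y by blast
    have aM: "a \<in> Hom C M M" and fac: "a \<boxminus> Id C M \<in> factoring M M"
      using a mem_cl_iff[OF IdM] by auto
    note A [THEN Hom_data] = aM
    have t: "t \<in> Hom C T T" and s: "s \<in> Hom C Q Q"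
      and pt: "p M \<cdot> t = a \<cdot> p M" and ks: "k M \<cdot> s = t \<cdot> k M"
      using t s eq A H by simp_all
    note TS [THEN Hom_data] = t s
    obtain T' u v where u: "T' \<in> \<T>" "u \<in> Hom C M T'" "v \<in> Hom C T' M" "a \<boxminus> Id C M = v \<cdot> u"
      using fac by (rule factoringE)
    obtain v' where v': "v' \<in> Hom C T' T" "p M \<cdot> v' = v" using ext u by blast
    define d where "d = v' \<cdot> u"
    have d: "d \<in> Hom C M T" using HomD[OF u(2)] HomD[OF v'(1)] by (simp add: d_def Hom_def)
    note D [THEN Hom_data] = d
    have "a \<boxminus> Id C M = p M \<cdot> d"
      using u(4) HomD[OF u(2)] HomD[OF v'(1)] H by (simp add: d_def comp_reduce[OF v'(2)])
    then have a_eq: "a = (p M \<cdot> d) \<boxplus> Id C M"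
      using aM D H by (subst (asm) diff_eq_iff) (auto simp: Hom_def)
    have "p M \<cdot> ((t \<boxminus> Id C T) \<boxminus> (d \<cdot> p M)) = (p M \<cdot> t) \<boxplus> (neg (p M) \<boxplus> neg (p M \<cdot> (d \<cdot> p M)))"
      using TS D H by simp
    also have "\<dots> = Zero C T M"
      unfolding pt unfolding a_eq using TS D H by simp
    finally obtain r where r: "r \<in> Hom C T Q" "k M \<cdot> r = (t \<boxminus> Id C T) \<boxminus> (d \<cdot> p M)"
      using kernel_factor[OF ker p, of "(t \<boxminus> Id C T) \<boxminus> (d \<cdot> p M)" T] TS D H
      by (auto simp: Hom_def)
    note R [THEN Hom_data] = r(1)
    have "k M \<cdot> (r \<cdot> k M) = ((t \<boxminus> Id C T) \<boxminus> (d \<cdot> p M)) \<cdot> k M"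
      using R H by (simp only: comp_reduce[OF r(2)])
    also have "\<dots> = k M \<cdot> (s \<boxminus> Id C Q)"
      using TS D H ks pk by simp
    finally have eq': "k M \<cdot> (r \<cdot> k M) = k M \<cdot> (s \<boxminus> Id C Q)" .
    have "s \<boxminus> Id C Q = r \<cdot> k M"
      by (rule mono_cancel[OF kernel_mono[OF ker] _ _ _ _ _ eq'[symmetric]]) (use TS R H in simp_all)
    then have "s \<boxminus> Id C Q \<in> factoring Q Q" using factoringI[OF T k r(1)] by simp
    then have "cl s = cl (Id C Q)" using s H by (subst cl_eq_iff) (auto simp: Hom_def)
    then show ?thesis using eq(3) by simp
  qed
  ultimately show ?thesis unfolding Loop_def Q_def[symmetric] by (rule the_equality)
qed

lemma standard_left_imp_left_triangle:
  assumes c: "precover_choice C \<T> k p" and f: "f \<in> Hom C M N"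
    and std: "standard_left_triangle C k p h g f"
  shows "left_triangle C \<T> k p (cl h) (cl g) (cl f)"
proof -
  note F [THEN Hom_data] = f
  define K where "K = Dom C (k N)"
  obtain v where po: "is_pullback C (p N) f v g" and h: "h \<in> Hom C K (Dom C g)"
    using std F unfolding standard_left_triangle_def K_def by auto
  have g: "g \<in> Hom C (Dom C g) M" using po F unfolding is_pullback_def Hom_def by auto
  note H [THEN Hom_data] = h g
  have loop: "Loop C \<T> k p (cl (Id C N)) = cl (Id C K)"
    unfolding K_def by (rule Loop_Id[OF c]) (use F in simp)
  have iso: "is_iso S (cl (Id C X))" if "X \<in> Ob C" for X
    using category.iso_Id[OF category_S, of X] that by simp
  show ?thesis
    unfolding left_triangle_def Let_def
  proof (intro bexI conjI)
    show "cl h \<in> Hom S (Dom C (k N)) (Dom C g)" using h cl_in_Hom K_def by blast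
    show "cl g \<in> Hom S (Dom C g) M" "cl f \<in> Hom S M N" using f g cl_in_Hom by blast+
    have "cl (Id C (Dom C g)) \<cdot>\<^bsub>S\<^esub> cl h = cl h \<cdot>\<^bsub>S\<^esub> Loop C \<T> k p (cl (Id C N))"
      "cl (Id C M) \<cdot>\<^bsub>S\<^esub> cl g = cl g \<cdot>\<^bsub>S\<^esub> cl (Id C (Dom C g))"
      "cl (Id C N) \<cdot>\<^bsub>S\<^esub> cl f = cl f \<cdot>\<^bsub>S\<^esub> cl (Id C M)"
      unfolding loop using H F by simp_all
    moreover have "cl (Id C (Dom C g)) \<in> Hom S (Dom C g) (Dom C g)"
      "cl (Id C M) \<in> Hom S M (Dom C f)" "cl (Id C N) \<in> Hom S N (Cod C f)"
      using H F by (simp_all add: Hom_iff)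
    moreover have "is_iso S (cl (Id C (Dom C g)))" "is_iso S (cl (Id C M))" "is_iso S (cl (Id C N))"
      using H F by (auto intro!: iso)
    ultimately show "\<exists>f' g' h' a b c. standard_left_triangle C k p h' g' f' \<and>
           a \<in> Hom S (Dom C g) (Dom C g') \<and> b \<in> Hom S M (Dom C f') \<and> c \<in> Hom S N (Cod C f') \<and>
           is_iso S a \<and> is_iso S b \<and> is_iso S c \<and>
           a \<cdot>\<^bsub>S\<^esub> cl h = cl h' \<cdot>\<^bsub>S\<^esub> Loop C \<T> k p c \<and>
           b \<cdot>\<^bsub>S\<^esub> cl g = cl g' \<cdot>\<^bsub>S\<^esub> a \<and>
           c \<cdot>\<^bsub>S\<^esub> cl f = cl f' \<cdot>\<^bsub>S\<^esub> b"
      using std by blast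
  qed (use H F in auto)
qed

lemma standard_right_imp_right_triangle:
  assumes c: "preenvelope_choice C \<T> i q" and f: "f \<in> Hom C M N"
    and std: "standard_right_triangle C i q f g h"
  shows "right_triangle C \<T> i q (cl f) (cl g) (cl h)"
proof -
  note F [THEN Hom_data] = f
  define K where "K = Cod C (q M)"
  obtain v where po: "is_pushout C (i M) f v g" and h: "h \<in> Hom C (Cod C g) K"
    using std F unfolding standard_right_triangle_def K_def by auto
  have g: "g \<in> Hom C N (Cod C g)" using po F unfolding is_pushout_def Hom_def by auto
  note H [THEN Hom_data] = h g
  have susp: "Susp C \<T> i q (cl (Id C M)) = cl (Id C K)"
    unfolding K_def by (rule Susp_Id[OF c]) (use F in simp)
  have iso: "is_iso S (cl (Id C X))" if "X \<in> Ob C" for X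
    using category.iso_Id[OF category_S, of X] that by simp
  show ?thesis
    unfolding right_triangle_def Let_def
  proof (intro bexI conjI)
    show "cl h \<in> Hom S (Cod C g) (Cod C (q M))" using h cl_in_Hom K_def by blast
    show "cl g \<in> Hom S N (Cod C g)" "cl f \<in> Hom S M N" using f g cl_in_Hom by blast+
    have "Susp C \<T> i q (cl (Id C M)) \<cdot>\<^bsub>S\<^esub> cl h = cl h \<cdot>\<^bsub>S\<^esub> cl (Id C (Cod C g))"
      "cl (Id C (Cod C g)) \<cdot>\<^bsub>S\<^esub> cl g = cl g \<cdot>\<^bsub>S\<^esub> cl (Id C N)"
      "cl (Id C N) \<cdot>\<^bsub>S\<^esub> cl f = cl f \<cdot>\<^bsub>S\<^esub> cl (Id C M)"
      unfolding susp using H F by simp_all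
    moreover have "cl (Id C (Cod C g)) \<in> Hom S (Cod C g) (Cod C g)"
      "cl (Id C M) \<in> Hom S M (Dom C f)" "cl (Id C N) \<in> Hom S N (Cod C f)"
      using H F by (simp_all add: Hom_iff)
    moreover have "is_iso S (cl (Id C (Cod C g)))" "is_iso S (cl (Id C M))" "is_iso S (cl (Id C N))"
      using H F by (auto intro!: iso)
    ultimately show "\<exists>f' g' h' a b c. standard_right_triangle C i q f' g' h' \<and>
           a \<in> Hom S M (Dom C f') \<and> b \<in> Hom S N (Cod C f') \<and> c \<in> Hom S (Cod C g) (Cod C g') \<and>
           is_iso S a \<and> is_iso S b \<and> is_iso S c \<and>
           b \<cdot>\<^bsub>S\<^esub> cl f = cl f' \<cdot>\<^bsub>S\<^esub> a \<and>
           c \<cdot>\<^bsub>S\<^esub> cl g = cl g' \<cdot>\<^bsub>S\<^esub> b \<and>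
           Susp C \<T> i q a \<cdot>\<^bsub>S\<^esub> cl h = cl h' \<cdot>\<^bsub>S\<^esub> c"
      using std by blast
  qed (use H F in auto)
qed

section \<open>Weak balance and epimorphisms with invisible kernel\<close>

text \<open>For an epimorphism \<open>f\<close> with kernel \<open>l: T \<rightarrow> M\<close>, the precover of \<open>N\<close> lifts along \<open>f\<close>, so its
  pullback is \<open>T \<oplus> T\<^sub>N\<close>; and since the preenvelope \<open>M \<rightarrow> T\<^sup>M\<close> kills \<open>T\<close> it factors through \<open>f\<close>,
  so that its pushout along \<open>f\<close> is \<open>T\<^sup>M\<close> itself. Both triangles of \<open>f\<close> thus have a zero term, and a
  stable inverse \<open>f'\<close> satisfies \<open>f' f l = l\<close>, because \<open>f' f - 1\<close> factors through \<open>\<T>\<close>.\<close>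

lemma weakly_balanced_imp_epi_iso:
  assumes wb: "weakly_balanced C \<T> i q k p"
    and ci: "preenvelope_choice C \<T> i q" and cp: "precover_choice C \<T> k p"
  shows "epi_with_invisible_kernel_iso C \<T>"
  unfolding epi_with_invisible_kernel_iso_def
proof (intro ballI allI impI)
  fix M N f l assume f: "f \<in> Hom C M N" and
    hyp: "is_epi C f \<and> is_kernel C f l \<and> Dom C l \<in> \<T> \<and>
        (\<forall>T\<in>\<T>. \<forall>h\<in>Hom C M T. h \<cdot> l = Zero C (Dom C l) T)"
  define T where "T = Dom C l"
  have T: "T \<in> \<T>" and epi: "is_epi C f" and ker: "is_kernel C f l"
    and kill: "\<And>T' h. T' \<in> \<T> \<Longrightarrow> h \<in> Hom C M T' \<Longrightarrow> h \<cdot> l = Zero C T T'"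
    using hyp by (auto simp: T_def)
  have l: "l \<in> Hom C T M" and fl: "f \<cdot> l = Zero C T N"
    using kernel_Hom[OF ker f] by (simp_all add: T_def)
  note H [THEN Hom_data] = f l
  obtain TN where p: "p N \<in> Hom C TN N" "TN \<in> \<T>" and kp: "is_kernel C (p N) (k N)"
    using cp H unfolding precover_choice_def is_precover_def by (auto simp: Hom_iff)
  obtain TM where i: "i M \<in> Hom C M TM" "TM \<in> \<T>" and qi: "is_cokernel C (i M) (q M)"
    using ci H unfolding preenvelope_choice_def is_preenvelope_def by (auto simp: Hom_iff)
  note PI [THEN Hom_data] = p(1) i(1)
  note co = epi_cokernel_of_kernel[OF epi f ker l]

  have "\<exists>z y. left_triangle C \<T> k p z y (cl f) \<and> is_zero_object S (Dom S y)"
  proof -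
    obtain t where t: "t \<in> Hom C TN M" "f \<cdot> t = p N" using lift[OF p(2) epi f p(1)] by blast
    obtain P i1 i2 p1 p2 where P: "P \<in> \<T>" "i1 \<in> Hom C T P" and b: "is_biproduct C T TN i1 i2 p1 p2"
      using T_biproduct[OF T p(2)] by blast
    note B = biproduct_Hom(2-4)[OF b, unfolded HomD(3)[OF P(2)]] biproduct_eqs[OF b]
    note BH [THEN Hom_data] = P(2) B(1,2,3) t(1)
    define g where "g = (l \<cdot> p1) \<boxplus> (t \<cdot> p2)"
    have g: "g \<in> Hom C P M" using BH H by (simp add: g_def Hom_def)
    have pb: "is_pullback C (p N) f p2 g"
      unfolding is_pullback_def
    proof (intro conjI ballI impI)
      show "p N \<cdot> p2 = f \<cdot> g"
        using BH H PI by (simp add: g_def comp_reduce[OF fl] comp_reduce[OF t(2)])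
      fix X a d assume X: "X \<in> Ob C" "a \<in> Hom C X (Dom C (p N))" "d \<in> Hom C X (Dom C f)" "p N \<cdot> a = f \<cdot> d"
      note A [THEN Hom_data] = X(2,3)
      have "f \<cdot> (d \<boxminus> (t \<cdot> a)) = Zero C X N"
        using A BH H PI X by (simp add: comp_reduce[OF t(2)])
      then obtain e where e: "e \<in> Hom C X T" "l \<cdot> e = d \<boxminus> (t \<cdot> a)"
        using kernel_factor[OF ker f, of "d \<boxminus> (t \<cdot> a)" X] A BH H PI by (auto simp: Hom_def)
      note E [THEN Hom_data] = e(1)
      define w where "w = (i1 \<cdot> e) \<boxplus> (i2 \<cdot> a)"
      have w: "w \<in> Hom C X P" using E A BH PI by (simp add: w_def Hom_def)
      have pw: "p1 \<cdot> w = e" "p2 \<cdot> w = a"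
        using E A BH PI H X by (simp_all add: w_def B(4-7)[THEN comp_reduce])
      have gw: "g \<cdot> w = d"
        using HomD[OF w] E A BH PI H pw e(2) by (simp add: g_def)
      show "\<exists>!w. w \<in> Hom C X (Dom C p2) \<and> p2 \<cdot> w = a \<and> g \<cdot> w = d"
      proof (rule ex1I[of _ w])
        show "w \<in> Hom C X (Dom C p2) \<and> p2 \<cdot> w = a \<and> g \<cdot> w = d" using w pw gw BH by simp
        fix w' assume w': "w' \<in> Hom C X (Dom C p2) \<and> p2 \<cdot> w' = a \<and> g \<cdot> w' = d"
        then have W': "w' \<in> Ar C" "Dom C w' = X" "Cod C w' = P" using BH by (auto simp: Hom_def)
        have "(l \<cdot> (p1 \<cdot> w')) \<boxplus> (t \<cdot> a) = d"
          using w' W' BH H by (auto simp: g_def)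
        then have "l \<cdot> (p1 \<cdot> w') = d \<boxminus> (t \<cdot> a)"
          using W' BH H A PI by (subst eq_commute, subst diff_eq_iff) (auto simp: Hom_def)
        then have lp: "l \<cdot> (p1 \<cdot> w') = l \<cdot> e" using e(2) by simp
        have p1: "p1 \<cdot> w' = e"
          by (rule mono_cancel[OF kernel_mono[OF ker] _ _ _ _ _ lp]) (use W' BH H E in auto)
        show "w' = w"
          by (rule biproduct_in_eq[OF b, of _ X]) (use W' w' w pw p1 BH in \<open>auto simp: Hom_def\<close>)
      qed
    qed (use BH PI H HomD[OF g] in auto)
    define K where "K = Dom C (k N)"
    have k: "k N \<in> Hom C K TN" "p N \<cdot> k N = Zero C K N"
      using kernel_Hom[OF kp p(1)] by (simp_all add: K_def)
    note KH [THEN Hom_data] = k(1)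
    obtain h where h: "h \<in> Hom C K P" "p2 \<cdot> h = k N" "g \<cdot> h = Zero C K M"
      using pullback_factor[OF pb p(1) f B(3) k(1), of "Zero C K M"] k(2) KH H by (auto simp: Hom_def)
    have "standard_left_triangle C k p h g f"
      unfolding standard_left_triangle_def
      using pb h H HomD[OF g] by (auto simp: K_def)
    then have "left_triangle C \<T> k p (cl h) (cl g) (cl f)"
      by (rule standard_left_imp_left_triangle[OF cp f])
    moreover have "is_zero_object S (Dom S (cl g))"
      using S_zero_object_iff[OF T_in_Ob[OF P(1)]] P(1) HomD[OF g] by simp
    ultimately show ?thesis by blast
  qed

  moreover have "\<exists>y z. right_triangle C \<T> i q (cl f) y z \<and> is_zero_object S (Cod S y)"
  proof -
    obtain w where w: "w \<in> Hom C N TM" "w \<cdot> f = i M"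
      using cokernel_factor[OF co l i(1)] kill[OF i(2,1)] H by auto
    note W [THEN Hom_data] = w(1)
    have po: "is_pushout C (i M) f (Id C TM) w"
      unfolding is_pushout_def
    proof (intro conjI ballI impI)
      show "Id C TM \<cdot> i M = w \<cdot> f" using w PI by simp
      fix X a d assume X: "X \<in> Ob C" "a \<in> Hom C (Cod C (i M)) X" "d \<in> Hom C (Cod C f) X" "a \<cdot> i M = d \<cdot> f"
      note A [THEN Hom_data] = X(2,3)
      have eq: "(a \<cdot> w) \<cdot> f = d \<cdot> f" using A W H PI w X by simp
      have "a \<cdot> w = d" by (rule epi_cancel[OF epi _ _ _ _ _ eq]) (use A W H PI in auto)
      moreover have id: "u \<cdot> Id C TM = u" if "u \<in> Hom C TM X" for u using HomD[OF that] by simp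
      moreover have "a \<in> Hom C TM X" "Cod C (Id C TM) = TM" using X(2) PI by simp_all
      ultimately show "\<exists>!u. u \<in> Hom C (Cod C (Id C TM)) X \<and> u \<cdot> Id C TM = a \<and> u \<cdot> w = d"
        by metis
    qed (use PI W H in auto)
    define Q where "Q = Cod C (q M)"
    have q: "q M \<in> Hom C TM Q" "q M \<cdot> i M = Zero C M Q"
      using cokernel_Hom[OF qi i(1)] by (simp_all add: Q_def)
    note QH [THEN Hom_data] = q(1)
    have "(q M \<cdot> w) \<cdot> f = Zero C M Q" using q(2) w(2) W QH H by simp
    then have qw: "q M \<cdot> w = Zero C N Q"
      using QH W by (intro epi_cancel_Zero[OF epi f]) (auto simp: Hom_def)
    have "standard_right_triangle C i q f w (q M)"
      unfolding standard_right_triangle_def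
      using po qw H W QH by (intro exI[of _ "Id C TM"]) (auto simp: Hom_def)
    then have "right_triangle C \<T> i q (cl f) (cl w) (cl (q M))"
      by (rule standard_right_imp_right_triangle[OF ci f])
    moreover have "is_zero_object S (Cod S (cl w))"
      using S_zero_object_iff[OF T_in_Ob[OF i(2)]] i(2) W by simp
    ultimately show ?thesis by blast
  qed

  moreover have "cl f \<in> Ar S" using H by simp
  ultimately have "is_iso S (cl f)"
    using wb unfolding weakly_balanced_def Let_def by blast
  then obtain f' where f': "f' \<in> Hom C N M" "(f' \<cdot> f) \<boxminus> Id C M \<in> factoring M M"
    using S_iso_iff[OF f] by blast
  obtain T' u v where u: "T' \<in> \<T>" "u \<in> Hom C M T'" "v \<in> Hom C T' M" "(f' \<cdot> f) \<boxminus> Id C M = v \<cdot> u"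
    using f'(2) by (rule factoringE)
  note U [THEN Hom_data] = u(2,3) f'(1)
  have "((f' \<cdot> f) \<boxminus> Id C M) \<cdot> l = neg l" using U H fl by simp
  moreover have "(v \<cdot> u) \<cdot> l = Zero C T M" using U H kill[OF u(1,2)] by simp
  ultimately have "neg (neg l) = neg (Zero C T M)" using u(4) by metis
  then have "l = Zero C T M" using H by simp
  then show "is_iso C f" by (rule zero_kernel_iso[OF f epi ker l])
qed

text \<open>The cokernel \<open>c: T' \<oplus> N \<rightarrow> Q\<close> that computes the pushout splits, because \<open>Q\<close> is projective.
  Its kernel \<open>I\<close> is the image of \<open>M \<rightarrow> T' \<oplus> N\<close>, and the projection \<open>I \<rightarrow> N\<close> is a stable isomorphism
  because the complements of \<open>I\<close> and of \<open>N\<close> in \<open>T' \<oplus> N\<close> are \<open>Q\<close> and \<open>T'\<close>.\<close>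

lemma stable_image_of_pushout:
  assumes i: "i \<in> Hom C M T'" "T' \<in> \<T>" and f: "f \<in> Hom C M N"
    and po: "is_pushout C i f v g" and Q: "Cod C v \<in> \<T>"
  obtains I e a b where "e \<in> Hom C M I" "is_epi C e" "a \<in> Hom C I N" "is_iso S (cl a)" "a \<cdot> e = f"
    "b \<in> Hom C I T'" "b \<cdot> e = i"
proof -
  define Q where "Q = Cod C v"
  have v: "v \<in> Hom C T' Q" and g: "g \<in> Hom C N Q" and vi: "v \<cdot> i = g \<cdot> f"
    using pushout_Hom[OF po i(1) f] by (simp_all add: Q_def)
  have QT: "Q \<in> \<T>" using Q by (simp add: Q_def)
  obtain i1 i2 p1 p2 where b: "is_biproduct C T' N i1 i2 p1 p2"
    using ex_biproduct Hom_objects(2)[OF i(1)] Hom_objects(2)[OF f] by blast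
  define P where "P = Cod C i1"
  note P = biproduct_Hom[OF b, folded P_def] and B = biproduct_eqs[OF b]
  note sum = biproduct_sum[OF b, folded P_def]
  note H [THEN Hom_data] = i(1) f v g P(1,2,3,4)
  define m c where "m = (i1 \<cdot> i) \<boxplus> (i2 \<cdot> f)" and "c = (v \<cdot> p1) \<boxminus> (g \<cdot> p2)"
  have m: "m \<in> Hom C M P" and c: "c \<in> Hom C P Q" using H by (simp_all add: m_def c_def Hom_def)
  have co: "is_cokernel C m c"
    unfolding m_def c_def using pushout_iff_cokernel[OF i(1) f v g b] po by blast
  have pm: "p1 \<cdot> m = i" "p2 \<cdot> m = f" using H by (simp_all add: m_def B B[THEN comp_reduce])
  have cm: "c \<cdot> m = Zero C M Q" using cokernel_Hom(2)[OF co m] HomD[OF c] by simp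
  obtain I n where n: "n \<in> Hom C I P" "is_kernel C c n" using obtain_kernel[OF c] by blast
  obtain e where e: "e \<in> Hom C M I" "n \<cdot> e = m"
    using kernel_factor[OF n(2) c m cm] HomD[OF n(1)] by auto
  have epi: "is_epi C e" by (rule epi_onto_image[OF m co c n(2,1) e])
  obtain \<sigma> where \<sigma>: "\<sigma> \<in> Hom C Q P" "c \<cdot> \<sigma> = Id C Q"
    using lift[OF QT cokernel_epi[OF co] c, of "Id C Q"] H by (auto simp: Hom_def)
  obtain \<rho> where \<rho>: "\<rho> \<in> Hom C P I" and bi: "is_biproduct C I Q n \<sigma> \<rho> c"
    using split_kernel_biproduct[OF n(2) c n(1) \<sigma>] by blast
  note R = biproduct_eqs(1)[OF bi] biproduct_sum[OF bi, unfolded HomD(3)[OF n(1)]]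
  note K [THEN Hom_data] = m c n(1) e(1) \<sigma>(1) \<rho>
  have a: "p2 \<cdot> n \<in> Hom C I N" and j: "\<rho> \<cdot> i2 \<in> Hom C N I" using H K by (auto simp: Hom_def)
  have "((\<rho> \<cdot> i2) \<cdot> (p2 \<cdot> n)) \<boxminus> Id C I \<in> factoring I I"
  proof -
    have "\<rho> \<cdot> (((i1 \<cdot> p1) \<boxplus> (i2 \<cdot> p2)) \<cdot> n) = Id C I"
      unfolding sum using K R by simp
    then have "(\<rho> \<cdot> (i1 \<cdot> (p1 \<cdot> n))) \<boxplus> (\<rho> \<cdot> (i2 \<cdot> (p2 \<cdot> n))) = Id C I"
      using H K by simp
    then have "((\<rho> \<cdot> i2) \<cdot> (p2 \<cdot> n)) \<boxminus> Id C I
        = ((\<rho> \<cdot> i2) \<cdot> (p2 \<cdot> n)) \<boxminus> ((\<rho> \<cdot> (i1 \<cdot> (p1 \<cdot> n))) \<boxplus> (\<rho> \<cdot> (i2 \<cdot> (p2 \<cdot> n))))"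
      by simp
    also have "\<dots> = neg ((\<rho> \<cdot> i1) \<cdot> (p1 \<cdot> n))"
      using H K by (simp add: Plus_commute[of "neg (\<rho> \<cdot> (i1 \<cdot> (p1 \<cdot> n)))"])
    finally show ?thesis
      using factoring_neg[OF factoringI[OF i(2), of "p1 \<cdot> n" I "\<rho> \<cdot> i1" I]] H K
      by (simp add: Hom_iff)
  qed
  moreover have "((p2 \<cdot> n) \<cdot> (\<rho> \<cdot> i2)) \<boxminus> Id C N \<in> factoring N N"
  proof -
    have "p2 \<cdot> (((n \<cdot> \<rho>) \<boxplus> (\<sigma> \<cdot> c)) \<cdot> i2) = Id C N"
      unfolding R(2) using H B by simp
    then have "(p2 \<cdot> (n \<cdot> (\<rho> \<cdot> i2))) \<boxplus> (p2 \<cdot> (\<sigma> \<cdot> (c \<cdot> i2))) = Id C N"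
      using H K by simp
    then have "((p2 \<cdot> n) \<cdot> (\<rho> \<cdot> i2)) \<boxminus> Id C N
        = ((p2 \<cdot> n) \<cdot> (\<rho> \<cdot> i2)) \<boxminus> ((p2 \<cdot> (n \<cdot> (\<rho> \<cdot> i2))) \<boxplus> (p2 \<cdot> (\<sigma> \<cdot> (c \<cdot> i2))))"
      by simp
    also have "\<dots> = neg ((p2 \<cdot> \<sigma>) \<cdot> (c \<cdot> i2))"
      using H K by simp
    finally show ?thesis
      using factoring_neg[OF factoringI[OF QT, of "c \<cdot> i2" N "p2 \<cdot> \<sigma>" N]] H K
      by (simp add: Hom_iff)
  qed
  ultimately have iso: "is_iso S (cl (p2 \<cdot> n))"
    using S_iso_iff[OF a] j by blast
  have "(p2 \<cdot> n) \<cdot> e = f" "(p1 \<cdot> n) \<cdot> e = i"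
    using pm e(2) H K by simp_all
  then show thesis using that[OF e(1) epi a iso, of "p1 \<cdot> n"] H K by (auto simp: Hom_def)
qed

text \<open>The differences through \<open>\<T>\<close> in a stable isomorphism between \<open>e\<close> and \<open>f\<close> lift along \<open>p\<close> and
  along \<open>e\<close>, which gives squares that commute on the nose. They induce \<open>\<kappa>: K \<rightarrow> P\<close> and
  \<open>\<mu>: P \<rightarrow> K\<close>, and \<open>1 - \<mu> \<kappa>\<close> is the restriction \<open>\<theta> k\<close> to \<open>K\<close> of an endomorphism \<open>k \<theta>\<close> of \<open>M'\<close> that
  factors through \<open>\<T>\<close>. This does not yet make \<open>\<theta> k\<close> factor through \<open>\<T>\<close>, but its square
  \<open>\<theta> (k \<theta>) k\<close> does so; and \<open>\<theta> k\<close> is stably the identity, because \<open>\<mu> \<kappa>\<close> factors through \<open>P\<close>.\<close>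

lemma kernel_of_epi_in_T:
  assumes p: "p \<in> Hom C TN N" "TN \<in> \<T>"
    and cover: "\<And>T x. T \<in> \<T> \<Longrightarrow> x \<in> Hom C T N \<Longrightarrow> \<exists>y\<in>Hom C T TN. p \<cdot> y = x"
    and f: "f \<in> Hom C M N" and pb: "is_pullback C p f v g" and P: "Dom C g \<in> \<T>"
    and e: "e \<in> Hom C M' I" "is_epi C e" and k: "is_kernel C e k" "k \<in> Hom C K M'"
    and b: "b \<in> Hom S M' M" "is_iso S b" and c: "c \<in> Hom S I N" "is_iso S c"
    and comm: "c \<cdot>\<^bsub>S\<^esub> cl e = cl f \<cdot>\<^bsub>S\<^esub> b"
  shows "K \<in> \<T>"
proof -
  interpret S: category S by (rule category_S)
  define P where "P = Dom C g"
  have v: "v \<in> Hom C P TN" and g: "g \<in> Hom C P M" and pv: "p \<cdot> v = f \<cdot> g"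
    using pullback_Hom[OF pb p(1) f] by (simp_all add: P_def Hom_iff)
  have PT: "P \<in> \<T>" using P by (simp add: P_def)
  obtain b' where b': "b' \<in> Hom S M M'" "b' \<cdot>\<^bsub>S\<^esub> b = Id S M'" "b \<cdot>\<^bsub>S\<^esub> b' = Id S M"
    using S.isoE[OF b(2,1)] by blast
  obtain c' where c': "c' \<in> Hom S N I" "c' \<cdot>\<^bsub>S\<^esub> c = Id S I" "c \<cdot>\<^bsub>S\<^esub> c' = Id S N"
    using S.isoE[OF c(2,1)] by blast
  obtain \<beta> \<beta>' \<gamma> \<gamma>' where \<beta>: "\<beta> \<in> Hom C M' M" "b = cl \<beta>" and \<beta>': "\<beta>' \<in> Hom C M M'" "b' = cl \<beta>'"
    and \<gamma>: "\<gamma> \<in> Hom C I N" "c = cl \<gamma>" and \<gamma>': "\<gamma>' \<in> Hom C N I" "c' = cl \<gamma>'"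
    using S_HomE b(1) b'(1) c(1) c'(1) by metis
  note H [THEN Hom_data] = p(1) f v g e(1) k(2) \<beta>(1) \<beta>'(1) \<gamma>(1) \<gamma>'(1)
  have ek: "e \<cdot> k = Zero C K I" using kernel_Hom(2)[OF k(1) e(1)] H by simp
  have \<beta>\<beta>: "(\<beta>' \<cdot> \<beta>) \<boxminus> Id C M' \<in> factoring M' M'"
  proof -
    have "cl (\<beta>' \<cdot> \<beta>) = cl (Id C M')" using b'(2) \<beta>(2) \<beta>'(2) H by simp
    then show ?thesis using H by (subst (asm) cl_eq_iff) (auto simp: Hom_def)
  qed
  have \<gamma>\<gamma>: "(\<gamma>' \<cdot> \<gamma>) \<boxminus> Id C I \<in> factoring I I"
  proof -
    have "cl (\<gamma>' \<cdot> \<gamma>) = cl (Id C I)" using c'(2) \<gamma>(2) \<gamma>'(2) H by simp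
    then show ?thesis using H by (subst (asm) cl_eq_iff) (auto simp: Hom_def)
  qed
  have "(\<gamma> \<cdot> e) \<boxminus> (f \<cdot> \<beta>) \<in> factoring M' N"
  proof -
    have "cl (\<gamma> \<cdot> e) = cl (f \<cdot> \<beta>)" using comm \<beta>(2) \<gamma>(2) H by simp
    then show ?thesis using H by (subst (asm) cl_eq_iff) (auto simp: Hom_def)
  qed
  then obtain T1 x1 s1 where x1: "T1 \<in> \<T>" "x1 \<in> Hom C M' T1" "s1 \<in> Hom C T1 N"
    "(\<gamma> \<cdot> e) \<boxminus> (f \<cdot> \<beta>) = s1 \<cdot> x1"
    by (rule factoringE)
  obtain y1 where y1: "y1 \<in> Hom C T1 TN" "p \<cdot> y1 = s1" using cover x1 by blast
  define x where "x = y1 \<cdot> x1"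
  have x: "x \<in> Hom C M' TN" using HomD[OF x1(2)] HomD[OF y1(1)] by (simp add: x_def Hom_def)
  have "(\<gamma> \<cdot> e) \<boxminus> (f \<cdot> \<beta>) = p \<cdot> x"
    using x1(4) HomD[OF x1(2)] HomD[OF y1(1)] H by (simp add: x_def comp_reduce[OF y1(2)])
  then have \<gamma>e: "\<gamma> \<cdot> e = (p \<cdot> x) \<boxplus> (f \<cdot> \<beta>)"
    using H HomD[OF x] by (subst (asm) diff_eq_iff) (auto simp: Hom_def)
  have "(\<gamma>' \<cdot> f) \<boxminus> (e \<cdot> \<beta>') \<in> factoring M I"
  proof -
    have "c' \<cdot>\<^bsub>S\<^esub> ((c \<cdot>\<^bsub>S\<^esub> cl e) \<cdot>\<^bsub>S\<^esub> b') = (c' \<cdot>\<^bsub>S\<^esub> c) \<cdot>\<^bsub>S\<^esub> (cl e \<cdot>\<^bsub>S\<^esub> b')"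
      using \<beta>'(2) \<gamma>(2) \<gamma>'(2) H by simp
    also have "\<dots> = cl (e \<cdot> \<beta>')" unfolding c'(2) \<beta>'(2) using H by simp
    finally have 1: "c' \<cdot>\<^bsub>S\<^esub> ((c \<cdot>\<^bsub>S\<^esub> cl e) \<cdot>\<^bsub>S\<^esub> b') = cl (e \<cdot> \<beta>')" .
    have "c' \<cdot>\<^bsub>S\<^esub> ((cl f \<cdot>\<^bsub>S\<^esub> b) \<cdot>\<^bsub>S\<^esub> b') = (c' \<cdot>\<^bsub>S\<^esub> cl f) \<cdot>\<^bsub>S\<^esub> (b \<cdot>\<^bsub>S\<^esub> b')"
      using \<beta>(2) \<beta>'(2) \<gamma>'(2) H by simp
    also have "\<dots> = cl (\<gamma>' \<cdot> f)" unfolding b'(3) \<gamma>'(2) using H by simp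
    finally have "cl (\<gamma>' \<cdot> f) = cl (e \<cdot> \<beta>')" using 1 comm by simp
    then show ?thesis using H by (subst (asm) cl_eq_iff) (auto simp: Hom_def)
  qed
  then obtain T2 x2 s2 where x2: "T2 \<in> \<T>" "x2 \<in> Hom C M T2" "s2 \<in> Hom C T2 I"
    "(\<gamma>' \<cdot> f) \<boxminus> (e \<cdot> \<beta>') = s2 \<cdot> x2"
    by (rule factoringE)
  obtain y2 where y2: "y2 \<in> Hom C T2 M'" "e \<cdot> y2 = s2" using lift[OF x2(1) e(2,1) x2(3)] by blast
  define d where "d = y2 \<cdot> x2"
  have d: "d \<in> factoring M M'" unfolding d_def by (rule factoringI[OF x2(1,2) y2(1)])
  note D [THEN Hom_data] = factoring_Hom[OF d]
  have "(\<gamma>' \<cdot> f) \<boxminus> (e \<cdot> \<beta>') = e \<cdot> d"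
    using x2(4) HomD[OF x2(2)] HomD[OF y2(1)] H by (simp add: d_def comp_reduce[OF y2(2)])
  then have "\<gamma>' \<cdot> f = (e \<cdot> d) \<boxplus> (e \<cdot> \<beta>')"
    using H D by (subst (asm) diff_eq_iff) (auto simp: Hom_def)
  define \<delta> where "\<delta> = d \<boxplus> \<beta>'"
  have \<delta>: "\<delta> \<in> Hom C M M'" using D H by (simp add: \<delta>_def Hom_def)
  note D' [THEN Hom_data] = \<delta> x
  have \<gamma>f: "\<gamma>' \<cdot> f = e \<cdot> \<delta>" using \<open>\<gamma>' \<cdot> f = _\<close> D H by (simp add: \<delta>_def)
  have \<delta>\<beta>: "Id C M' \<boxminus> (\<delta> \<cdot> \<beta>) \<in> factoring M' M'"
  proof -
    have "neg (d \<cdot> \<beta>) \<boxplus> neg ((\<beta>' \<cdot> \<beta>) \<boxminus> Id C M') \<in> factoring M' M'"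
      using factoring_Plus factoring_neg factoring_comp(2)[OF d \<beta>(1)] \<beta>\<beta> by blast
    also have "neg (d \<cdot> \<beta>) \<boxplus> neg ((\<beta>' \<cdot> \<beta>) \<boxminus> Id C M') = Id C M' \<boxminus> (\<delta> \<cdot> \<beta>)"
      using D H by (simp add: \<delta>_def Plus_ac)
    finally show ?thesis .
  qed
  obtain y where y: "y \<in> Hom C TN M'" "e \<cdot> y = \<gamma>' \<cdot> p"
    using lift[OF p(2) e(2,1), of "\<gamma>' \<cdot> p"] H by (auto simp: Hom_def)
  note Y [THEN Hom_data] = y(1)

  \<comment> \<open>The pair \<open>(- x k, \<beta> k)\<close> into the pullback gives \<open>\<kappa>\<close>, and \<open>\<delta> g - y v\<close> into the kernel gives \<open>\<mu>\<close>.\<close>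
  have "(p \<cdot> (x \<cdot> k)) \<boxplus> (f \<cdot> (\<beta> \<cdot> k)) = Zero C K N"
  proof -
    have "(\<gamma> \<cdot> e) \<cdot> k = Zero C K N" using ek H by simp
    then show ?thesis unfolding \<gamma>e using H D' by simp
  qed
  then have "f \<cdot> (\<beta> \<cdot> k) = neg (p \<cdot> (x \<cdot> k))"
    using H D' by (intro neg_unique) auto
  then obtain \<kappa> where \<kappa>: "\<kappa> \<in> Hom C K P" "v \<cdot> \<kappa> = neg (x \<cdot> k)" "g \<cdot> \<kappa> = \<beta> \<cdot> k"
    using pullback_factor[OF pb p(1) f v, of "neg (x \<cdot> k)" K "\<beta> \<cdot> k"] H D' by (auto simp: Hom_def)
  have "e \<cdot> ((\<delta> \<cdot> g) \<boxminus> (y \<cdot> v)) = Zero C P I"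
    using H D' Y by (simp add: comp_reduce[OF \<gamma>f[symmetric]] comp_reduce[OF y(2)] pv)
  then obtain \<mu> where \<mu>: "\<mu> \<in> Hom C P K" "k \<cdot> \<mu> = (\<delta> \<cdot> g) \<boxminus> (y \<cdot> v)"
    using kernel_factor[OF k(1) e(1), of "(\<delta> \<cdot> g) \<boxminus> (y \<cdot> v)" P] H D' Y by (auto simp: Hom_def)
  note KL [THEN Hom_data] = \<kappa>(1) \<mu>(1)
  define B where "B = (\<delta> \<cdot> \<beta>) \<boxplus> (y \<cdot> x)"
  have B: "B \<in> Hom C M' M'" using H D' Y by (simp add: B_def Hom_def)
  have k\<mu>\<kappa>: "k \<cdot> (\<mu> \<cdot> \<kappa>) = B \<cdot> k"
    using H D' Y KL \<kappa>(2,3) by (simp add: comp_reduce[OF \<mu>(2)] B_def)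
  have eB: "e \<cdot> B = \<gamma>' \<cdot> (\<gamma> \<cdot> e)"
    unfolding \<gamma>e
    using H D' Y by (simp add: B_def comp_reduce[OF \<gamma>f[symmetric]] comp_reduce[OF y(2)] Plus_commute)
  obtain T3 u s where u: "T3 \<in> \<T>" "u \<in> Hom C I T3" "s \<in> Hom C T3 I" "(\<gamma>' \<cdot> \<gamma>) \<boxminus> Id C I = s \<cdot> u"
    using \<gamma>\<gamma> by (rule factoringE)
  obtain s' where s': "s' \<in> Hom C T3 M'" "e \<cdot> s' = s" using lift[OF u(1) e(2,1) u(3)] by blast
  define z where "z = s' \<cdot> (u \<cdot> e)"
  have z: "z \<in> factoring M' M'"
    unfolding z_def by (rule factoringI[OF u(1)]) (use HomD[OF u(2)] s' H in \<open>auto simp: Hom_def\<close>)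
  note Z [THEN Hom_data] = factoring_Hom[OF z] B
  have "e \<cdot> z = ((\<gamma>' \<cdot> \<gamma>) \<boxminus> Id C I) \<cdot> e"
    unfolding u(4) using HomD[OF u(2)] HomD[OF s'(1)] HomD[OF u(3)] H
    by (simp add: z_def comp_reduce[OF s'(2)])
  then have ez: "e \<cdot> z = (\<gamma>' \<cdot> (\<gamma> \<cdot> e)) \<boxminus> e" using H by simp
  \<comment> \<open>\<open>e B = \<gamma>' \<gamma> e\<close> differs from \<open>e\<close> by \<open>e z\<close>, so \<open>1 - B\<close> lands in \<open>K\<close> after adding \<open>z\<close>.\<close>
  define \<psi> where "\<psi> = (Id C M' \<boxminus> B) \<boxplus> z"
  have \<psi>: "\<psi> \<in> Hom C M' M'" using Z by (simp add: \<psi>_def Hom_def)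
  have "e \<cdot> \<psi> = Zero C M' I"
    using H Z eB ez by (simp add: \<psi>_def)
  then obtain \<theta> where \<theta>: "\<theta> \<in> Hom C M' K" "k \<cdot> \<theta> = \<psi>"
    using kernel_factor[OF k(1) e(1) \<psi>] H by auto
  note T [THEN Hom_data] = \<theta>(1) \<psi>
  have \<psi>_fac: "\<psi> \<in> factoring M' M'"
  proof -
    have "y \<cdot> x \<in> factoring M' M'" by (rule factoringI[OF p(2) x y(1)])
    then have "((Id C M' \<boxminus> (\<delta> \<cdot> \<beta>)) \<boxplus> neg (y \<cdot> x)) \<boxplus> z \<in> factoring M' M'"
      using \<delta>\<beta> z factoring_Plus factoring_neg by blast
    also have "((Id C M' \<boxminus> (\<delta> \<cdot> \<beta>)) \<boxplus> neg (y \<cdot> x)) \<boxplus> z = \<psi>"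
      using H D' Y Z by (simp add: \<psi>_def B_def)
    finally show ?thesis .
  qed
  have zk: "z \<cdot> k = Zero C K M'"
    using HomD[OF u(2)] HomD[OF s'(1)] H by (simp add: z_def ek)
  have one: "Id C K = (\<mu> \<cdot> \<kappa>) \<boxplus> (\<theta> \<cdot> k)"
  proof (rule mono_cancel[OF kernel_mono[OF k(1)]])
    have "k \<cdot> ((\<mu> \<cdot> \<kappa>) \<boxplus> (\<theta> \<cdot> k)) = (B \<cdot> k) \<boxplus> (\<psi> \<cdot> k)"
      using KL T H k\<mu>\<kappa> by (simp add: comp_reduce[OF \<theta>(2)])
    also have "\<dots> = k" using Z T H zk by (simp add: \<psi>_def Plus_commute[of k])
    finally show "k \<cdot> Id C K = k \<cdot> ((\<mu> \<cdot> \<kappa>) \<boxplus> (\<theta> \<cdot> k))" using H by simp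
  qed (use KL T H in auto)
  \<comment> \<open>Substituting this expression for the identity into \<open>\<theta> k\<close> produces the square of \<open>\<theta> k\<close>.\<close>
  have "\<theta> \<cdot> k = (\<theta> \<cdot> k) \<cdot> Id C K" using T H by simp
  also have "\<dots> = ((\<theta> \<cdot> k) \<cdot> (\<mu> \<cdot> \<kappa>)) \<boxplus> (\<theta> \<cdot> (\<psi> \<cdot> k))"
    unfolding one using T H KL by (simp add: comp_reduce[OF \<theta>(2)])
  finally have \<theta>k: "\<theta> \<cdot> k = ((\<theta> \<cdot> k) \<cdot> (\<mu> \<cdot> \<kappa>)) \<boxplus> (\<theta> \<cdot> (\<psi> \<cdot> k))" .
  have \<mu>\<kappa>: "\<mu> \<cdot> \<kappa> \<in> factoring K K" by (rule factoringI[OF PT \<kappa>(1) \<mu>(1)])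
  have "\<theta> \<cdot> k \<in> Hom C K K" using T H by (simp add: Hom_def)
  then have "\<theta> \<cdot> k \<in> factoring K K"
    using \<theta>k factoring_Plus factoring_comp(1)[OF \<mu>\<kappa>]
      factoring_comp(1)[OF factoring_comp(2)[OF \<psi>_fac k(2)] \<theta>(1)] by metis
  then have "Id C K \<in> factoring K K" using one factoring_Plus[OF \<mu>\<kappa>] by metis
  then show "K \<in> \<T>" using T_iff_Id_factoring H by blast
qed

text \<open>The right triangle replaces \<open>\<alpha>\<close> by an epimorphism \<open>e\<close> through which every arrow into \<open>\<T>\<close>
  factors, so that these arrows vanish on \<open>ker e\<close>; the left triangle puts \<open>ker e\<close> into \<open>\<T>\<close>.\<close>

lemma epi_iso_imp_weakly_balanced:
  assumes iso: "epi_with_invisible_kernel_iso C \<T>"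
    and ci: "preenvelope_choice C \<T> i q" and cp: "precover_choice C \<T> k p"
  shows "weakly_balanced C \<T> i q k p"
  unfolding weakly_balanced_def Let_def
proof (intro ballI impI, elim conjE exE)
  interpret S: category S by (rule category_S)
  fix \<alpha> z y y' z' assume "\<alpha> \<in> Ar S"
    and lt: "left_triangle C \<T> k p z y \<alpha>" "is_zero_object S (Dom S y)"
    and rt: "right_triangle C \<T> i q \<alpha> y' z'" "is_zero_object S (Cod S y')"
  obtain L M N f g h a b c where y: "y \<in> Hom S L M" and \<alpha>: "\<alpha> \<in> Hom S M N"
    and std: "standard_left_triangle C k p h g f"
    and a: "a \<in> Hom S L (Dom C g)" "is_iso S a" and b: "b \<in> Hom S M (Dom C f)" "is_iso S b"
    and c: "c \<in> Hom S N (Cod C f)" "is_iso S c" and c\<alpha>: "c \<cdot>\<^bsub>S\<^esub> \<alpha> = cl f \<cdot>\<^bsub>S\<^esub> b"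
    using lt(1) unfolding left_triangle_def Let_def by blast
  obtain L' f' g' h' a' b' c' where y': "y' \<in> Hom S N L'"
    and std': "standard_right_triangle C i q f' g' h'"
    and a': "a' \<in> Hom S M (Dom C f')" "is_iso S a'" and b': "b' \<in> Hom S N (Cod C f')" "is_iso S b'"
    and c': "c' \<in> Hom S L' (Cod C g')" "is_iso S c'" and b\<alpha>: "b' \<cdot>\<^bsub>S\<^esub> \<alpha> = cl f' \<cdot>\<^bsub>S\<^esub> a'"
  proof -
    obtain M1 N1 L' f' g' h' a' b' c' where
      r: "\<alpha> \<in> Hom S M1 N1" "y' \<in> Hom S N1 L'" "standard_right_triangle C i q f' g' h'"
       "a' \<in> Hom S M1 (Dom C f')" "is_iso S a'" "b' \<in> Hom S N1 (Cod C f')" "is_iso S b'"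
       "c' \<in> Hom S L' (Cod C g')" "is_iso S c'" "b' \<cdot>\<^bsub>S\<^esub> \<alpha> = cl f' \<cdot>\<^bsub>S\<^esub> a'"
      using rt(1) unfolding right_triangle_def Let_def by blast
    have "M1 = M" "N1 = N" using r(1) \<alpha> by (auto simp: Hom_iff)
    then show thesis using that r by blast
  qed
  define X Y where "X = Dom C f'" and "Y = Cod C f'"
  note a'X = a'(1)[folded X_def] and b'Y = b'(1)[folded Y_def]
  have "L \<in> \<T>"
    using lt(2) y S.Hom_objects[OF y] S_zero_object_iff[of L] by (simp add: Hom_iff)
  then have gT: "Dom C g \<in> \<T>" using T_iso_closed a by blast
  have "L' \<in> \<T>"
    using rt(2) y' S.Hom_objects[OF y'] S_zero_object_iff[of L'] by (simp add: Hom_iff)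
  then have g'T: "Cod C g' \<in> \<T>" using T_iso_closed c' by blast
  obtain v' where po: "is_pushout C (i X) f' v' g'"
    using std' unfolding standard_right_triangle_def X_def by blast
  have f': "f' \<in> Hom C X Y" and Q: "Cod C v' \<in> \<T>"
    using po g'T unfolding is_pushout_def by (auto simp: X_def Y_def Hom_iff)
  have "is_preenvelope C \<T> X (i X)"
    using ci Hom_objects[OF f'] by (auto simp: preenvelope_choice_def)
  moreover define T' where "T' = Cod C (i X)"
  ultimately have i: "i X \<in> Hom C X T'" "T' \<in> \<T>"
    and ext: "\<And>T h. T \<in> \<T> \<Longrightarrow> h \<in> Hom C X T \<Longrightarrow> \<exists>h'\<in>Hom C T' T. h' \<cdot> i X = h"
    by (auto simp: is_preenvelope_def Hom_iff)
  obtain I e a1 b1 where e: "e \<in> Hom C X I" "is_epi C e"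
    and a1: "a1 \<in> Hom C I Y" "is_iso S (cl a1)" "a1 \<cdot> e = f'" and b1: "b1 \<in> Hom C I T'" "b1 \<cdot> e = i X"
    by (rule stable_image_of_pushout[OF i f' po Q])
  note E [THEN Hom_data] = e(1) a1(1) b1(1)
  obtain K \<kappa> where \<kappa>: "\<kappa> \<in> Hom C K X" "is_kernel C e \<kappa>" using obtain_kernel[OF e(1)] by blast
  have e\<kappa>: "e \<cdot> \<kappa> = Zero C K I" using kernel_Hom(2)[OF \<kappa>(2) e(1)] HomD[OF \<kappa>(1)] by simp
  obtain a'' where a'': "a'' \<in> Hom S X M" "a'' \<cdot>\<^bsub>S\<^esub> a' = Id S M" "a' \<cdot>\<^bsub>S\<^esub> a'' = Id S X"
    using S.isoE[OF a'(2) a'X] by blast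
  obtain b'' where b'': "b'' \<in> Hom S Y N" "b'' \<cdot>\<^bsub>S\<^esub> b' = Id S N" "b' \<cdot>\<^bsub>S\<^esub> b'' = Id S Y"
    using S.isoE[OF b'(2) b'Y] by blast
  have inv: "is_iso S a''" "is_iso S b''"
    using S.isoI[OF a''(1) a'X a''(3,2)] S.isoI[OF b''(1) b'Y b''(3,2)]
    by blast+
  have ce: "cl e \<in> Hom S X I" and ca: "cl a1 \<in> Hom S I Y" and cf: "cl f' \<in> Hom S X Y"
    using e(1) a1(1) f' by (auto intro: cl_in_Hom)
  have f'eq: "cl a1 \<cdot>\<^bsub>S\<^esub> cl e = cl f'" using a1(3) E by simp
  note SH [THEN S.Hom_data] = \<alpha> a'X b'Y a''(1) b''(1) ce ca b(1) c(1) cf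

  \<comment> \<open>Up to the stable isomorphisms \<open>a'\<close> and \<open>b'' a1\<close>, the arrow \<open>\<alpha>\<close> is \<open>e\<close>.\<close>
  have \<alpha>_eq: "b'' \<cdot>\<^bsub>S\<^esub> (cl a1 \<cdot>\<^bsub>S\<^esub> (cl e \<cdot>\<^bsub>S\<^esub> a')) = \<alpha>"
  proof -
    have "b'' \<cdot>\<^bsub>S\<^esub> (cl a1 \<cdot>\<^bsub>S\<^esub> (cl e \<cdot>\<^bsub>S\<^esub> a')) = b'' \<cdot>\<^bsub>S\<^esub> (cl f' \<cdot>\<^bsub>S\<^esub> a')"
      using SH S.comp_reduce[OF f'eq] by simp
    also have "\<dots> = (b'' \<cdot>\<^bsub>S\<^esub> b') \<cdot>\<^bsub>S\<^esub> \<alpha>"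
      unfolding b\<alpha>[symmetric] using SH by simp
    also have "\<dots> = \<alpha>" unfolding b''(2) using SH by (intro S.Id_left) auto
    finally show ?thesis .
  qed

  define N' where "N' = Cod C f"
  obtain v where pb: "is_pullback C (p N') f v g"
    using std unfolding standard_left_triangle_def N'_def by blast
  have "K \<in> \<T>"
  proof (rule kernel_of_epi_in_T)
    show "is_pullback C (p N') f v g" by fact
    have f: "f \<in> Hom C (Dom C f) N'" using pb unfolding is_pullback_def by (auto simp: N'_def Hom_iff)
    then show "f \<in> Hom C (Dom C f) N'" .
    have pre: "is_precover C \<T> N' (p N')"
      using cp Hom_objects[OF f] by (auto simp: precover_choice_def)
    then show "p N' \<in> Hom C (Dom C (p N')) N'" "Dom C (p N') \<in> \<T>"
      "\<And>T x. T \<in> \<T> \<Longrightarrow> x \<in> Hom C T N' \<Longrightarrow> \<exists>y\<in>Hom C T (Dom C (p N')). p N' \<cdot> y = x"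
      by (auto simp: is_precover_def Hom_iff)
    show "Dom C g \<in> \<T>" "e \<in> Hom C X I" "is_epi C e" "is_kernel C e \<kappa>" "\<kappa> \<in> Hom C K X" by fact+
    show "b \<cdot>\<^bsub>S\<^esub> a'' \<in> Hom S X (Dom C f)" "is_iso S (b \<cdot>\<^bsub>S\<^esub> a'')"
      using S.Comp_in_Hom[OF a''(1) b(1)] S.iso_comp[OF inv(1) a''(1) b(2,1)] by blast+
    have ba: "b'' \<cdot>\<^bsub>S\<^esub> cl a1 \<in> Hom S I N" "is_iso S (b'' \<cdot>\<^bsub>S\<^esub> cl a1)"
      using S.Comp_in_Hom[OF ca b''(1)] S.iso_comp[OF a1(2) ca inv(2) b''(1)] by blast+
    show "c \<cdot>\<^bsub>S\<^esub> (b'' \<cdot>\<^bsub>S\<^esub> cl a1) \<in> Hom S I N'" "is_iso S (c \<cdot>\<^bsub>S\<^esub> (b'' \<cdot>\<^bsub>S\<^esub> cl a1))"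
      using S.Comp_in_Hom[OF ba(1) c(1)] S.iso_comp[OF ba(2,1) c(2,1)] unfolding N'_def by blast+
    have "c \<cdot>\<^bsub>S\<^esub> (b'' \<cdot>\<^bsub>S\<^esub> cl a1) \<cdot>\<^bsub>S\<^esub> cl e
        = c \<cdot>\<^bsub>S\<^esub> (b'' \<cdot>\<^bsub>S\<^esub> (cl a1 \<cdot>\<^bsub>S\<^esub> (cl e \<cdot>\<^bsub>S\<^esub> (a' \<cdot>\<^bsub>S\<^esub> a''))))"
    proof -
      have "cl e \<cdot>\<^bsub>S\<^esub> (a' \<cdot>\<^bsub>S\<^esub> a'') = cl e" unfolding a''(3) using SH by (intro S.Id_right) auto
      then show ?thesis using SH by simp
    qed
    also have "\<dots> = c \<cdot>\<^bsub>S\<^esub> ((b'' \<cdot>\<^bsub>S\<^esub> (cl a1 \<cdot>\<^bsub>S\<^esub> (cl e \<cdot>\<^bsub>S\<^esub> a'))) \<cdot>\<^bsub>S\<^esub> a'')"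
      using SH by (simp del: S_Comp)
    also have "\<dots> = (c \<cdot>\<^bsub>S\<^esub> \<alpha>) \<cdot>\<^bsub>S\<^esub> a''" unfolding \<alpha>_eq using SH by simp
    also have "\<dots> = cl f \<cdot>\<^bsub>S\<^esub> (b \<cdot>\<^bsub>S\<^esub> a'')"
      unfolding c\<alpha> using SH HomD[OF cl_in_Hom[OF f]] by (intro S.assoc) auto
    finally show "c \<cdot>\<^bsub>S\<^esub> (b'' \<cdot>\<^bsub>S\<^esub> cl a1) \<cdot>\<^bsub>S\<^esub> cl e = cl f \<cdot>\<^bsub>S\<^esub> (b \<cdot>\<^bsub>S\<^esub> a'')" .
  qed
  moreover have "h \<cdot> \<kappa> = Zero C K T" if T: "T \<in> \<T>" and h: "h \<in> Hom C X T" for T h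
  proof -
    obtain h' where h': "h' \<in> Hom C T' T" "h' \<cdot> i X = h" using ext[OF T h] by blast
    have "h = (h' \<cdot> b1) \<cdot> e" using h'(2) b1(2) E HomD[OF h'(1)] by simp
    then show ?thesis
      using E HomD[OF h'(1)] HomD[OF \<kappa>(1)] e\<kappa> Hom_objects[OF \<kappa>(1)] by simp
  qed
  ultimately have "is_iso C e"
    using iso e \<kappa> E HomD[OF \<kappa>(1)] unfolding epi_with_invisible_kernel_iso_def by metis
  then have "is_iso S (cl e)" using S_iso_of_iso e(1) by blast
  then have "is_iso S (cl e \<cdot>\<^bsub>S\<^esub> a')" "cl e \<cdot>\<^bsub>S\<^esub> a' \<in> Hom S M I"
    using S.iso_comp[OF a'(2) a'X _ ce] S.Comp_in_Hom[OF a'X ce] by blast+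
  then have "is_iso S (cl a1 \<cdot>\<^bsub>S\<^esub> (cl e \<cdot>\<^bsub>S\<^esub> a'))" "cl a1 \<cdot>\<^bsub>S\<^esub> (cl e \<cdot>\<^bsub>S\<^esub> a') \<in> Hom S M Y"
    using S.iso_comp[OF _ _ a1(2) ca] S.Comp_in_Hom[OF _ ca] by blast+
  then show "is_iso S \<alpha>"
    using S.iso_comp[OF _ _ inv(2) b''(1)] \<alpha>_eq by metis
qed

end

section \<open>Extensions as pushouts of one extension\<close>

context preadditive_category
begin

text \<open>An arrow of short exact sequences that is \<open>a\<close> on the left ends and the identity on the right
  ends.\<close>

definition extension_arrow :: "'m \<Rightarrow> 'm \<times> 'm \<Rightarrow> 'm \<times> 'm \<Rightarrow> bool" where
  "extension_arrow a x y \<longleftrightarrow> (\<exists>u\<in>Hom C (Cod C (fst x)) (Cod C (fst y)).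
     u \<cdot> fst x = fst y \<cdot> a \<and> snd y \<cdot> u = snd x)"

text \<open>The class in \<open>Ext(N, T)\<close> of the pushout of \<open>x\<close> along \<open>a\<close>. As \<open>x\<close> stays fixed and \<open>a\<close> varies,
  these classes describe the group operations and the functoriality of \<open>Ext\<close> by those of the arrows
  \<open>a\<close>.\<close>

definition pushout_class :: "'o \<Rightarrow> 'm \<times> 'm \<Rightarrow> 'o \<Rightarrow> 'm \<Rightarrow> ('m \<times> 'm) set" where
  "pushout_class N x T a = {e. is_extension C N T e \<and> extension_arrow a x e}"

lemma extensionE:
  assumes "is_extension C N T (j, r)"
  obtains E where "j \<in> Hom C T E" "r \<in> Hom C E N" "is_kernel C r j" "is_cokernel C j r"
    "is_mono C j" "is_epi C r" "r \<cdot> j = Zero C T N" "Cod C j = E"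
proof -
  have k: "is_kernel C r j" and c: "is_cokernel C j r" and dc: "Dom C j = T" "Cod C r = N"
    using assms by auto
  have j: "j \<in> Hom C T (Cod C j)" using k dc by (auto simp: is_kernel_def Hom_iff)
  have r: "r \<in> Hom C (Cod C j) N" using c dc by (auto simp: is_cokernel_def Hom_iff)
  show thesis
    using that[OF j r k c kernel_mono[OF k] cokernel_epi[OF c]] cokernel_Hom(2)[OF c j] HomD[OF r]
    by simp
qed

lemma extension_arrowE:
  assumes "extension_arrow a (j, r) (j', r')" "j \<in> Hom C T E" "j' \<in> Hom C T' E'"
  obtains u where "u \<in> Hom C E E'" "u \<cdot> j = j' \<cdot> a" "r' \<cdot> u = r"
  using assms by (auto simp: extension_arrow_def Hom_iff)

lemma extension_arrowI:
  assumes "u \<in> Hom C E E'" "u \<cdot> j = j' \<cdot> a" "r' \<cdot> u = r" "j \<in> Hom C T E" "j' \<in> Hom C T' E'"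
  shows "extension_arrow a (j, r) (j', r')"
  using assms by (auto simp: extension_arrow_def Hom_iff)

lemma extension_arrow_comp:
  assumes x: "is_extension C N T x" and y: "is_extension C N T' y" and z: "is_extension C N T'' z"
    and a: "a \<in> Hom C T T'" "extension_arrow a x y" and b: "b \<in> Hom C T' T''" "extension_arrow b y z"
  shows "extension_arrow (b \<cdot> a) x z"
proof -
  obtain j r j' r' j'' r'' where xyz: "x = (j, r)" "y = (j', r')" "z = (j'', r'')"
    by (metis surj_pair)
  obtain E where E: "j \<in> Hom C T E" "r \<in> Hom C E N" using x xyz extensionE by metis
  obtain E' where E': "j' \<in> Hom C T' E'" "r' \<in> Hom C E' N" using y xyz extensionE by metis
  obtain E'' where E'': "j'' \<in> Hom C T'' E''" "r'' \<in> Hom C E'' N" using z xyz extensionE by metis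
  obtain u where u: "u \<in> Hom C E E'" "u \<cdot> j = j' \<cdot> a" "r' \<cdot> u = r"
    using extension_arrowE a(2) E(1) E'(1) unfolding xyz by metis
  obtain v where v: "v \<in> Hom C E' E''" "v \<cdot> j' = j'' \<cdot> b" "r'' \<cdot> v = r'"
    using extension_arrowE b(2) E'(1) E''(1) unfolding xyz by metis
  note H [THEN Hom_data] = E(1) E'(1,2) E''(1,2) u(1) v(1) a(1) b(1)
  show ?thesis
    unfolding xyz
    by (rule extension_arrowI[of "v \<cdot> u" E E'' _ _ _ _ _ T T''])
       (use H E E'' u v in \<open>auto simp: Hom_iff comp_reduce[OF v(2)] comp_reduce[OF v(3)]\<close>)
qed

text \<open>The arrows between the same two extensions differ by an arrow through the left end, so \<open>a\<close> is
  determined up to arrows that extend along \<open>j\<close>.\<close>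

lemma extension_arrow_iff_diff_extends:
  assumes x: "is_extension C N T (j, r)" and y: "is_extension C N T' y"
    and a: "a \<in> Hom C T T'" "extension_arrow a (j, r) y" and b: "b \<in> Hom C T T'"
  shows "extension_arrow b (j, r) y \<longleftrightarrow> (\<exists>h\<in>Hom C (Cod C j) T'. a \<boxminus> b = h \<cdot> j)"
proof -
  obtain j' r' where y_eq: "y = (j', r')" by (metis surj_pair)
  obtain E where E: "j \<in> Hom C T E" "r \<in> Hom C E N" "Cod C j = E" using x extensionE by metis
  obtain E' where E': "j' \<in> Hom C T' E'" "r' \<in> Hom C E' N" "is_kernel C r' j'" "is_mono C j'"
    "r' \<cdot> j' = Zero C T' N"
    using y y_eq extensionE by metis
  obtain u where u: "u \<in> Hom C E E'" "u \<cdot> j = j' \<cdot> a" "r' \<cdot> u = r"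
    using extension_arrowE a(2) E(1) E'(1) unfolding y_eq by metis
  note H [THEN Hom_data] = E(1,2) E'(1,2) u(1) a(1) b
  show ?thesis
  proof
    assume "extension_arrow b (j, r) y"
    then obtain v where v: "v \<in> Hom C E E'" "v \<cdot> j = j' \<cdot> b" "r' \<cdot> v = r"
      using extension_arrowE E(1) E'(1) unfolding y_eq by metis
    note V [THEN Hom_data] = v(1)
    have "r' \<cdot> (u \<boxminus> v) = Zero C E N" using V H u v by simp
    then obtain h where h: "h \<in> Hom C E T'" "j' \<cdot> h = u \<boxminus> v"
      using kernel_factor[OF E'(3,2), of "u \<boxminus> v" E] V H by (auto simp: Hom_iff)
    have "j' \<cdot> (a \<boxminus> b) = (u \<boxminus> v) \<cdot> j" using V H u v by simp
    then have eq: "j' \<cdot> (a \<boxminus> b) = j' \<cdot> (h \<cdot> j)"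
      using comp_reduce[OF h(2), of j] HomD[OF h(1)] H by simp
    have "a \<boxminus> b = h \<cdot> j"
      by (rule mono_cancel[OF E'(4) _ _ _ _ _ eq]) (use HomD[OF h(1)] H in simp_all)
    then show "\<exists>h\<in>Hom C (Cod C j) T'. a \<boxminus> b = h \<cdot> j" using h(1) E(3) by blast
  next
    assume "\<exists>h\<in>Hom C (Cod C j) T'. a \<boxminus> b = h \<cdot> j"
    then obtain h where h: "h \<in> Hom C E T'" "a \<boxminus> b = h \<cdot> j" using E(3) by blast
    note G [THEN Hom_data] = h(1)
    have "a = (h \<cdot> j) \<boxplus> b" using h(2) G H by (subst (asm) diff_eq_iff) (auto simp: Hom_iff)
    then have "u \<cdot> j = (j' \<cdot> (h \<cdot> j)) \<boxplus> (j' \<cdot> b)" using u(2) G H by simp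
    then have 1: "(u \<boxminus> (j' \<cdot> h)) \<cdot> j = j' \<cdot> b"
      using G H by (simp add: Plus_commute[of "j' \<cdot> (h \<cdot> j)"])
    have 2: "r' \<cdot> (u \<boxminus> (j' \<cdot> h)) = r" using u(3) E'(5) G H by (simp add: comp_reduce[OF E'(5)])
    show "extension_arrow b (j, r) y"
      unfolding y_eq
      by (rule extension_arrowI[OF _ 1 2 E(1) E'(1)]) (use G H in \<open>auto simp: Hom_iff\<close>)
  qed
qed

lemma biproduct_extension:
  assumes b: "is_biproduct C T N j s d r"
  shows "\<exists>E. j \<in> Hom C T E \<and> r \<in> Hom C E N \<and> s \<in> Hom C N E \<and> r \<cdot> s = Id C N \<and>
    is_kernel C r j \<and> is_epi C r"
proof -
  define E where "E = Cod C j"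
  note E = biproduct_Hom[OF b, folded E_def] and B = biproduct_eqs[OF b]
  note sum = biproduct_sum[OF b, folded E_def]
  note H [THEN Hom_data] = E(1,2,3,4)
  have mono: "is_mono C j"
  proof (rule monoI[OF E(1)])
    fix L x assume x: "x \<in> Hom C L T" "j \<cdot> x = Zero C L E"
    have "d \<cdot> (j \<cdot> x) = x" using comp_reduce[OF B(1), of x] HomD[OF x(1)] H by simp
    then show "x = Zero C L T" using x(2) HomD[OF x(1)] Hom_objects[OF x(1)] H by simp
  qed
  have epi: "is_epi C r"
  proof (rule epiI[OF E(4)])
    fix L x assume x: "x \<in> Hom C N L" "x \<cdot> r = Zero C E L"
    have "(x \<cdot> r) \<cdot> s = x" using B(2) HomD[OF x(1)] H by simp
    then show "x = Zero C N L" using x(2) HomD[OF x(1)] Hom_objects[OF x(1)] H by simp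
  qed
  have "is_kernel C r j"
  proof (rule kernelI[OF E(4,1) B(4) mono])
    fix X x assume x: "x \<in> Hom C X E" "r \<cdot> x = Zero C X N"
    note X [THEN Hom_data] = x(1)
    have "x = ((j \<cdot> d) \<boxplus> (s \<cdot> r)) \<cdot> x" unfolding sum using X by simp
    also have "\<dots> = j \<cdot> (d \<cdot> x)" using X H x(2) by simp
    finally show "\<exists>w\<in>Hom C X T. j \<cdot> w = x" using X H by (intro bexI[of _ "d \<cdot> x"]) (auto simp: Hom_iff)
  qed
  then show ?thesis using E B epi by blast
qed

end

context abelian_category
begin

lemma extensionI:
  assumes "j \<in> Hom C T E" "r \<in> Hom C E N" "is_kernel C r j" "is_epi C r"
  shows "is_extension C N T (j, r)"
  using epi_cokernel_of_kernel[OF assms(4,2,3,1)] assms(3) HomD[OF assms(1)] HomD[OF assms(2)] by simp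

lemma pushout_matrix_mono:
  assumes b: "is_biproduct C E T' i1 i2 p1 p2" and j: "j \<in> Hom C T E" "is_mono C j" and a: "a \<in> Hom C T T'"
  shows "is_mono C ((i1 \<cdot> j) \<boxplus> (i2 \<cdot> a))"
proof -
  define P where "P = Cod C i1"
  note P = biproduct_Hom[OF b, folded P_def] and B = biproduct_eqs(1,3)[OF b]
  note H [THEN Hom_data] = j(1) a P(1,2,3)
  show ?thesis
  proof (rule monoI[of _ T P])
    show "(i1 \<cdot> j) \<boxplus> (i2 \<cdot> a) \<in> Hom C T P" using H by (simp add: Hom_iff)
    fix L x assume x: "x \<in> Hom C L T" "((i1 \<cdot> j) \<boxplus> (i2 \<cdot> a)) \<cdot> x = Zero C L P"
    note X [THEN Hom_data] = x(1)
    have "j \<cdot> x = p1 \<cdot> (((i1 \<cdot> j) \<boxplus> (i2 \<cdot> a)) \<cdot> x)"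
      using X H by (simp add: comp_reduce[OF B(1)] comp_reduce[OF B(2)])
    also have "\<dots> = Zero C L E" unfolding x(2) using X H by simp
    finally show "x = Zero C L T" by (rule mono_cancel_Zero[OF j(2,1) x(1)])
  qed
qed

text \<open>As \<open>j\<close> is a monomorphism, \<open>T \<rightarrow> E \<oplus> T'\<close> is the kernel of its cokernel \<open>E \<oplus> T' \<rightarrow> Q\<close>; an arrow
  into \<open>T'\<close> that \<open>j'\<close> kills therefore comes from an arrow into \<open>T\<close> that \<open>j\<close> kills.\<close>

lemma pushout_extension_is_extension:
  assumes x: "is_extension C N T x" and a: "a \<in> Hom C T T'" and po: "is_pushout_extension C a x y"
  shows "is_extension C N T' y" "extension_arrow a x y"
proof -
  obtain j r j' r' where xy: "x = (j, r)" "y = (j', r')" by (metis surj_pair)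
  obtain E where E: "j \<in> Hom C T E" "r \<in> Hom C E N" "is_cokernel C j r" "is_mono C j" "is_epi C r"
    using x xy extensionE by metis
  obtain u where u: "is_pushout C j a u j'" "r' \<in> Hom C (Cod C u) N" "r' \<cdot> u = r"
    "r' \<cdot> j' = Zero C T' N"
    using po xy HomD[OF a] HomD[OF E(2)] by auto
  define Q where "Q = Cod C u"
  have uE: "u \<in> Hom C E Q" and j': "j' \<in> Hom C T' Q" and comm: "u \<cdot> j = j' \<cdot> a"
    using pushout_Hom[OF u(1) E(1) a] by (simp_all add: Q_def)
  have r': "r' \<in> Hom C Q N" using u(2) by (simp add: Q_def)
  obtain i1 i2 p1 p2 where b: "is_biproduct C E T' i1 i2 p1 p2"
    using ex_biproduct Hom_objects(2)[OF E(1)] Hom_objects(2)[OF a] by blast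
  define P where "P = Cod C i1"
  note P = biproduct_Hom[OF b, folded P_def] and B = biproduct_eqs[OF b]
  note H [THEN Hom_data] = E(1,2) uE j' r' a P(1,2,3,4)
  define \<kappa> c where "\<kappa> = (i1 \<cdot> j) \<boxplus> (i2 \<cdot> a)" and "c = (u \<cdot> p1) \<boxminus> (j' \<cdot> p2)"
  have \<kappa>: "\<kappa> \<in> Hom C T P" and c: "c \<in> Hom C P Q" using H by (simp_all add: \<kappa>_def c_def Hom_iff)
  have co: "is_cokernel C \<kappa> c"
    unfolding \<kappa>_def c_def using pushout_iff_cokernel[OF E(1) a uE j' b] u(1) by blast
  have \<kappa>_mono: "is_mono C \<kappa>" unfolding \<kappa>_def by (rule pushout_matrix_mono[OF b E(1,4) a])
  have ker: "is_kernel C c \<kappa>" by (rule mono_kernel_of_cokernel[OF \<kappa>_mono \<kappa> co c])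
  have p\<kappa>: "p1 \<cdot> \<kappa> = j" using H by (simp add: \<kappa>_def B B[THEN comp_reduce])
  have j'_mono: "is_mono C j'"
  proof (rule monoI[OF j'])
    fix L x assume x: "x \<in> Hom C L T'" "j' \<cdot> x = Zero C L Q"
    note X [THEN Hom_data] = x(1)
    have "c \<cdot> (i2 \<cdot> x) = Zero C L Q" using X H x(2) by (simp add: c_def B[THEN comp_reduce])
    then obtain z where z: "z \<in> Hom C L T" "\<kappa> \<cdot> z = i2 \<cdot> x"
      using kernel_factor[OF ker c, of "i2 \<cdot> x" L] X H HomD[OF \<kappa>] by (auto simp: Hom_iff)
    note Z [THEN Hom_data] = z(1) \<kappa>
    have "j \<cdot> z = p1 \<cdot> (i2 \<cdot> x)" using comp_reduce[OF p\<kappa>, of z] Z H z(2) by simp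
    also have "\<dots> = Zero C L E" using X H by (simp add: B[THEN comp_reduce])
    finally have "z = Zero C L T" by (rule mono_cancel_Zero[OF E(4,1) z(1)])
    then have "i2 \<cdot> x = Zero C L P" using z(2) Z X by simp
    then have "p2 \<cdot> (i2 \<cdot> x) = Zero C L T'" using X H by simp
    then show "x = Zero C L T'" using X H by (simp add: B[THEN comp_reduce])
  qed
  have r'_epi: "is_epi C r'"
  proof (rule epiI[OF r'])
    fix L x assume x: "x \<in> Hom C N L" "x \<cdot> r' = Zero C Q L"
    have "x \<cdot> r = (x \<cdot> r') \<cdot> u" using u(3) HomD[OF x(1)] H by simp
    also have "\<dots> = Zero C E L" unfolding x(2) using H Hom_objects[OF x(1)] by simp
    finally show "x = Zero C N L" by (rule epi_cancel_Zero[OF E(5,2) x(1)])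
  qed
  have "is_cokernel C j' r'"
  proof (rule cokernelI[OF j' r' u(4) r'_epi])
    fix X x assume x: "x \<in> Hom C Q X" "x \<cdot> j' = Zero C T' X"
    note X [THEN Hom_data] = x(1)
    have "(x \<cdot> u) \<cdot> j = (x \<cdot> j') \<cdot> a" using comm X H by simp
    also have "\<dots> = Zero C T X" unfolding x(2) using X H by simp
    finally obtain z where z: "z \<in> Hom C N X" "z \<cdot> r = x \<cdot> u"
      using cokernel_factor[OF E(3,1), of "x \<cdot> u" X] X H by (auto simp: Hom_iff)
    note Z [THEN Hom_data] = z(1)
    have "z \<cdot> r' = x"
      by (rule pushout_eq[OF u(1) E(1) a uE, of _ X])
         (use Z X H x u(3,4) z(2) in \<open>auto simp: Hom_iff\<close>)
    then show "\<exists>w\<in>Hom C N X. w \<cdot> r' = x" using z by blast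
  qed
  then have "is_kernel C r' j'" by (rule mono_kernel_of_cokernel[OF j'_mono j' _ r'])
  then show "is_extension C N T' y" unfolding xy by (intro extensionI[OF j' r' _ r'_epi])
  show "extension_arrow a x y"
    unfolding xy by (rule extension_arrowI[OF uE comm u(3) E(1) j'])
qed

lemma ex_pushout_extension:
  assumes x: "is_extension C N T x" and a: "a \<in> Hom C T T'"
  shows "\<exists>y. is_pushout_extension C a x y"
proof -
  obtain j r where xy: "x = (j, r)" by (metis surj_pair)
  obtain E where E: "j \<in> Hom C T E" "r \<in> Hom C E N" "r \<cdot> j = Zero C T N"
    using x xy extensionE by metis
  obtain i1 i2 p1 p2 where b: "is_biproduct C E T' i1 i2 p1 p2"
    using ex_biproduct Hom_objects(2)[OF E(1)] Hom_objects(2)[OF a] by blast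
  define P where "P = Cod C i1"
  note P = biproduct_Hom[OF b, folded P_def] and B = biproduct_eqs[OF b]
  note H [THEN Hom_data] = E(1,2) a P(1,2,3,4)
  have \<kappa>: "(i1 \<cdot> j) \<boxplus> (i2 \<cdot> a) \<in> Hom C T P" using H by (simp add: Hom_iff)
  obtain Q c where c: "c \<in> Hom C P Q" "is_cokernel C ((i1 \<cdot> j) \<boxplus> (i2 \<cdot> a)) c"
    using obtain_cokernel[OF \<kappa>] by blast
  note CH [THEN Hom_data] = c(1)
  have u: "c \<cdot> i1 \<in> Hom C E Q" and j': "neg (c \<cdot> i2) \<in> Hom C T' Q" using CH H by (simp_all add: Hom_iff)
  have "c = ((c \<cdot> i1) \<cdot> p1) \<boxminus> (neg (c \<cdot> i2) \<cdot> p2)"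
    by (rule biproduct_out_eq[OF b, of _ Q]) (use CH H in \<open>auto simp: Hom_iff B\<close>)
  then have po: "is_pushout C j a (c \<cdot> i1) (neg (c \<cdot> i2))"
    using pushout_iff_cokernel[OF E(1) a u j' b] c(2) by simp
  obtain r' where "r' \<in> Hom C Q N" "r' \<cdot> (c \<cdot> i1) = r" "r' \<cdot> neg (c \<cdot> i2) = Zero C T' N"
    using pushout_factor[OF po E(1) a u E(2), of "Zero C T' N"] E(3) H by (auto simp: Hom_iff)
  then have "is_pushout_extension C a (j, r) (neg (c \<cdot> i2), r')"
    using po HomD[OF u] H by auto
  then show ?thesis using xy by blast
qed

text \<open>Conversely, every arrow of extensions over the identity of \<open>N\<close> is a pushout square: in the
  sequence \<open>T \<rightarrow> E \<oplus> T' \<rightarrow> E'\<close> the second arrow is an epimorphism with kernel the first.\<close>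

lemma extension_arrow_imp_pushout:
  assumes x: "is_extension C N T x" and y: "is_extension C N T' y"
    and a: "a \<in> Hom C T T'" "extension_arrow a x y"
  shows "is_pushout_extension C a x y"
proof -
  obtain j r j' r' where xy: "x = (j, r)" "y = (j', r')" by (metis surj_pair)
  obtain E where E: "j \<in> Hom C T E" "r \<in> Hom C E N" "is_kernel C r j" "is_mono C j" "is_epi C r"
    "r \<cdot> j = Zero C T N"
    using x xy extensionE by metis
  obtain E' where E': "j' \<in> Hom C T' E'" "r' \<in> Hom C E' N" "is_mono C j'" "is_cokernel C j' r'"
    "r' \<cdot> j' = Zero C T' N"
    using y xy extensionE by metis
  obtain u where u: "u \<in> Hom C E E'" "u \<cdot> j = j' \<cdot> a" "r' \<cdot> u = r"
    using extension_arrowE a(2) E(1) E'(1) unfolding xy by metis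
  obtain i1 i2 p1 p2 where b: "is_biproduct C E T' i1 i2 p1 p2"
    using ex_biproduct Hom_objects(2)[OF E(1)] Hom_objects(2)[OF a(1)] by blast
  define P where "P = Cod C i1"
  note P = biproduct_Hom[OF b, folded P_def] and B = biproduct_eqs[OF b]
  note H [THEN Hom_data] = E(1,2) E'(1,2) u(1) a(1) P(1,2,3,4)
  define \<kappa> c where "\<kappa> = (i1 \<cdot> j) \<boxplus> (i2 \<cdot> a)" and "c = (u \<cdot> p1) \<boxminus> (j' \<cdot> p2)"
  have \<kappa>: "\<kappa> \<in> Hom C T P" and c: "c \<in> Hom C P E'" using H by (simp_all add: \<kappa>_def c_def Hom_iff)
  have ci: "c \<cdot> i1 = u" "c \<cdot> i2 = neg j'" using H by (simp_all add: c_def B)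
  note K [THEN Hom_data] = \<kappa> c
  have epi: "is_epi C c"
  proof (rule epiI[OF c])
    fix L x assume x: "x \<in> Hom C E' L" "x \<cdot> c = Zero C P L"
    note X [THEN Hom_data] = x(1)
    have "x \<cdot> (c \<cdot> i1) = Zero C E L" "x \<cdot> (c \<cdot> i2) = Zero C T' L"
      using X H K by (simp_all add: comp_reduce[OF x(2)])
    then have xu: "x \<cdot> u = Zero C E L" and "neg (x \<cdot> j') = Zero C T' L" using ci X H by auto
    then have "neg (neg (x \<cdot> j')) = neg (Zero C T' L)" by simp
    then have "x \<cdot> j' = Zero C T' L" using X H by simp
    then obtain z where z: "z \<in> Hom C N L" "z \<cdot> r' = x"
      using cokernel_factor[OF E'(4,1) x(1)] H by auto
    have "z \<cdot> r = x \<cdot> u" using comp_reduce[OF z(2), of u] u(3) HomD[OF z(1)] H by simp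
    then have "z = Zero C N L" using xu by (intro epi_cancel_Zero[OF E(5,2) z(1)]) simp
    then show "x = Zero C E' L" using z(2) X H by simp
  qed
  have "is_kernel C c \<kappa>"
  proof (rule kernelI[OF c \<kappa>])
    show "c \<cdot> \<kappa> = Zero C T E'"
      using H u(2) by (simp add: c_def \<kappa>_def B[THEN comp_reduce])
    show "is_mono C \<kappa>" unfolding \<kappa>_def by (rule pushout_matrix_mono[OF b E(1,4) a(1)])
    fix X z assume z: "z \<in> Hom C X P" "c \<cdot> z = Zero C X E'"
    note Z [THEN Hom_data] = z(1)
    have "(u \<cdot> (p1 \<cdot> z)) \<boxminus> (j' \<cdot> (p2 \<cdot> z)) = Zero C X E'"
      using z(2) Z H by (simp add: c_def)
    then have up: "u \<cdot> (p1 \<cdot> z) = j' \<cdot> (p2 \<cdot> z)"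
      using Z H by (subst (asm) diff_eq_Zero_iff) (auto simp: Hom_iff)
    have "r \<cdot> (p1 \<cdot> z) = r' \<cdot> (u \<cdot> (p1 \<cdot> z))" using Z H by (simp add: comp_reduce[OF u(3)])
    also have "\<dots> = Zero C X N" unfolding up using Z H by (simp add: comp_reduce[OF E'(5)])
    finally obtain w where w: "w \<in> Hom C X T" "j \<cdot> w = p1 \<cdot> z"
      using kernel_factor[OF E(3,2), of "p1 \<cdot> z" X] Z H by (auto simp: Hom_iff)
    note W [THEN Hom_data] = w(1)
    have eq: "j' \<cdot> (a \<cdot> w) = j' \<cdot> (p2 \<cdot> z)"
      using comp_reduce[OF u(2), of w] W H w(2) up by simp
    have aw: "a \<cdot> w = p2 \<cdot> z"
      by (rule mono_cancel[OF E'(3) _ _ _ _ _ eq]) (use W Z H in auto)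
    have "\<kappa> \<cdot> w = z"
      by (rule biproduct_in_eq[OF b, of _ X])
         (use W Z H K w(2) aw in \<open>auto simp: Hom_iff \<kappa>_def B[THEN comp_reduce]\<close>)
    then show "\<exists>w\<in>Hom C X T. \<kappa> \<cdot> w = z" using w by blast
  qed
  then have "is_cokernel C \<kappa> c" using epi_cokernel_of_kernel[OF epi c _ \<kappa>] by blast
  then have "is_pushout C j a u j'"
    using pushout_iff_cokernel[OF E(1) a(1) u(1) E'(1) b] by (simp add: \<kappa>_def c_def)
  then show ?thesis
    unfolding xy is_pushout_extension.simps
    by (intro exI[of _ u]) (use u(3) E'(5) H in \<open>simp add: Hom_iff\<close>)
qed

text \<open>The universal property of the pushout extension \<open>y\<close>.\<close>

lemma extension_arrow_factor:
  assumes x: "is_extension C N T x" and y: "is_extension C N T' y" and z: "is_extension C N T'' z"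
    and a: "a \<in> Hom C T T'" "extension_arrow a x y" and b: "b \<in> Hom C T' T''"
    and ba: "extension_arrow (b \<cdot> a) x z"
  shows "extension_arrow b y z"
proof -
  obtain j r j' r' j'' r'' where xyz: "x = (j, r)" "y = (j', r')" "z = (j'', r'')"
    by (metis surj_pair)
  obtain E where E: "j \<in> Hom C T E" "r \<in> Hom C E N" using x xyz extensionE by metis
  obtain E' where E': "j' \<in> Hom C T' E'" "r' \<in> Hom C E' N" "r' \<cdot> j' = Zero C T' N"
    using y xyz extensionE by metis
  obtain E'' where E'': "j'' \<in> Hom C T'' E''" "r'' \<in> Hom C E'' N" "r'' \<cdot> j'' = Zero C T'' N"
    using z xyz extensionE by metis
  obtain u where po: "is_pushout C j a u j'" and ru: "r' \<cdot> u = r"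
    using extension_arrow_imp_pushout[OF x y a] xyz by auto
  have u: "u \<in> Hom C E E'" using pushout_Hom[OF po E(1) a(1)] HomD[OF E'(1)] by (simp add: Hom_iff)
  obtain v where v: "v \<in> Hom C E E''" "v \<cdot> j = j'' \<cdot> (b \<cdot> a)" "r'' \<cdot> v = r"
    using extension_arrowE ba E(1) E''(1) unfolding xyz by metis
  note H [THEN Hom_data] = E(1) E'(1,2) E''(1,2) u v(1) a(1) b
  obtain w where w: "w \<in> Hom C E' E''" "w \<cdot> u = v" "w \<cdot> j' = j'' \<cdot> b"
    using pushout_factor[OF po E(1) a(1) u v(1), of "j'' \<cdot> b"] v(2) H by (auto simp: Hom_iff)
  have "r'' \<cdot> w = r'"
    by (rule pushout_eq[OF po E(1) a(1) u, of _ N])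
       (use H HomD[OF w(1)] w ru v(3) E'(3) E''(3) in \<open>auto simp: Hom_iff comp_reduce[OF E''(3)]\<close>)
  then show ?thesis
    unfolding xyz using extension_arrowI[OF w(1,3) _ E'(1) E''(1)] by blast
qed

lemma pushout_class_nonempty:
  assumes "is_extension C N T x" "a \<in> Hom C T T'"
  obtains y where "y \<in> pushout_class N x T' a"
  using ex_pushout_extension[OF assms] pushout_extension_is_extension[OF assms]
  unfolding pushout_class_def by blast

lemma pushout_class_comp:
  assumes x: "is_extension C N T x" and a: "a \<in> Hom C T T'" and b: "b \<in> Hom C T' T''"
    and y: "y \<in> pushout_class N x T' a"
  shows "pushout_class N y T'' b = pushout_class N x T'' (b \<cdot> a)"
proof -
  have "is_extension C N T' y" "extension_arrow a x y" using y by (auto simp: pushout_class_def)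
  then show ?thesis
    using extension_arrow_comp[OF x _ _ a _ b] extension_arrow_factor[OF x _ _ a _ b]
    unfolding pushout_class_def by blast
qed

lemma Ext_map_pushout_class:
  assumes x: "is_extension C N T x" and a: "a \<in> Hom C T T'" and b: "b \<in> Hom C T' T''"
  shows "Ext_map C b (pushout_class N x T' a) = pushout_class N x T'' (b \<cdot> a)"
proof -
  have 1: "is_pushout_extension C b y e \<longleftrightarrow> e \<in> pushout_class N x T'' (b \<cdot> a)"
    if y: "y \<in> pushout_class N x T' a" for y e
  proof -
    have "is_extension C N T' y" using y by (simp add: pushout_class_def)
    then have "is_pushout_extension C b y e \<longleftrightarrow> e \<in> pushout_class N y T'' b"
      using pushout_extension_is_extension[OF _ b] extension_arrow_imp_pushout[OF _ _ b]
      unfolding pushout_class_def by blast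
    then show ?thesis using pushout_class_comp[OF x a b y] by simp
  qed
  obtain y where "y \<in> pushout_class N x T' a" using pushout_class_nonempty[OF x a] by blast
  then show ?thesis unfolding Ext_map_def using 1 by blast
qed

text \<open>The short five lemma: arrows of extensions that are identities at both ends are isomorphisms.\<close>

lemma extension_rel_iff:
  "(x, y) \<in> extension_rel C N T \<longleftrightarrow>
    is_extension C N T x \<and> is_extension C N T y \<and> extension_arrow (Id C T) x y"
proof -
  obtain j r j' r' where xy: "x = (j, r)" "y = (j', r')" by (metis surj_pair)
  have *: "(\<exists>u\<in>Hom C (Cod C j) (Cod C j'). is_iso C u \<and> u \<cdot> j = j' \<and> r' \<cdot> u = r) \<longleftrightarrow>
      extension_arrow (Id C T) x y"
    if x: "is_extension C N T (j, r)" and y: "is_extension C N T (j', r')"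
  proof -
    obtain E where E: "j \<in> Hom C T E" "r \<in> Hom C E N" "is_kernel C r j" "is_epi C r" "Cod C j = E"
      using x extensionE by metis
    obtain E' where E': "j' \<in> Hom C T E'" "r' \<in> Hom C E' N" "is_mono C j'" "is_cokernel C j' r'"
      "Cod C j' = E'"
      using y extensionE by metis
    note H [THEN Hom_data] = E(1,2) E'(1,2)
    have "is_iso C u" if u: "u \<in> Hom C E E'" "u \<cdot> j = j'" "r' \<cdot> u = r" for u
    proof (rule mono_epi_iso)
      note U [THEN Hom_data] = u(1)
      show "is_mono C u"
      proof (rule monoI[OF u(1)])
        fix L z assume z: "z \<in> Hom C L E" "u \<cdot> z = Zero C L E'"
        note Z [THEN Hom_data] = z(1)
        have "r \<cdot> z = r' \<cdot> (u \<cdot> z)" using Z U H by (simp add: comp_reduce[OF u(3)])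
        then have "r \<cdot> z = Zero C L N" using z(2) Z H by simp
        then obtain w where w: "w \<in> Hom C L T" "j \<cdot> w = z"
          using kernel_factor[OF E(3,2) z(1)] H by auto
        have "j' \<cdot> w = u \<cdot> z" using comp_reduce[OF u(2), of w] HomD[OF w(1)] w(2) U H by simp
        then have "w = Zero C L T" using z(2) by (intro mono_cancel_Zero[OF E'(3,1) w(1)]) simp
        then show "z = Zero C L E" using w(2) Z H by simp
      qed
      show "is_epi C u"
      proof (rule epiI[OF u(1)])
        fix L z assume z: "z \<in> Hom C E' L" "z \<cdot> u = Zero C E L"
        note Z [THEN Hom_data] = z(1)
        have "z \<cdot> j' = (z \<cdot> u) \<cdot> j" using Z U H u(2) by simp
        then have "z \<cdot> j' = Zero C T L" using z(2) Z H by simp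
        then obtain w where w: "w \<in> Hom C N L" "w \<cdot> r' = z"
          using cokernel_factor[OF E'(4,1) z(1)] H by auto
        have "w \<cdot> r = z \<cdot> u" using comp_reduce[OF w(2), of u] HomD[OF w(1)] u(3) U H by simp
        then have "w = Zero C N L" using z(2) by (intro epi_cancel_Zero[OF E(4,2) w(1)]) simp
        then show "z = Zero C E' L" using w(2) Z H by simp
      qed
    qed
    then show ?thesis
      using H E(5) E'(5) unfolding extension_arrow_def xy by auto
  qed
  show ?thesis
    unfolding extension_rel_def using * xy by auto
qed

lemma extension_class_eq:
  assumes "is_extension C N T x"
  shows "extension_rel C N T `` {x} = pushout_class N x T (Id C T)"
  using assms by (auto simp: extension_rel_iff pushout_class_def simp del: is_extension.simps)

lemma Ext_carrierE:
  assumes "X \<in> carrier (Ext_group C N T)"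
  obtains x where "is_extension C N T x" "X = pushout_class N x T (Id C T)"
  using assms extension_class_eq by (auto simp: Ext_group_def elim!: quotientE simp del: is_extension.simps)

lemma pushout_class_in_carrier:
  assumes x: "is_extension C N T x" and a: "a \<in> Hom C T T'"
  shows "pushout_class N x T' a \<in> carrier (Ext_group C N T')"
proof -
  obtain y where y: "y \<in> pushout_class N x T' a" using pushout_class_nonempty[OF x a] by blast
  then have ext: "is_extension C N T' y" by (simp add: pushout_class_def)
  have "extension_rel C N T' `` {y} = pushout_class N x T' (Id C T' \<cdot> a)"
    using extension_class_eq[OF ext] pushout_class_comp[OF x a _ y, of "Id C T'" T'] Hom_objects[OF a]
    by (simp add: Hom_iff)
  also have "\<dots> = pushout_class N x T' a" using HomD[OF a] by simp
  finally show ?thesis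
    using ext quotientI[of y "{e. is_extension C N T' e}" "extension_rel C N T'"]
    by (simp add: Ext_group_def)
qed

lemma pushout_class_eq_iff:
  assumes x: "is_extension C N T (j, r)" and a: "a \<in> Hom C T T'" and b: "b \<in> Hom C T T'"
  shows "pushout_class N (j, r) T' a = pushout_class N (j, r) T' b \<longleftrightarrow>
    (\<exists>h\<in>Hom C (Cod C j) T'. a \<boxminus> b = h \<cdot> j)"
proof
  assume eq: "pushout_class N (j, r) T' a = pushout_class N (j, r) T' b"
  obtain y where y: "y \<in> pushout_class N (j, r) T' a" using pushout_class_nonempty[OF x a] by blast
  then show "\<exists>h\<in>Hom C (Cod C j) T'. a \<boxminus> b = h \<cdot> j"
    using eq extension_arrow_iff_diff_extends[OF x _ a _ b] unfolding pushout_class_def by blast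
next
  assume ex: "\<exists>h\<in>Hom C (Cod C j) T'. a \<boxminus> b = h \<cdot> j"
  then obtain h where h: "h \<in> Hom C (Cod C j) T'" "a \<boxminus> b = h \<cdot> j" by blast
  have j: "j \<in> Hom C T (Cod C j)" using x extensionE by metis
  note H [THEN Hom_data] = h(1) j a b
  have "b \<boxminus> a = neg (a \<boxminus> b)" using H by (simp add: Plus_commute)
  also have "\<dots> = neg h \<cdot> j" unfolding h(2) using H by simp
  finally have ex': "\<exists>h\<in>Hom C (Cod C j) T'. b \<boxminus> a = h \<cdot> j"
    using H by (intro bexI[of _ "neg h"]) (auto simp: Hom_iff)
  show "pushout_class N (j, r) T' a = pushout_class N (j, r) T' b"
    using extension_arrow_iff_diff_extends[OF x _ a _ b] ex
      extension_arrow_iff_diff_extends[OF x _ b _ a] ex'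
    unfolding pushout_class_def by blast
qed

text \<open>An arrow of extensions over \<open>0: T \<rightarrow> T'\<close> vanishes on \<open>T\<close>, so it factors through \<open>N\<close> and is a
  section of the target; conversely a section \<open>s\<close> gives the arrow \<open>s r\<close>.\<close>

lemma Ext_one_eq:
  assumes x: "is_extension C N T x" and T': "T' \<in> Ob C"
  shows "\<one>\<^bsub>Ext_group C N T'\<^esub> = pushout_class N x T' (Zero C T T')"
proof -
  obtain j r where xy: "x = (j, r)" by (metis surj_pair)
  obtain E where E: "j \<in> Hom C T E" "r \<in> Hom C E N" "is_cokernel C j r" "is_epi C r"
    "r \<cdot> j = Zero C T N"
    using x xy extensionE by metis
  note H [THEN Hom_data] = E(1,2)
  have "(\<exists>s d. is_biproduct C T' N j' s d r') \<longleftrightarrow> (j', r') \<in> pushout_class N x T' (Zero C T T')" for j' r'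
  proof
    assume "\<exists>s d. is_biproduct C T' N j' s d r'"
    then obtain s d where "is_biproduct C T' N j' s d r'" by blast
    then obtain E' where E': "j' \<in> Hom C T' E'" "r' \<in> Hom C E' N" "s \<in> Hom C N E'" "r' \<cdot> s = Id C N"
      "is_kernel C r' j'" "is_epi C r'"
      using biproduct_extension by metis
    note H' [THEN Hom_data] = E'(1,2,3)
    have "extension_arrow (Zero C T T') (j, r) (j', r')"
      by (rule extension_arrowI[of "s \<cdot> r" E E' _ _ _ _ _ T T'])
         (use E E' H H' in \<open>auto simp: Hom_iff comp_reduce[OF E'(4)]\<close>)
    then show "(j', r') \<in> pushout_class N x T' (Zero C T T')"
      using extensionI[OF E'(1,2,5,6)] unfolding xy pushout_class_def by blast
  next
    assume "(j', r') \<in> pushout_class N x T' (Zero C T T')"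
    then have ext: "is_extension C N T' (j', r')" and arr: "extension_arrow (Zero C T T') (j, r) (j', r')"
      unfolding xy pushout_class_def by blast+
    obtain E' where E': "j' \<in> Hom C T' E'" "r' \<in> Hom C E' N" "is_kernel C r' j'"
      using ext extensionE by metis
    note H' [THEN Hom_data] = E'(1,2)
    obtain u where u: "u \<in> Hom C E E'" "u \<cdot> j = j' \<cdot> Zero C T T'" "r' \<cdot> u = r"
      using extension_arrowE arr E(1) E'(1) by metis
    have "u \<cdot> j = Zero C T E'" using u(2) H H' by simp
    then obtain s where s: "s \<in> Hom C N E'" "s \<cdot> r = u"
      using cokernel_factor[OF E(3,1) u(1)] H by auto
    note SH [THEN Hom_data] = s(1)
    have eq: "(r' \<cdot> s) \<cdot> r = Id C N \<cdot> r" using s(2) u(3) SH H H' by simp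
    have "r' \<cdot> s = Id C N"
      by (rule epi_cancel[OF E(4) _ _ _ _ _ eq]) (use SH H H' in auto)
    then obtain d where "is_biproduct C T' N j' s d r'"
      using split_kernel_biproduct[OF E'(3,2,1) s(1)] by blast
    then show "\<exists>s d. is_biproduct C T' N j' s d r'" by blast
  qed
  then show ?thesis by (auto simp: Ext_group_def)
qed

end

section \<open>The Baer sum\<close>

context abelian_category
begin

lemma direct_sum_extension:
  assumes x: "is_extension C N T (j, r)" and y: "is_extension C N T' (j', r')"
    and bT: "is_biproduct C T T' t1 t2 s1 s2"
    and bE: "is_biproduct C (Cod C j) (Cod C j') e1 e2 d1 d2"
    and bN: "is_biproduct C N N n1 n2 m1 m2"
  shows "is_extension C (Cod C n1) (Cod C t1)
    ((e1 \<cdot> j \<cdot> s1) \<boxplus> (e2 \<cdot> j' \<cdot> s2), (n1 \<cdot> r \<cdot> d1) \<boxplus> (n2 \<cdot> r' \<cdot> d2))"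
proof -
  obtain E where E: "j \<in> Hom C T E" "r \<in> Hom C E N" "is_kernel C r j" "is_mono C j" "is_epi C r"
    "r \<cdot> j = Zero C T N" "Cod C j = E"
    using x extensionE by metis
  obtain E' where E': "j' \<in> Hom C T' E'" "r' \<in> Hom C E' N" "is_kernel C r' j'" "is_mono C j'"
    "is_epi C r'" "r' \<cdot> j' = Zero C T' N" "Cod C j' = E'"
    using y extensionE by metis
  note bE' = bE[unfolded E(7) E'(7)]
  define A where "A = Cod C t1"
  note A = biproduct_Hom[OF bT, folded A_def] and At = biproduct_eqs[OF bT]
  define B where "B = Cod C e1"
  note B = biproduct_Hom[OF bE', folded B_def] and Be = biproduct_eqs[OF bE']
  define D where "D = Cod C n1"
  note D = biproduct_Hom[OF bN, folded D_def] and Dn = biproduct_eqs[OF bN]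
  note H [THEN Hom_data] = E(1,2) E'(1,2) A(1,2,3,4) B(1,2,3,4) D(1,2,3,4)
  note R = At At[THEN comp_reduce] Be Be[THEN comp_reduce] Dn Dn[THEN comp_reduce]
    E(6) comp_reduce[OF E(6)] E'(6) comp_reduce[OF E'(6)]
  define J where "J = (e1 \<cdot> j \<cdot> s1) \<boxplus> (e2 \<cdot> j' \<cdot> s2)"
  define Q where "Q = (n1 \<cdot> r \<cdot> d1) \<boxplus> (n2 \<cdot> r' \<cdot> d2)"
  have J: "J \<in> Hom C A B" and Q: "Q \<in> Hom C B D" using H by (simp_all add: J_def Q_def Hom_iff)
  have dJ: "d1 \<cdot> J = j \<cdot> s1" "d2 \<cdot> J = j' \<cdot> s2" using H by (simp_all add: J_def R)
  have mQ: "m1 \<cdot> Q = r \<cdot> d1" "m2 \<cdot> Q = r' \<cdot> d2" using H by (simp_all add: Q_def R)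
  have Qe: "Q \<cdot> e1 = n1 \<cdot> r" "Q \<cdot> e2 = n2 \<cdot> r'" using H by (simp_all add: Q_def R)
  note JQ [THEN Hom_data] = J Q
  have epi: "is_epi C Q"
  proof (rule epiI[OF Q])
    fix L z assume z: "z \<in> Hom C D L" "z \<cdot> Q = Zero C B L"
    note Z [THEN Hom_data] = z(1)
    have "(z \<cdot> n1) \<cdot> r = (z \<cdot> Q) \<cdot> e1" "(z \<cdot> n2) \<cdot> r' = (z \<cdot> Q) \<cdot> e2"
      using Z JQ H by (simp_all add: Qe)
    then have "(z \<cdot> n1) \<cdot> r = Zero C E L" "(z \<cdot> n2) \<cdot> r' = Zero C E' L"
      unfolding z(2) using Z H by simp_all
    then have zn: "z \<cdot> n1 = Zero C N L" "z \<cdot> n2 = Zero C N L"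
      using epi_cancel_Zero[OF E(5,2), of "z \<cdot> n1" L] epi_cancel_Zero[OF E'(5,2), of "z \<cdot> n2" L]
        Z H by (simp_all add: Hom_iff)
    show "z = Zero C D L"
      by (rule biproduct_out_eq[OF bN, of _ L]) (use zn Z H in \<open>auto simp: Hom_iff\<close>)
  qed
  have "is_kernel C Q J"
  proof (rule kernelI[OF Q J])
    show "Q \<cdot> J = Zero C A D"
      using H by (simp add: Q_def J_def R)
    show "is_mono C J"
    proof (rule monoI[OF J])
      fix L z assume z: "z \<in> Hom C L A" "J \<cdot> z = Zero C L B"
      note Z [THEN Hom_data] = z(1)
      have "j \<cdot> (s1 \<cdot> z) = d1 \<cdot> (J \<cdot> z)" "j' \<cdot> (s2 \<cdot> z) = d2 \<cdot> (J \<cdot> z)"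
        using Z JQ H by (simp_all add: comp_reduce[OF dJ(1)] comp_reduce[OF dJ(2)])
      then have "j \<cdot> (s1 \<cdot> z) = Zero C L E" "j' \<cdot> (s2 \<cdot> z) = Zero C L E'"
        unfolding z(2) using Z H by simp_all
      then have sz: "s1 \<cdot> z = Zero C L T" "s2 \<cdot> z = Zero C L T'"
        using mono_cancel_Zero[OF E(4,1), of "s1 \<cdot> z" L] mono_cancel_Zero[OF E'(4,1), of "s2 \<cdot> z" L]
          Z H by (simp_all add: Hom_iff)
      show "z = Zero C L A"
        by (rule biproduct_in_eq[OF bT, of _ L]) (use sz Z H in \<open>auto simp: Hom_iff\<close>)
    qed
    fix X z assume z: "z \<in> Hom C X B" "Q \<cdot> z = Zero C X D"
    note Z [THEN Hom_data] = z(1)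
    have "r \<cdot> (d1 \<cdot> z) = m1 \<cdot> (Q \<cdot> z)" "r' \<cdot> (d2 \<cdot> z) = m2 \<cdot> (Q \<cdot> z)"
      using Z JQ H by (simp_all add: comp_reduce[OF mQ(1)] comp_reduce[OF mQ(2)])
    then have rz: "r \<cdot> (d1 \<cdot> z) = Zero C X N" "r' \<cdot> (d2 \<cdot> z) = Zero C X N"
      unfolding z(2) using Z H by simp_all
    obtain w1 where w1: "w1 \<in> Hom C X T" "j \<cdot> w1 = d1 \<cdot> z"
      using kernel_factor[OF E(3,2), of "d1 \<cdot> z" X] rz Z H by (auto simp: Hom_iff)
    obtain w2 where w2: "w2 \<in> Hom C X T'" "j' \<cdot> w2 = d2 \<cdot> z"
      using kernel_factor[OF E'(3,2), of "d2 \<cdot> z" X] rz Z H by (auto simp: Hom_iff)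
    note W [THEN Hom_data] = w1(1) w2(1)
    define w where "w = (t1 \<cdot> w1) \<boxplus> (t2 \<cdot> w2)"
    have w: "w \<in> Hom C X A" using W H by (simp add: w_def Hom_iff)
    have sw: "s1 \<cdot> w = w1" "s2 \<cdot> w = w2" using W H Z by (simp_all add: w_def R)
    have "J \<cdot> w = z"
    proof (rule biproduct_in_eq[OF bE', of _ X])
      show "d1 \<cdot> (J \<cdot> w) = d1 \<cdot> z" "d2 \<cdot> (J \<cdot> w) = d2 \<cdot> z"
        using comp_reduce[OF dJ(1), of w] comp_reduce[OF dJ(2), of w] HomD[OF w] JQ H sw w1 w2
        by simp_all
    qed (use HomD[OF w] JQ Z H in \<open>auto simp: Hom_iff\<close>)
    then show "\<exists>w\<in>Hom C X A. J \<cdot> w = z" using w by blast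
  qed
  then have "is_extension C D A (J, Q)" by (rule extensionI[OF J Q _ epi])
  then show ?thesis using HomD(3)[OF A(1)] HomD(3)[OF D(1)] unfolding J_def Q_def by simp
qed

lemma kernel_of_pullback:
  assumes k: "is_kernel C R J" and R: "R \<in> Hom C E L" and J: "J \<in> Hom C K E" and b: "b \<in> Hom C N L"
    and pb: "is_pullback C R b u r" and u: "u \<in> Hom C P E"
    and j: "j \<in> Hom C K P" "u \<cdot> j = J" "r \<cdot> j = Zero C K N"
  shows "is_kernel C r j"
proof -
  have r: "r \<in> Hom C P N" and comm: "R \<cdot> u = b \<cdot> r"
    using pullback_Hom[OF pb R b] HomD[OF u] by (simp_all add: Hom_iff)
  note H [THEN Hom_data] = R J b u j(1) r
  show ?thesis
  proof (rule kernelI[OF r j(1,3)])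
    show "is_mono C j"
    proof (rule monoI[OF j(1)])
      fix X x assume x: "x \<in> Hom C X K" "j \<cdot> x = Zero C X P"
      note X [THEN Hom_data] = x(1)
      have "J \<cdot> x = u \<cdot> (j \<cdot> x)" using X H by (simp add: comp_reduce[OF j(2)])
      also have "\<dots> = Zero C X E" unfolding x(2) using X H by simp
      finally show "x = Zero C X K" by (rule mono_cancel_Zero[OF kernel_mono[OF k] J x(1)])
    qed
    fix X x assume x: "x \<in> Hom C X P" "r \<cdot> x = Zero C X N"
    note X [THEN Hom_data] = x(1)
    have "R \<cdot> (u \<cdot> x) = b \<cdot> (r \<cdot> x)" using X H by (simp add: comp_reduce[OF comm])
    also have "\<dots> = Zero C X L" unfolding x(2) using X H by simp
    finally obtain w where w: "w \<in> Hom C X K" "J \<cdot> w = u \<cdot> x"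
      using kernel_factor[OF k R, of "u \<cdot> x" X] X H by (auto simp: Hom_iff)
    note W [THEN Hom_data] = w(1)
    have "j \<cdot> w = x"
      by (rule pullback_eq[OF pb R b u, of _ X])
         (use W X H w(2) x(2) in \<open>auto simp: Hom_iff comp_reduce[OF j(2)] comp_reduce[OF j(3)]\<close>)
    then show "\<exists>w\<in>Hom C X K. j \<cdot> w = x" using w by blast
  qed
qed

text \<open>Any two extensions of \<open>N\<close> are pushouts of one: pull their direct sum back along the diagonal
  of \<open>N\<close> and take the two projections of the left end.\<close>

lemma obtain_diagonal_pullback:
  assumes x: "is_extension C N T (j, r)" and y: "is_extension C N T' (j', r')"
    and bT: "is_biproduct C T T' t1 t2 s1 s2"
    and bE: "is_biproduct C (Cod C j) (Cod C j') e1 e2 d1 d2"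
    and bN: "is_biproduct C N N n1 n2 m1 m2"
  obtains z where "is_pullback_extension C (n1 \<boxplus> n2)
      ((e1 \<cdot> j \<cdot> s1) \<boxplus> (e2 \<cdot> j' \<cdot> s2), (n1 \<cdot> r \<cdot> d1) \<boxplus> (n2 \<cdot> r' \<cdot> d2)) z"
    "is_extension C N (Cod C t1) z" "extension_arrow s1 z (j, r)" "extension_arrow s2 z (j', r')"
proof -
  obtain E where E: "j \<in> Hom C T E" "r \<in> Hom C E N" "Cod C j = E"
    using x extensionE by metis
  obtain E' where E': "j' \<in> Hom C T' E'" "r' \<in> Hom C E' N" "Cod C j' = E'"
    using y extensionE by metis
  note bE' = bE[unfolded E(3) E'(3)]
  define A where "A = Cod C t1"
  note A = biproduct_Hom(1,3,4)[OF bT, folded A_def]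
  define B where "B = Cod C e1"
  note B = biproduct_Hom[OF bE', folded B_def] and Be = biproduct_eqs[OF bE']
  define D where "D = Cod C n1"
  note D = biproduct_Hom[OF bN, folded D_def] and Dn = biproduct_eqs[OF bN]
  note H [THEN Hom_data] = E(1,2) E'(1,2) A(1,2,3) B(1,2,3,4) D(1,2,3,4)
  note R = Be Be[THEN comp_reduce] Dn Dn[THEN comp_reduce]
  define J where "J = (e1 \<cdot> j \<cdot> s1) \<boxplus> (e2 \<cdot> j' \<cdot> s2)"
  define Q where "Q = (n1 \<cdot> r \<cdot> d1) \<boxplus> (n2 \<cdot> r' \<cdot> d2)"
  have J: "J \<in> Hom C A B" and Q: "Q \<in> Hom C B D" using H by (simp_all add: J_def Q_def Hom_iff)
  have dJ: "d1 \<cdot> J = j \<cdot> s1" "d2 \<cdot> J = j' \<cdot> s2" using H by (simp_all add: J_def R)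
  have mQ: "m1 \<cdot> Q = r \<cdot> d1" "m2 \<cdot> Q = r' \<cdot> d2" using H by (simp_all add: Q_def R)
  have "is_extension C D A (J, Q)"
    using direct_sum_extension[OF x y bT bE bN] HomD(3)[OF A(1)] HomD(3)[OF D(1)]
    unfolding J_def Q_def by simp
  then have ker: "is_kernel C Q J" and epi: "is_epi C Q" and QJ: "Q \<cdot> J = Zero C A D"
    using extensionE by metis+
  have diag: "n1 \<boxplus> n2 \<in> Hom C N D" using H by (simp add: Hom_iff)
  obtain P u v where u: "u \<in> Hom C P B" and v: "v \<in> Hom C P N" and pb: "is_pullback C Q (n1 \<boxplus> n2) u v"
    and v_epi: "is_epi C v"
    using obtain_pullback_of_epi[OF epi Q diag] by blast
  note U [THEN Hom_data] = u v J Q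
  obtain l where l: "l \<in> Hom C A P" "u \<cdot> l = J" "v \<cdot> l = Zero C A N"
    using pullback_factor[OF pb Q diag u J, of "Zero C A N"] QJ H by (auto simp: Hom_iff)
  note L [THEN Hom_data] = l(1)
  have "is_kernel C v l" by (rule kernel_of_pullback[OF ker Q J diag pb u l])
  then have ext: "is_extension C N A (l, v)" by (rule extensionI[OF l(1) v _ v_epi])
  have "Q \<cdot> u = (n1 \<boxplus> n2) \<cdot> v" using pullback_Hom(3)[OF pb Q diag] .
  then have "m1 \<cdot> (Q \<cdot> u) = v" "m2 \<cdot> (Q \<cdot> u) = v"
    using U H by (simp_all add: R)
  then have rd: "r \<cdot> (d1 \<cdot> u) = v" "r' \<cdot> (d2 \<cdot> u) = v"
    using U H by (simp_all add: comp_reduce[OF mQ(1)] comp_reduce[OF mQ(2)])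
  have "extension_arrow s1 (l, v) (j, r)"
    by (rule extension_arrowI[of "d1 \<cdot> u" P E _ _ _ _ _ A T])
       (use U L H E l E' rd dJ in \<open>auto simp: Hom_iff\<close>)
  moreover have "extension_arrow s2 (l, v) (j', r')"
    by (rule extension_arrowI[of "d2 \<cdot> u" P E' _ _ _ _ _ A T'])
       (use U L H E l E' rd dJ in \<open>auto simp: Hom_iff\<close>)
  moreover have "is_pullback_extension C (n1 \<boxplus> n2) (J, Q) (l, v)"
    unfolding is_pullback_extension.simps
    by (intro exI[of _ u]) (use pb l U L H in \<open>simp add: Hom_iff\<close>)
  ultimately show thesis
    using that[of "(l, v)"] ext HomD(3)[OF A(1)] unfolding J_def Q_def by simp
qed

text \<open>An arrow from \<open>z\<close> to both summands is an arrow to their direct sum over the diagonal, hence one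
  to the pullback. It also shows that the pulled back arrow onto \<open>N\<close> is an epimorphism.\<close>

lemma diagonal_pullback_of_common:
  assumes x: "is_extension C N T (j, r)" and y: "is_extension C N T' (j', r')"
    and bT: "is_biproduct C T T' t1 t2 s1 s2"
    and bE: "is_biproduct C (Cod C j) (Cod C j') e1 e2 d1 d2"
    and bN: "is_biproduct C N N n1 n2 m1 m2"
    and z: "is_extension C N K z" and a: "a \<in> Hom C K T" "extension_arrow a z (j, r)"
    and b: "b \<in> Hom C K T'" "extension_arrow b z (j', r')"
    and pbe: "is_pullback_extension C (n1 \<boxplus> n2)
      ((e1 \<cdot> j \<cdot> s1) \<boxplus> (e2 \<cdot> j' \<cdot> s2), (n1 \<cdot> r \<cdot> d1) \<boxplus> (n2 \<cdot> r' \<cdot> d2)) w"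
  shows "is_extension C N (Cod C t1) w" "extension_arrow ((t1 \<cdot> a) \<boxplus> (t2 \<cdot> b)) z w"
proof -
  obtain i q l v where zw: "z = (i, q)" "w = (l, v)" by (metis surj_pair)
  obtain E where E: "j \<in> Hom C T E" "r \<in> Hom C E N" "r \<cdot> j = Zero C T N" "Cod C j = E"
    using x extensionE by metis
  obtain E' where E': "j' \<in> Hom C T' E'" "r' \<in> Hom C E' N" "r' \<cdot> j' = Zero C T' N" "Cod C j' = E'"
    using y extensionE by metis
  obtain F where F: "i \<in> Hom C K F" "q \<in> Hom C F N" "is_epi C q" "q \<cdot> i = Zero C K N"
    using z zw extensionE by metis
  note bE' = bE[unfolded E(4) E'(4)]
  define A where "A = Cod C t1"
  note A = biproduct_Hom[OF bT, folded A_def] and At = biproduct_eqs[OF bT]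
  define B where "B = Cod C e1"
  note B = biproduct_Hom[OF bE', folded B_def] and Be = biproduct_eqs[OF bE']
  define D where "D = Cod C n1"
  note D = biproduct_Hom(1,2)[OF bN, folded D_def]
  obtain f where f: "f \<in> Hom C F E" "f \<cdot> i = j \<cdot> a" "r \<cdot> f = q"
    using extension_arrowE a(2) F(1) E(1) unfolding zw by metis
  obtain g where g: "g \<in> Hom C F E'" "g \<cdot> i = j' \<cdot> b" "r' \<cdot> g = q"
    using extension_arrowE b(2) F(1) E'(1) unfolding zw by metis
  note H [THEN Hom_data] = E(1,2) E'(1,2) F(1,2) f(1) g(1) a(1) b(1) A(1,2,3,4) B(1,2,3,4) D(1,2)
  note R = At At[THEN comp_reduce] Be Be[THEN comp_reduce] E(3) comp_reduce[OF E(3)] E'(3)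
    comp_reduce[OF E'(3)]
  define J where "J = (e1 \<cdot> j \<cdot> s1) \<boxplus> (e2 \<cdot> j' \<cdot> s2)"
  define Q where "Q = (n1 \<cdot> r \<cdot> d1) \<boxplus> (n2 \<cdot> r' \<cdot> d2)"
  have J: "J \<in> Hom C A B" and Q: "Q \<in> Hom C B D" using H by (simp_all add: J_def Q_def Hom_iff)
  have "is_extension C D A (J, Q)"
    using direct_sum_extension[OF x y bT bE bN] HomD(3)[OF A(1)] HomD(3)[OF D(1)]
    unfolding J_def Q_def by simp
  then have ker: "is_kernel C Q J" using extensionE by metis
  have diag: "n1 \<boxplus> n2 \<in> Hom C N D" using H by (simp add: Hom_iff)
  obtain u where u: "is_pullback C Q (n1 \<boxplus> n2) u v" "l \<in> Hom C A (Dom C u)" "u \<cdot> l = J"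
    "v \<cdot> l = Zero C A N"
    using pbe HomD[OF J] HomD[OF diag] unfolding zw is_pullback_extension.simps J_def[symmetric] Q_def[symmetric]
    by auto
  define P where "P = Dom C u"
  have uP: "u \<in> Hom C P B" and v: "v \<in> Hom C P N"
    using pullback_Hom[OF u(1) Q diag] by (simp_all add: P_def)
  have l: "l \<in> Hom C A P" using u(2) by (simp add: P_def)
  have lker: "is_kernel C v l" by (rule kernel_of_pullback[OF ker Q J diag u(1) uP l u(3,4)])
  note U [THEN Hom_data] = uP v l J Q
  define \<phi> where "\<phi> = (e1 \<cdot> f) \<boxplus> (e2 \<cdot> g)"
  have \<phi>: "\<phi> \<in> Hom C F B" using H by (simp add: \<phi>_def Hom_iff)
  have "Q \<cdot> \<phi> = (n1 \<boxplus> n2) \<cdot> q"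
    using H f(3) g(3) by (simp add: Q_def \<phi>_def R)
  then obtain h where h: "h \<in> Hom C F P" "u \<cdot> h = \<phi>" "v \<cdot> h = q"
    using pullback_factor[OF u(1) Q diag uP \<phi> F(2)] by blast
  note HH [THEN Hom_data] = h(1) \<phi>
  have "is_epi C v"
  proof (rule epiI[OF v])
    fix L y assume y: "y \<in> Hom C N L" "y \<cdot> v = Zero C P L"
    have "y \<cdot> q = (y \<cdot> v) \<cdot> h" using h(3) HomD[OF y(1)] HH U by simp
    also have "\<dots> = Zero C F L" unfolding y(2) using HH U Hom_objects[OF y(1)] by simp
    finally show "y = Zero C N L" by (rule epi_cancel_Zero[OF F(3,2) y(1)])
  qed
  then show "is_extension C N (Cod C t1) w"
    using extensionI[OF l v lker] HomD(3)[OF A(1)] zw by simp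
  define c where "c = (t1 \<cdot> a) \<boxplus> (t2 \<cdot> b)"
  have c: "c \<in> Hom C K A" using H by (simp add: c_def Hom_iff)
  have \<phi>i: "\<phi> \<cdot> i = J \<cdot> c"
    using H f(2) g(2) by (simp add: \<phi>_def J_def c_def R)
  have "h \<cdot> i = l \<cdot> c"
    by (rule pullback_eq[OF u(1) Q diag uP, of _ K])
       (use \<phi>i U HH H HomD[OF c] F(4) in \<open>auto simp: Hom_iff comp_reduce[OF h(2)] comp_reduce[OF h(3)]
          comp_reduce[OF u(3)] comp_reduce[OF u(4)]\<close>)
  then show "extension_arrow ((t1 \<cdot> a) \<boxplus> (t2 \<cdot> b)) z w"
    unfolding zw c_def[symmetric] by (rule extension_arrowI[OF h(1) _ h(3) F(1) l])
qed

text \<open>The pair \<open>(a, b)\<close> is an arrow from \<open>z\<close> to the diagonal pullback of the direct sum, and followed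
  by the codiagonal it becomes \<open>a + b\<close>. So a pushout along the codiagonal is a pushout of \<open>z\<close> along
  \<open>a + b\<close>.\<close>

lemma Baer_sum_iff:
  assumes x: "is_extension C N T x" and y: "is_extension C N T y" and z: "is_extension C N K z"
    and a: "a \<in> Hom C K T" "extension_arrow a z x" and b: "b \<in> Hom C K T" "extension_arrow b z y"
  shows "is_Baer_sum C x y e \<longleftrightarrow> e \<in> pushout_class N z T (a \<boxplus> b)"
proof -
  obtain j r j' r' where xy: "x = (j, r)" "y = (j', r')" by (metis surj_pair)
  note X = x[unfolded xy] and Y = y[unfolded xy] and aX = a(2)[unfolded xy] and bY = b(2)[unfolded xy]
  obtain E where E: "j \<in> Hom C T E" "r \<in> Hom C E N" using X extensionE by metis
  obtain E' where E': "j' \<in> Hom C T E'" "r' \<in> Hom C E' N" using Y extensionE by metis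
  note ends = HomD[OF E(1)] HomD[OF E(2)] HomD[OF E'(1)] HomD[OF E'(2)]
  note H [THEN Hom_data] = E(1,2) E'(1,2) a(1) b(1)
  have codiag: "s1 \<boxplus> s2 \<in> Hom C (Cod C t1) T"
      "(t1 \<cdot> a) \<boxplus> (t2 \<cdot> b) \<in> Hom C K (Cod C t1)"
      "(s1 \<boxplus> s2) \<cdot> ((t1 \<cdot> a) \<boxplus> (t2 \<cdot> b)) = a \<boxplus> b"
    if bT: "is_biproduct C T T t1 t2 s1 s2" for t1 t2 s1 s2
  proof -
    define A where "A = Cod C t1"
    note A = biproduct_Hom[OF bT, folded A_def] and At = biproduct_eqs[OF bT]
    note AH [THEN Hom_data] = A(1,2,3,4) a(1)
    show "s1 \<boxplus> s2 \<in> Hom C (Cod C t1) T" "(t1 \<cdot> a) \<boxplus> (t2 \<cdot> b) \<in> Hom C K (Cod C t1)"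
      "(s1 \<boxplus> s2) \<cdot> ((t1 \<cdot> a) \<boxplus> (t2 \<cdot> b)) = a \<boxplus> b"
      using AH H by (simp_all add: Hom_iff At[THEN comp_reduce])
  qed
  show ?thesis
  proof
    assume "is_Baer_sum C x y e"
    then obtain t1 t2 s1 s2 e1 e2 d1 d2 n1 n2 m1 m2 w where
      bT: "is_biproduct C T T t1 t2 s1 s2" and
      bE: "is_biproduct C (Cod C j) (Cod C j') e1 e2 d1 d2" and
      bN: "is_biproduct C N N n1 n2 m1 m2" and
      pbe: "is_pullback_extension C (n1 \<boxplus> n2)
          ((e1 \<cdot> j \<cdot> s1) \<boxplus> (e2 \<cdot> j' \<cdot> s2), (n1 \<cdot> r \<cdot> d1) \<boxplus> (n2 \<cdot> r' \<cdot> d2)) w" and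
      poe: "is_pushout_extension C (s1 \<boxplus> s2) w e"
      unfolding xy is_Baer_sum.simps ends by (elim exE conjE)
    have w: "is_extension C N (Cod C t1) w" "extension_arrow ((t1 \<cdot> a) \<boxplus> (t2 \<cdot> b)) z w"
      by (rule diagonal_pullback_of_common[OF X Y bT bE bN z a(1) aX b(1) bY pbe])+
    note cd = codiag[OF bT]
    have e: "is_extension C N T e" "extension_arrow (s1 \<boxplus> s2) w e"
      by (rule pushout_extension_is_extension[OF w(1) cd(1) poe])+
    show "e \<in> pushout_class N z T (a \<boxplus> b)"
      using e extension_arrow_comp[OF z w(1) e(1) cd(2) w(2) cd(1) e(2)] cd(3)
      by (simp add: pushout_class_def)
  next
    assume "e \<in> pushout_class N z T (a \<boxplus> b)"
    then have e: "is_extension C N T e" "extension_arrow (a \<boxplus> b) z e"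
      by (simp_all add: pushout_class_def)
    obtain t1 t2 s1 s2 where bT: "is_biproduct C T T t1 t2 s1 s2" using ex_biproduct H by blast
    obtain e1 e2 d1 d2 where bE: "is_biproduct C (Cod C j) (Cod C j') e1 e2 d1 d2"
      using ex_biproduct[of "Cod C j" "Cod C j'"] H by auto
    obtain n1 n2 m1 m2 where bN: "is_biproduct C N N n1 n2 m1 m2" using ex_biproduct H by blast
    obtain w where pbe: "is_pullback_extension C (n1 \<boxplus> n2)
          ((e1 \<cdot> j \<cdot> s1) \<boxplus> (e2 \<cdot> j' \<cdot> s2), (n1 \<cdot> r \<cdot> d1) \<boxplus> (n2 \<cdot> r' \<cdot> d2)) w"
      by (rule obtain_diagonal_pullback[OF X Y bT bE bN])
    have w: "is_extension C N (Cod C t1) w" "extension_arrow ((t1 \<cdot> a) \<boxplus> (t2 \<cdot> b)) z w"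
      by (rule diagonal_pullback_of_common[OF X Y bT bE bN z a(1) aX b(1) bY pbe])+
    note cd = codiag[OF bT]
    have "extension_arrow (s1 \<boxplus> s2) w e"
      by (rule extension_arrow_factor[OF z w(1) e(1) cd(2) w(2) cd(1)]) (use e cd(3) in simp)
    then have poe: "is_pushout_extension C (s1 \<boxplus> s2) w e"
      by (rule extension_arrow_imp_pushout[OF w(1) e(1) cd(1)])
    show "is_Baer_sum C x y e"
      unfolding xy is_Baer_sum.simps ends
      by (intro exI conjI) (rule bT, use bE H in simp, rule bN, rule pbe, rule poe)
  qed
qed

lemma Ext_mult_pushout_class:
  assumes z: "is_extension C N K z" and a: "a \<in> Hom C K T" and b: "b \<in> Hom C K T"
  shows "pushout_class N z T a \<otimes>\<^bsub>Ext_group C N T\<^esub> pushout_class N z T b = pushout_class N z T (a \<boxplus> b)"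
proof -
  have iff: "is_Baer_sum C x y e \<longleftrightarrow> e \<in> pushout_class N z T (a \<boxplus> b)"
    if "x \<in> pushout_class N z T a" "y \<in> pushout_class N z T b" for x y e
    using that Baer_sum_iff[OF _ _ z a _ b] by (simp add: pushout_class_def)
  obtain x y where "x \<in> pushout_class N z T a" "y \<in> pushout_class N z T b"
    using pushout_class_nonempty[OF z a] pushout_class_nonempty[OF z b] by metis
  then have "{e. \<exists>x\<in>pushout_class N z T a. \<exists>y\<in>pushout_class N z T b. is_Baer_sum C x y e} =
      pushout_class N z T (a \<boxplus> b)"
    using iff by blast
  then show ?thesis by (simp add: Ext_group_def)
qed

text \<open>Write \<open>z\<close> and a member of \<open>Y\<close> as pushouts of one extension \<open>w\<close>, along \<open>s\<close> and \<open>t\<close>. Then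
  \<open>a s + t\<close> extends along the left arrow of \<open>w\<close>, as its pushout splits, so \<open>t\<close> and \<open>- a s\<close> have the
  same pushouts.\<close>

lemma Ext_inverse_unique:
  assumes z: "is_extension C N K z" and a: "a \<in> Hom C K T"
    and Y: "Y \<in> carrier (Ext_group C N T)"
    and one: "pushout_class N z T a \<otimes>\<^bsub>Ext_group C N T\<^esub> Y = \<one>\<^bsub>Ext_group C N T\<^esub>"
  shows "Y = pushout_class N z T (neg a)"
proof -
  obtain y where y: "is_extension C N T y" and Y_eq: "Y = pushout_class N y T (Id C T)"
    using Ext_carrierE[OF Y] by blast
  obtain j r j' r' where zy: "z = (j, r)" "y = (j', r')" by (metis surj_pair)
  obtain E where E: "j \<in> Hom C K E" "r \<in> Hom C E N" using z zy extensionE by metis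
  obtain E' where E': "j' \<in> Hom C T E'" using y zy extensionE by metis
  note H [THEN Hom_data] = E(1,2) E'(1) a
  obtain t1 t2 s t where bT: "is_biproduct C K T t1 t2 s t" using ex_biproduct H by blast
  obtain e1 e2 d1 d2 where bE: "is_biproduct C (Cod C j) (Cod C j') e1 e2 d1 d2"
    using ex_biproduct[of "Cod C j" "Cod C j'"] H by auto
  obtain n1 n2 m1 m2 where bN: "is_biproduct C N N n1 n2 m1 m2" using ex_biproduct H by blast
  define A where "A = Cod C t1"
  have s: "s \<in> Hom C A K" and t: "t \<in> Hom C A T"
    unfolding A_def by (rule biproduct_Hom[OF bT])+
  obtain w where w: "is_extension C N A w" and arr: "extension_arrow s w z" "extension_arrow t w y"
    using obtain_diagonal_pullback[OF z[unfolded zy] y[unfolded zy] bT bE bN] unfolding A_def zy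
    by metis
  note S [THEN Hom_data] = s t
  have "z \<in> pushout_class N w K s" "y \<in> pushout_class N w T t"
    using z y arr by (auto simp: pushout_class_def)
  note zc = pushout_class_comp[OF w s _ this(1)] and yc = pushout_class_comp[OF w t _ this(2)]
  have Y_w: "Y = pushout_class N w T t"
    using yc[of "Id C T" T] S H by (simp add: Y_eq Hom_iff)
  have as: "a \<cdot> s \<in> Hom C A T" using S H by (simp add: Hom_iff)
  obtain l v where w_eq: "w = (l, v)" by (metis surj_pair)
  note W = w[unfolded w_eq]
  have "pushout_class N w T ((a \<cdot> s) \<boxplus> t) = pushout_class N w T (Zero C A T)"
    using Ext_mult_pushout_class[OF w as t] one Ext_one_eq[OF w, of T] H zc[OF a] Y_w by simp
  then have "\<exists>h\<in>Hom C (Cod C l) T. ((a \<cdot> s) \<boxplus> t) \<boxminus> Zero C A T = h \<cdot> l"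
    unfolding w_eq
    by (subst (asm) pushout_class_eq_iff[OF W]) (use S H Hom_objects[OF s] in \<open>auto simp: Hom_iff\<close>)
  moreover have "((a \<cdot> s) \<boxplus> t) \<boxminus> Zero C A T = t \<boxminus> neg (a \<cdot> s)"
    using S H Hom_objects[OF s] by (simp add: Plus_commute)
  ultimately have "pushout_class N w T t = pushout_class N w T (neg (a \<cdot> s))"
    unfolding w_eq
    by (subst pushout_class_eq_iff[OF W]) (use S H Hom_objects[OF s] in \<open>auto simp: Hom_iff\<close>)
  also have "neg (a \<cdot> s) = neg a \<cdot> s" using S H by simp
  also have "pushout_class N w T (neg a \<cdot> s) = pushout_class N z T (neg a)"
    using zc[of "neg a" T] H by (simp add: Hom_iff)
  finally show ?thesis using Y_w by simp
qed

lemma Ext_inv_pushout_class: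
  assumes z: "is_extension C N K z" and a: "a \<in> Hom C K T"
  shows "inv\<^bsub>Ext_group C N T\<^esub> (pushout_class N z T a) = pushout_class N z T (neg a)"
  unfolding m_inv_def
proof (rule the_equality)
  note H [THEN Hom_data] = a
  have na: "neg a \<in> Hom C K T" using H by (simp add: Hom_iff)
  show "pushout_class N z T (neg a) \<in> carrier (Ext_group C N T) \<and>
    pushout_class N z T a \<otimes>\<^bsub>Ext_group C N T\<^esub> pushout_class N z T (neg a) = \<one>\<^bsub>Ext_group C N T\<^esub> \<and>
    pushout_class N z T (neg a) \<otimes>\<^bsub>Ext_group C N T\<^esub> pushout_class N z T a = \<one>\<^bsub>Ext_group C N T\<^esub>"
    using pushout_class_in_carrier[OF z na] Ext_mult_pushout_class[OF z a na]
      Ext_mult_pushout_class[OF z na a] Ext_one_eq[OF z Hom_objects(2)[OF a]] H by simp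
qed (use Ext_inverse_unique[OF z a] in blast)

end

section \<open>Representable subfunctors of Ext\<close>

context projective_subcategory
begin

text \<open>An isomorphism from \<open>\<T>(T0, ?)\<close> onto a subfunctor sends \<open>a\<close> to the pushout along \<open>a\<close> of the
  extension \<open>T0 \<rightarrow> M \<rightarrow> N\<close> to which it sends the identity. Its injectivity says that no non-zero
  arrow \<open>T0 \<rightarrow> T'\<close> extends to \<open>M\<close>.\<close>

lemma detected_imp_no_representable:
  assumes det: "nonzero_mono_detected C \<T>"
  shows "no_representable_Ext_subfunctor C \<T>"
  unfolding no_representable_Ext_subfunctor_def
proof (intro ballI impI notI, elim exE conjE bexE)
  fix N F T1 T0
  assume F: "Ext_subfunctor C \<T> N F" and T1: "T1 \<in> \<T>" "F T1 \<noteq> {\<one>\<^bsub>Ext_group C N T1\<^esub>}"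
    and T0: "T0 \<in> \<T>" and rep: "iso_to_representable C \<T> N F T0"
  obtain \<eta> where iso: "\<And>T. T \<in> \<T> \<Longrightarrow> \<eta> T \<in> iso (hom_group C T0 T) (Ext_group C N T\<lparr>carrier := F T\<rparr>)"
    and nat: "\<And>T T' a x. T \<in> \<T> \<Longrightarrow> T' \<in> \<T> \<Longrightarrow> a \<in> Hom C T T' \<Longrightarrow> x \<in> Hom C T0 T \<Longrightarrow>
      \<eta> T' (a \<cdot> x) = Ext_map C a (\<eta> T x)"
    using rep unfolding iso_to_representable_def by blast
  have bij: "bij_betw (\<eta> T) (Hom C T0 T) (F T)" if "T \<in> \<T>" for T
    using iso[OF that] by (simp add: iso_def)
  have O: "T0 \<in> Ob C" by (rule T_in_Ob[OF T0])
  have Id: "Id C T0 \<in> Hom C T0 T0" using O by (simp add: Hom_iff)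
  have "\<eta> T0 (Id C T0) \<in> F T0" using bij[OF T0] Id by (auto simp: bij_betw_def)
  moreover have "F T0 \<subseteq> carrier (Ext_group C N T0)"
    using F T0 unfolding Ext_subfunctor_def by (auto dest: subgroup.subset)
  ultimately obtain z where z: "is_extension C N T0 z"
    and \<eta>_Id: "\<eta> T0 (Id C T0) = pushout_class N z T0 (Id C T0)"
    using Ext_carrierE by (metis subsetD)
  have \<eta>: "\<eta> T a = pushout_class N z T a" if T: "T \<in> \<T>" and a: "a \<in> Hom C T0 T" for T a
    using nat[OF T0 T a Id] Ext_map_pushout_class[OF z Id a] HomD[OF a] by (simp add: \<eta>_Id)
  obtain j r where z_eq: "z = (j, r)" by (metis surj_pair)
  obtain M where j: "j \<in> Hom C T0 M" "is_mono C j" "Cod C j = M"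
    using z z_eq extensionE by metis
  note H [THEN Hom_data] = j(1)
  have "j \<noteq> Zero C T0 M"
  proof
    assume "j = Zero C T0 M"
    then have "\<exists>!a. a \<in> Hom C T0 T1"
      using mono_eq_Zero_iff[OF j(2,1)] T_in_Ob[OF T1(1)] by (auto simp: is_zero_object_def)
    moreover have "Zero C T0 T1 \<in> Hom C T0 T1" using O T_in_Ob[OF T1(1)] by (simp add: Hom_iff)
    ultimately have "Hom C T0 T1 = {Zero C T0 T1}" by auto
    then have "F T1 = {\<eta> T1 (Zero C T0 T1)}" using bij[OF T1(1)] by (auto simp: bij_betw_def)
    also have "\<dots> = {\<one>\<^bsub>Ext_group C N T1\<^esub>}"
      using \<eta>[OF T1(1)] Ext_one_eq[OF z] O T_in_Ob[OF T1(1)] by (simp add: Hom_iff)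
    finally show False using T1(2) by simp
  qed
  then obtain T' h where h: "T' \<in> \<T>" "h \<in> Hom C M T'" "h \<cdot> j \<noteq> Zero C T0 T'"
    using det T0 j H unfolding nonzero_mono_detected_def by blast
  note HH [THEN Hom_data] = h(2)
  have hj: "h \<cdot> j \<in> Hom C T0 T'" and Z: "Zero C T0 T' \<in> Hom C T0 T'"
    using H HH by (auto simp: Hom_iff)
  have "pushout_class N z T' (h \<cdot> j) = pushout_class N z T' (Zero C T0 T')"
    unfolding z_eq
    by (subst pushout_class_eq_iff[OF z[unfolded z_eq] hj Z])
       (use h(2) j(3) H HH in \<open>auto intro!: bexI[of _ h] simp: Hom_iff\<close>)
  then have "\<eta> T' (h \<cdot> j) = \<eta> T' (Zero C T0 T')" using \<eta>[OF h(1)] hj Z by simp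
  then have "h \<cdot> j = Zero C T0 T'"
    using bij[OF h(1)] hj Z by (auto simp: bij_betw_def dest: inj_onD)
  then show False using h(3) by simp
qed

text \<open>If every arrow from \<open>M\<close> into \<open>\<T>\<close> kills the monomorphism \<open>j: T0 \<rightarrow> M\<close>, then two arrows
  from \<open>T0\<close> into \<open>\<T>\<close> have the same pushout of \<open>T0 \<rightarrow> M \<rightarrow> N\<close> only if they are equal, so these
  pushouts form a copy of \<open>\<T>(T0, ?)\<close> inside \<open>Ext(N, ?)\<close>.\<close>

lemma no_representable_imp_detected:
  assumes no: "no_representable_Ext_subfunctor C \<T>"
  shows "nonzero_mono_detected C \<T>"
  unfolding nonzero_mono_detected_def
proof (intro ballI impI, rule ccontr)
  fix T0 M j assume T0: "T0 \<in> \<T>" and M: "M \<in> Ob C" and j: "j \<in> Hom C T0 M"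
    "is_mono C j \<and> j \<noteq> Zero C T0 M"
    and none: "\<not> (\<exists>T'\<in>\<T>. \<exists>h\<in>Hom C M T'. h \<cdot> j \<noteq> Zero C T0 T')"
  obtain N r where r: "r \<in> Hom C M N" "is_cokernel C j r" using obtain_cokernel[OF j(1)] by blast
  note H [THEN Hom_data] = j(1) r(1)
  have "is_kernel C r j" using mono_kernel_of_cokernel[OF _ j(1) r(2,1)] j(2) by blast
  then have z: "is_extension C N T0 (j, r)" using r(2) H by simp
  define \<eta> where "\<eta> T a = pushout_class N (j, r) T a" for T a
  define F where "F T = \<eta> T ` Hom C T0 T" for T
  have inj: "a = b" if T: "T \<in> \<T>" and ab: "a \<in> Hom C T0 T" "b \<in> Hom C T0 T" and eq: "\<eta> T a = \<eta> T b"
    for T a b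
  proof -
    obtain h where "h \<in> Hom C (Cod C j) T" "a \<boxminus> b = h \<cdot> j"
      using eq pushout_class_eq_iff[OF z ab] unfolding \<eta>_def by blast
    then have "a \<boxminus> b = Zero C T0 T" using none T H by auto
    then show ?thesis using diff_eq_Zero_iff[OF ab] by blast
  qed
  have one: "\<one>\<^bsub>Ext_group C N T\<^esub> = \<eta> T (Zero C T0 T)" if "T \<in> \<T>" for T
    using Ext_one_eq[OF z T_in_Ob[OF that]] by (simp add: \<eta>_def)
  have mult: "\<eta> T a \<otimes>\<^bsub>Ext_group C N T\<^esub> \<eta> T b = \<eta> T (a \<boxplus> b)"
    if "a \<in> Hom C T0 T" "b \<in> Hom C T0 T" for T a b
    using Ext_mult_pushout_class[OF z that] by (simp add: \<eta>_def)
  have map: "Ext_map C a (\<eta> T x) = \<eta> T' (a \<cdot> x)" if "x \<in> Hom C T0 T" "a \<in> Hom C T T'" for T T' a x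
    using Ext_map_pushout_class[OF z that] by (simp add: \<eta>_def)
  have carrier: "\<eta> T a \<in> carrier (Ext_group C N T)" if "a \<in> Hom C T0 T" for T a
    using pushout_class_in_carrier[OF z that] by (simp add: \<eta>_def)
  have "subgroup (F T) (Ext_group C N T)" if T: "T \<in> \<T>" for T
  proof
    show "F T \<subseteq> carrier (Ext_group C N T)" using carrier by (auto simp: F_def)
    show "\<one>\<^bsub>Ext_group C N T\<^esub> \<in> F T"
      using one[OF T] H T_in_Ob[OF T] by (auto simp: F_def Hom_iff)
    fix X assume "X \<in> F T"
    then obtain a where a: "a \<in> Hom C T0 T" "X = \<eta> T a" by (auto simp: F_def)
    have "inv\<^bsub>Ext_group C N T\<^esub> X = \<eta> T (neg a)"
      using Ext_inv_pushout_class[OF z a(1)] a(2) by (simp add: \<eta>_def)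
    then show "inv\<^bsub>Ext_group C N T\<^esub> X \<in> F T" using HomD[OF a(1)] by (auto simp: F_def Hom_iff)
    fix Y assume "Y \<in> F T"
    then obtain b where b: "b \<in> Hom C T0 T" "Y = \<eta> T b" by (auto simp: F_def)
    have "a \<boxplus> b \<in> Hom C T0 T" using HomD[OF a(1)] HomD[OF b(1)] by (simp add: Hom_iff)
    then show "X \<otimes>\<^bsub>Ext_group C N T\<^esub> Y \<in> F T" using mult[OF a(1) b(1)] a(2) b(2) by (simp add: F_def)
  qed
  moreover have "Ext_map C a ` F T \<subseteq> F T'" if a: "a \<in> Hom C T T'" for T T' a
  proof (rule image_subsetI)
    fix X assume "X \<in> F T"
    then obtain x where x: "x \<in> Hom C T0 T" "X = \<eta> T x" by (auto simp: F_def)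
    have "a \<cdot> x \<in> Hom C T0 T'" using Comp_in_Hom[OF x(1) a] .
    then show "Ext_map C a X \<in> F T'" using map[OF x(1) a] x(2) by (simp add: F_def)
  qed
  ultimately have "Ext_subfunctor C \<T> N F" unfolding Ext_subfunctor_def by blast
  moreover have "iso_to_representable C \<T> N F T0"
    unfolding iso_to_representable_def
  proof (intro exI[of _ \<eta>] conjI ballI)
    fix T assume T: "T \<in> \<T>"
    have "inj_on (\<eta> T) (Hom C T0 T)" using inj[OF T] by (auto intro: inj_onI)
    then show "\<eta> T \<in> iso (hom_group C T0 T) (Ext_group C N T\<lparr>carrier := F T\<rparr>)"
      using mult by (auto simp: iso_def hom_def bij_betw_def F_def)
  next
    fix T T' a x assume "a \<in> Hom C T T'" "x \<in> Hom C T0 T"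
    then show "\<eta> T' (a \<cdot> x) = Ext_map C a (\<eta> T x)" using map by simp
  qed
  moreover have Id: "Id C T0 \<in> Hom C T0 T0" and Z: "Zero C T0 T0 \<in> Hom C T0 T0"
    using H by (simp_all add: Hom_iff)
  have "Id C T0 \<noteq> Zero C T0 T0"
    using mono_eq_Zero_iff[OF _ j(1)] zero_object_iff[of T0] j(2) H by blast
  then have ne: "\<eta> T0 (Id C T0) \<noteq> \<one>\<^bsub>Ext_group C N T0\<^esub>"
    using inj[OF T0 Id Z] one[OF T0] by metis
  have "F T0 \<noteq> {\<one>\<^bsub>Ext_group C N T0\<^esub>}" using ne Id by (auto simp: F_def)
  moreover have "carrier (Ext_group C N T0) \<noteq> {\<one>\<^bsub>Ext_group C N T0\<^esub>}" using ne carrier[OF Id] by blast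
  moreover have "N \<in> Ob C" using H by blast
  ultimately show False
    using no T0 unfolding no_representable_Ext_subfunctor_def by blast
qed

end

theorem theorem2p5p4:
  fixes \<A> :: "('o, 'm) preadditive_cat"
    and \<T> :: "'o set"
    and i q k p :: "'o \<Rightarrow> 'm"
  assumes "abelian_category \<A>"
    and "full_additive_subcategory \<A> \<T>"
    and "functorially_finite \<A> \<T>"
    and "\<forall>T\<in>\<T>. is_projective \<A> T"
    and "closed_under_summands \<A> \<T>"
    and "preenvelope_choice \<A> \<T> i q"
    and "precover_choice \<A> \<T> k p"
  shows "(embeds_in_injectives \<A> \<T> \<longrightarrow> nonzero_through_injective \<A> \<T>) \<and>
         (nonzero_through_injective \<A> \<T> \<longrightarrow> weakly_balanced \<A> \<T> i q k p) \<and>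
         (weakly_balanced \<A> \<T> i q k p \<longleftrightarrow> epi_with_invisible_kernel_iso \<A> \<T>) \<and>
         (epi_with_invisible_kernel_iso \<A> \<T> \<longleftrightarrow> nonzero_mono_detected \<A> \<T>) \<and>
         (nonzero_mono_detected \<A> \<T> \<longleftrightarrow> no_representable_Ext_subfunctor \<A> \<T>) \<and>
         (enough_injectives \<A> \<longrightarrow>
            (nonzero_through_injective \<A> \<T> \<longleftrightarrow> weakly_balanced \<A> \<T> i q k p) \<and>
            (weakly_balanced \<A> \<T> i q k p \<longleftrightarrow> epi_with_invisible_kernel_iso \<A> \<T>) \<and>
            (epi_with_invisible_kernel_iso \<A> \<T> \<longleftrightarrow> nonzero_mono_detected \<A> \<T>) \<and>
            (nonzero_mono_detected \<A> \<T> \<longleftrightarrow> no_representable_Ext_subfunctor \<A> \<T>))"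
proof -
  have "projective_subcategory \<A> \<T>"
    using assms(1,2,4,5) unfolding projective_subcategory_def projective_subcategory_axioms_def by blast
  then interpret projective_subcategory \<A> \<T> .
  have 34: "weakly_balanced \<A> \<T> i q k p \<longleftrightarrow> epi_with_invisible_kernel_iso \<A> \<T>"
    using weakly_balanced_imp_epi_iso epi_iso_imp_weakly_balanced assms(6,7) by blast
  show ?thesis
    using 34 epi_iso_iff_detected embeds_imp_nonzero_through_injective
      nonzero_through_injective_imp_detected detected_imp_nonzero_through_injective
      detected_imp_no_representable no_representable_imp_detected by blast
qed

end
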